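(* Let $T>0$ and let $\{f^n\}_{n\in\mathbb{N}}$ be a sequence of solutions of (CR) that is uniformly bounded in $L^\infty([0,T],L^2(\mathbb{R}^2))$. Then there exist a solution $f$ of (CR) and a subsequence of $\{f^n\}_{n\in\mathbb{N}}$ which converges to $f$ in the weak-* topology of $L^\infty([0,T],L^2(\mathbb{R}^2))$.
   Context: (CR) is the equation $-i\partial_tg=\mathcal{T}(g,g,g)$ for $g=g(t,\xi)$, $\xi\in\mathbb{R}^2$, where $$\mathcal{T}(f,g,h)(\xi)=\int_{-1}^1\int_{\mathbb{R}^2}f(\xi+x)\,\overline{g(\xi+x+\lambda x^\perp)}\,h(\xi+\lambda x^\perp)\,dx\,d\lambda$$ and $x^\perp$ is the rotation of $x$ by $+\pi/2$. $\mathcal{T}$ is bounded from $(L^2(\mathbb{R}^2))^3$ to $L^2(\mathbb{R}^2)$; a solution in $L^\infty([0,T],L^2)$ is a function satisfying $f(t)=f(0)+i\int_0^t\mathcal{T}(f,f,f)(s)\,ds$ on $[0,T]$. *)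

theory Defs
  imports "HOL-Probability.Probability"
begin

section \<open>The Hilbert space $L^2(\mathbb{R}^2)$\<close>

lemma borel_measurable_cnj [measurable]: "cnj \<in> borel_measurable borel"
  by (intro borel_measurable_continuous_onI continuous_intros)

definition square_integrable :: "(real^2 \<Rightarrow> complex) \<Rightarrow> bool" where
  "square_integrable f \<longleftrightarrow> f \<in> borel_measurable lborel \<and> integrable lborel (\<lambda>x. (norm (f x))\<^sup>2)"

lemma square_integrable_measurable[measurable_dest]:
  "square_integrable f \<Longrightarrow> f \<in> borel_measurable lborel"
  by (simp add: square_integrable_def)

lemma square_integrable_iff_nn:
  "square_integrable f \<longleftrightarrow>
     f \<in> borel_measurable lborel \<and> (\<integral>\<^sup>+x. ennreal ((norm (f x))\<^sup>2) \<partial>lborel) < \<infinity>"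
  unfolding square_integrable_def integrable_iff_bounded by (auto simp: measurable_compose)

lemma square_integrable_bound:
  assumes f: "square_integrable f" and g: "square_integrable g" and h: "h \<in> borel_measurable lborel"
    and le: "\<And>x. norm (h x) \<le> norm (f x) + norm (g x)"
  shows "square_integrable h"
  unfolding square_integrable_def
proof (intro conjI h)
  have "integrable lborel (\<lambda>x. 2 * (norm (f x))\<^sup>2 + 2 * (norm (g x))\<^sup>2)"
    using f g by (auto simp: square_integrable_def)
  then show "integrable lborel (\<lambda>x. (norm (h x))\<^sup>2)"
  proof (rule Bochner_Integration.integrable_bound)
    show "(\<lambda>x. (norm (h x))\<^sup>2) \<in> borel_measurable lborel"
      using h by measurable
    have "(norm (h x))\<^sup>2 \<le> 2 * (norm (f x))\<^sup>2 + 2 * (norm (g x))\<^sup>2" for x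
    proof -
      have "(norm (h x))\<^sup>2 \<le> (norm (f x) + norm (g x))\<^sup>2"
        using le[of x] by (intro power_mono) auto
      also have "\<dots> \<le> 2 * (norm (f x))\<^sup>2 + 2 * (norm (g x))\<^sup>2"
        using sum_squares_bound[of "norm (f x)" "norm (g x)"] by (simp add: power2_sum)
      finally show ?thesis .
    qed
    then show "AE x in lborel. norm ((norm (h x))\<^sup>2) \<le> norm (2 * (norm (f x))\<^sup>2 + 2 * (norm (g x))\<^sup>2)"
      by (intro always_eventually allI) (auto intro: order_trans[OF _ abs_ge_self])
  qed
qed

lemma square_integrable_zero: "square_integrable (\<lambda>x. 0)"
  by (simp add: square_integrable_def)

lemma square_integrable_add:
  "square_integrable f \<Longrightarrow> square_integrable g \<Longrightarrow> square_integrable (\<lambda>x. f x + g x)"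
  by (rule square_integrable_bound[of f g]) (auto simp: square_integrable_def norm_triangle_ineq)

lemma square_integrable_diff:
  "square_integrable f \<Longrightarrow> square_integrable g \<Longrightarrow> square_integrable (\<lambda>x. f x - g x)"
  by (rule square_integrable_bound[of f g]) (auto simp: square_integrable_def norm_triangle_ineq4)

lemma square_integrable_scale:
  "square_integrable f \<Longrightarrow> square_integrable (\<lambda>x. c * f x)"
  by (auto simp: square_integrable_def norm_mult power_mult_distrib)

lemma square_integrable_scaleR:
  "square_integrable f \<Longrightarrow> square_integrable (\<lambda>x. c *\<^sub>R f x)"
  using square_integrable_scale[of f "complex_of_real c"] by (simp add: scaleR_conv_of_real)

lemma square_integrable_uminus:
  "square_integrable f \<Longrightarrow> square_integrable (\<lambda>x. - f x)"
  by (auto simp: square_integrable_def)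

lemma square_integrable_mult_cnj:
  assumes f: "square_integrable f" and g: "square_integrable g"
  shows "integrable lborel (\<lambda>x. f x * cnj (g x))"
proof (rule Bochner_Integration.integrable_bound)
  show "integrable lborel (\<lambda>x. (norm (f x))\<^sup>2 + (norm (g x))\<^sup>2)"
    using f g by (auto simp: square_integrable_def)
  have [measurable]: "f \<in> borel_measurable lborel" "g \<in> borel_measurable lborel"
    using f g by (auto simp: square_integrable_def)
  show "(\<lambda>x. f x * cnj (g x)) \<in> borel_measurable lborel"
    by measurable
  have "norm (f x) * norm (g x) \<le> (norm (f x))\<^sup>2 + (norm (g x))\<^sup>2" for x
  proof -
    have "0 \<le> norm (f x) * norm (g x)" by simp
    then show ?thesis
      using sum_squares_bound[of "norm (f x)" "norm (g x)"] by linarith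
  qed
  then show "AE x in lborel. norm (f x * cnj (g x)) \<le> norm ((norm (f x))\<^sup>2 + (norm (g x))\<^sup>2)"
    by (intro always_eventually allI) (auto simp: norm_mult intro: order_trans[OF _ abs_ge_self])
qed

text \<open>
  Points of the type \<open>L2\<close> are classes of Borel measurable, square integrable functions modulo equality
  almost everywhere. Nothing is lost against Lebesgue measurable functions, since each of those agrees
  almost everywhere with a Borel measurable one.
\<close>

definition L2_rel :: "(real^2 \<Rightarrow> complex) \<Rightarrow> (real^2 \<Rightarrow> complex) \<Rightarrow> bool" where
  "L2_rel f g \<longleftrightarrow> square_integrable f \<and> square_integrable g \<and> (AE x in lborel. f x = g x)"

quotient_type L2 = "real^2 \<Rightarrow> complex" / partial: L2_rel
proof (rule part_equivpI)
  show "\<exists>f. L2_rel f f"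
    using square_integrable_zero by (auto simp: L2_rel_def)
  show "symp L2_rel"
    by (auto simp: symp_def L2_rel_def)
  show "transp L2_rel"
    by (auto simp: transp_def L2_rel_def)
qed

lemma L2_relI:
  assumes "square_integrable f" "square_integrable g" "AE x in lborel. f x = g x"
  shows "L2_rel f g"
  using assms by (simp add: L2_rel_def)

instantiation L2 :: real_vector
begin

lift_definition zero_L2 :: L2 is "\<lambda>x. 0"
  by (simp add: L2_rel_def square_integrable_zero)

lift_definition plus_L2 :: "L2 \<Rightarrow> L2 \<Rightarrow> L2" is "\<lambda>f g x. f x + g x"
  by (auto simp: L2_rel_def square_integrable_add)

lift_definition minus_L2 :: "L2 \<Rightarrow> L2 \<Rightarrow> L2" is "\<lambda>f g x. f x - g x"
  by (auto simp: L2_rel_def square_integrable_diff)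

lift_definition uminus_L2 :: "L2 \<Rightarrow> L2" is "\<lambda>f x. - f x"
  by (auto simp: L2_rel_def square_integrable_uminus)

lift_definition scaleR_L2 :: "real \<Rightarrow> L2 \<Rightarrow> L2" is "\<lambda>c f x. c *\<^sub>R f x"
  by (auto simp: L2_rel_def square_integrable_scaleR)

instance
proof
  fix f g h :: L2 and a b c :: real
  show "f + g + h = f + (g + h)"
    by transfer (auto simp: L2_rel_def add.assoc intro!: square_integrable_add)
  show "f + g = g + f"
    by transfer (auto simp: L2_rel_def add.commute intro!: square_integrable_add)
  show "0 + f = f"
    by transfer (auto simp: L2_rel_def)
  show "- f + f = 0"
    by transfer (auto simp: L2_rel_def square_integrable_zero)
  show "f - g = f + - g"
    by transfer (auto simp: L2_rel_def square_integrable_diff)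
  show "c *\<^sub>R (f + g) = c *\<^sub>R f + c *\<^sub>R g"
    by transfer (auto simp: L2_rel_def scaleR_add_right intro!: square_integrable_scaleR square_integrable_add)
  show "(a + b) *\<^sub>R f = a *\<^sub>R f + b *\<^sub>R f"
    by transfer (auto simp: L2_rel_def scaleR_add_left intro!: square_integrable_scaleR square_integrable_add)
  show "a *\<^sub>R b *\<^sub>R f = (a * b) *\<^sub>R f"
    by transfer (auto simp: L2_rel_def intro!: square_integrable_scaleR)
  show "1 *\<^sub>R f = f"
    by transfer (auto simp: L2_rel_def)
qed

end

text \<open>
  The class \<open>real_inner\<close> asks for a real inner product, which is the real part of the Hermitian one
  (\<open>cinner_L2\<close> below). Both induce the same norm.
\<close>

instantiation L2 :: real_inner
begin

lift_definition inner_L2 :: "L2 \<Rightarrow> L2 \<Rightarrow> real" is "\<lambda>f g. LINT x|lborel. Re (f x * cnj (g x))"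
proof -
  fix f f' g g' assume *: "L2_rel f f'" "L2_rel g g'"
  then have [measurable]: "f \<in> borel_measurable lborel" "f' \<in> borel_measurable lborel"
    "g \<in> borel_measurable lborel" "g' \<in> borel_measurable lborel"
    by (auto simp: L2_rel_def square_integrable_def)
  from * have "AE x in lborel. f x = f' x" "AE x in lborel. g x = g' x"
    by (auto simp: L2_rel_def)
  then show "(LINT x|lborel. Re (f x * cnj (g x))) = (LINT x|lborel. Re (f' x * cnj (g' x)))"
    by (intro integral_cong_AE) auto
qed

definition norm_L2 :: "L2 \<Rightarrow> real" where "norm_L2 f = sqrt (inner f f)"

definition sgn_L2 :: "L2 \<Rightarrow> L2" where "sgn_L2 f = f /\<^sub>R norm f"

definition dist_L2 :: "L2 \<Rightarrow> L2 \<Rightarrow> real" where "dist_L2 f g = norm (f - g)"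

definition uniformity_L2 :: "(L2 \<times> L2) filter" where
  "uniformity_L2 = (INF e\<in>{0<..}. principal {(f, g). dist f g < e})"

definition open_L2 :: "L2 set \<Rightarrow> bool" where
  "open_L2 U \<longleftrightarrow> (\<forall>f\<in>U. eventually (\<lambda>(f', g). f' = f \<longrightarrow> g \<in> U) uniformity)"

instance
proof
  fix f g h :: L2 and c :: real
  show "dist f g = norm (f - g)"
    by (rule dist_L2_def)
  show "sgn f = f /\<^sub>R norm f"
    by (rule sgn_L2_def)
  show "uniformity = (INF e\<in>{0<..}. principal {(f, g :: L2). dist f g < e})"
    by (rule uniformity_L2_def)
  show "open U \<longleftrightarrow> (\<forall>f\<in>U. eventually (\<lambda>(f', g). f' = f \<longrightarrow> g \<in> U) uniformity)" for U :: "L2 set"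
    by (rule open_L2_def)
  show "inner f g = inner g f"
    by transfer (simp add: mult.commute)
  show "inner (f + g) h = inner f h + inner g h"
  proof transfer
    fix f g h assume "L2_rel f f" "L2_rel g g" "L2_rel h h"
    then have "integrable lborel (\<lambda>x. Re (f x * cnj (h x)))" "integrable lborel (\<lambda>x. Re (g x * cnj (h x)))"
      by (auto simp only: L2_rel_def intro!: integrable_Re square_integrable_mult_cnj)
    then have "(LINT x|lborel. Re (f x * cnj (h x)) + Re (g x * cnj (h x))) =
      (LINT x|lborel. Re (f x * cnj (h x))) + (LINT x|lborel. Re (g x * cnj (h x)))"
      by (rule Bochner_Integration.integral_add)
    then show "(LINT x|lborel. Re ((f x + g x) * cnj (h x))) =
      (LINT x|lborel. Re (f x * cnj (h x))) + (LINT x|lborel. Re (g x * cnj (h x)))"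
      by (simp only: distrib_right plus_complex.sel)
  qed
  show "inner (c *\<^sub>R f) g = c * inner f g"
    by transfer (simp flip: right_diff_distrib distrib_left add: mult.assoc)
  show "0 \<le> inner f f"
    by transfer (auto intro!: integral_nonneg_AE simp flip: power2_eq_square)
  show "inner f f = 0 \<longleftrightarrow> f = 0"
  proof transfer
    fix f assume f: "L2_rel f f"
    then have f': "square_integrable f" by (simp add: L2_rel_def)
    have eq: "Re (f x * cnj (f x)) = (norm (f x))\<^sup>2" for x
      by (simp add: complex_norm_square[symmetric])
    have "(LINT x|lborel. Re (f x * cnj (f x))) = 0 \<longleftrightarrow> (AE x in lborel. (norm (f x))\<^sup>2 = 0)"
      unfolding eq using f' by (intro integral_nonneg_eq_0_iff_AE) (auto simp: square_integrable_def)
    then show "(LINT x|lborel. Re (f x * cnj (f x))) = 0 \<longleftrightarrow> L2_rel f (\<lambda>x. 0)"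
      using f' by (simp add: L2_rel_def square_integrable_zero)
  qed
  show "norm f = sqrt (inner f f)"
    by (rule norm_L2_def)
qed

end

lift_definition scaleC_L2 :: "complex \<Rightarrow> L2 \<Rightarrow> L2" (infixr "*\<^sub>C" 75) is "\<lambda>c f x. c * f x"
  by (auto simp: L2_rel_def square_integrable_scale)

lift_definition cinner_L2 :: "L2 \<Rightarrow> L2 \<Rightarrow> complex" is "\<lambda>f g. LINT x|lborel. f x * cnj (g x)"
proof -
  fix f f' g g' assume *: "L2_rel f f'" "L2_rel g g'"
  then have [measurable]: "f \<in> borel_measurable lborel" "f' \<in> borel_measurable lborel"
    "g \<in> borel_measurable lborel" "g' \<in> borel_measurable lborel"
    by (auto simp: L2_rel_def square_integrable_def)
  from * have "AE x in lborel. f x = f' x" "AE x in lborel. g x = g' x"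
    by (auto simp: L2_rel_def)
  then show "(LINT x|lborel. f x * cnj (g x)) = (LINT x|lborel. f' x * cnj (g' x))"
    by (intro integral_cong_AE) (measurable, auto)
qed

lemma inner_L2_eq_Re: "inner f g = Re (cinner_L2 f g)"
proof transfer
  fix f g assume "L2_rel f f" "L2_rel g g"
  then have "integrable lborel (\<lambda>x. f x * cnj (g x))"
    by (auto simp only: L2_rel_def intro!: square_integrable_mult_cnj)
  then show "(LINT x|lborel. Re (f x * cnj (g x))) = Re (LINT x|lborel. f x * cnj (g x))"
    by (rule integral_Re)
qed

lemma L2_rel_refl_iff: "L2_rel f f \<longleftrightarrow> square_integrable f"
  by (simp add: L2_rel_def)

lemma L2_cases:
  obtains f where "square_integrable f" "F = abs_L2 f"
proof -
  have "L2_rel (rep_L2 F) (rep_L2 F)" "abs_L2 (rep_L2 F) = F"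
    using Quotient_rep_reflp[OF Quotient_L2] Quotient_abs_rep[OF Quotient_L2] by blast+
  then show thesis
    using that[of "rep_L2 F"] by (simp add: L2_rel_refl_iff)
qed

lemma norm_abs_L2:
  assumes "square_integrable f"
  shows "(norm (abs_L2 f))\<^sup>2 = (LINT x|lborel. (norm (f x))\<^sup>2)"
proof -
  have "(norm (abs_L2 f))\<^sup>2 = inner (abs_L2 f) (abs_L2 f)"
    by (simp add: power2_norm_eq_inner)
  also have "\<dots> = (LINT x|lborel. Re (f x * cnj (f x)))"
    using assms by (intro inner_L2.abs_eq) (simp_all add: L2_rel_refl_iff)
  also have "\<dots> = (LINT x|lborel. (norm (f x))\<^sup>2)"
    by (intro Bochner_Integration.integral_cong) (simp_all add: complex_norm_square[symmetric])
  finally show ?thesis .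
qed

lemma ennreal_norm_abs_L2:
  assumes "square_integrable f"
  shows "ennreal ((norm (abs_L2 f))\<^sup>2) = (\<integral>\<^sup>+x. ennreal ((norm (f x))\<^sup>2) \<partial>lborel)"
  using assms unfolding norm_abs_L2[OF assms]
  by (subst nn_integral_eq_integral) (auto simp: square_integrable_def)

lemma abs_L2_diff:
  assumes "square_integrable f" "square_integrable g"
  shows "abs_L2 f - abs_L2 g = abs_L2 (\<lambda>x. f x - g x)"
  using assms by (intro minus_L2.abs_eq) (simp_all add: L2_rel_refl_iff)

instance L2 :: banach
proof
  fix X :: "nat \<Rightarrow> L2" assume X: "Cauchy X"
  have "\<exists>F. \<forall>n. square_integrable (F n) \<and> X n = abs_L2 (F n)"
    by (intro choice allI) (metis L2_cases)
  then obtain F where F: "\<And>n. square_integrable (F n)" and XF: "\<And>n. X n = abs_L2 (F n)"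
    by blast
  have [measurable]: "F n \<in> borel_measurable lborel" for n
    using F[of n] by (simp add: square_integrable_def)
  have nn: "(\<integral>\<^sup>+x. ennreal ((norm (F m x - F n x))\<^sup>2) \<partial>lborel) = ennreal ((norm (X m - X n))\<^sup>2)" for m n
    unfolding XF abs_L2_diff[OF F F] using ennreal_norm_abs_L2[OF square_integrable_diff[OF F F]] by simp
  have "\<forall>k. \<exists>M. \<forall>m\<ge>M. \<forall>n\<ge>M. norm (X m - X n) < (1/4) ^ k"
    using X by (metis Cauchy_iff zero_less_power zero_less_divide_1_iff zero_less_numeral)
  then obtain M where M: "\<And>k m n. m \<ge> M k \<Longrightarrow> n \<ge> M k \<Longrightarrow> norm (X m - X n) < (1/4) ^ k"
    by metis
  define r where "r k = (\<Sum>j\<le>k. M j)" for k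
  have rM: "r k \<ge> M k" for k
    unfolding r_def by (rule member_le_sum) auto
  have rSuc: "r (Suc k) \<ge> r k" for k
    by (simp add: r_def)
  define D where "D k x = norm (F (r (Suc k)) x - F (r k) x)" for k x
  have [measurable]: "D k \<in> borel_measurable lborel" for k
    unfolding D_def by measurable
  have nD: "(\<integral>\<^sup>+x. ennreal (4 ^ k * (D k x)\<^sup>2) \<partial>lborel) \<le> ennreal ((1/4) ^ k)" for k
  proof -
    have "norm (X (r (Suc k)) - X (r k)) < (1/4) ^ k"
      using M rM rSuc order_trans by blast
    then have "(norm (X (r (Suc k)) - X (r k)))\<^sup>2 \<le> ((1/4) ^ k)\<^sup>2"
      by (intro power_mono) auto
    then have "4 ^ k * (norm (X (r (Suc k)) - X (r k)))\<^sup>2 \<le> 4 ^ k * ((1/4) ^ k)\<^sup>2"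
      by (intro mult_left_mono) auto
    also have "\<dots> = (1/4) ^ k"
      by (simp add: power2_eq_square power_divide)
    finally have "4 ^ k * (norm (X (r (Suc k)) - X (r k)))\<^sup>2 \<le> (1/4) ^ k" .
    moreover have "(\<integral>\<^sup>+x. ennreal (4 ^ k * (D k x)\<^sup>2) \<partial>lborel) =
        ennreal (4 ^ k * (norm (X (r (Suc k)) - X (r k)))\<^sup>2)"
      by (simp add: ennreal_mult nn_integral_cmult D_def nn)
    ultimately show ?thesis by (simp add: ennreal_leI)
  qed
  have "(\<integral>\<^sup>+x. (\<Sum>k. ennreal (4 ^ k * (D k x)\<^sup>2)) \<partial>lborel) =
      (\<Sum>k. \<integral>\<^sup>+x. ennreal (4 ^ k * (D k x)\<^sup>2) \<partial>lborel)"
    by (rule nn_integral_suminf) measurable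
  also have "\<dots> \<le> (\<Sum>k. ennreal ((1/4) ^ k))"
    by (intro suminf_le nD) auto
  also have "\<dots> < \<infinity>"
    by (subst suminf_ennreal2) (auto intro!: summable_geometric)
  finally have "AE x in lborel. (\<Sum>k. ennreal (4 ^ k * (D k x)\<^sup>2)) \<noteq> \<infinity>"
    by (intro nn_integral_PInf_AE) auto
  then have conv: "AE x in lborel. convergent (\<lambda>k. F (r k) x)"
  proof eventually_elim
    fix x assume "(\<Sum>k. ennreal (4 ^ k * (D k x)\<^sup>2)) \<noteq> \<infinity>"
    then have "summable (\<lambda>k. 4 ^ k * (D k x)\<^sup>2)"
      by (intro summable_suminf_not_top) auto
    then have "Bseq (\<lambda>k. 4 ^ k * (D k x)\<^sup>2)"
      by (intro convergent_imp_Bseq) (auto simp: convergent_def intro: summable_LIMSEQ_zero)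
    then obtain C where C: "C > 0" "\<And>k. norm (4 ^ k * (D k x)\<^sup>2) \<le> C"
      by (auto simp: Bseq_def)
    have four: "((2::real) ^ k)\<^sup>2 = 4 ^ k" for k
      by (simp add: power2_eq_square flip: power_mult_distrib)
    have "norm (F (r (Suc k)) x - F (r k) x) \<le> sqrt C * (1/2) ^ k" for k
    proof -
      have "(2 ^ k * D k x)\<^sup>2 \<le> C"
        using C(2)[of k] by (simp add: power_mult_distrib four)
      then have "2 ^ k * D k x \<le> sqrt C"
        by (rule real_le_rsqrt)
      then show ?thesis
        by (simp add: D_def field_simps)
    qed
    then have bd: "norm (F (r (Suc k)) x - F (r k) x) \<le> sqrt C * (1/2) ^ k" for k
      by blast
    have "summable (\<lambda>k. sqrt C * (1/2::real) ^ k)"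
      by (intro summable_mult summable_geometric) simp
    then have "summable (\<lambda>k. F (r (Suc k)) x - F (r k) x)"
      by (rule summable_comparison_test'[where N = 0]) (rule bd)
    then have "convergent (\<lambda>n. \<Sum>k<n. F (r (Suc k)) x - F (r k) x)"
      by (simp add: summable_iff_convergent)
    then have "convergent (\<lambda>n. F (r n) x - F (r 0) x)"
      by (subst (asm) sum_lessThan_telescope[of "\<lambda>k. F (r k) x"])
    from convergent_add[OF this convergent_const[of "F (r 0) x"]]
    show "convergent (\<lambda>k. F (r k) x)" by simp
  qed
  define G where "G x = lim (\<lambda>k. F (r k) x)" for x
  have [measurable]: "G \<in> borel_measurable lborel"
    unfolding G_def by (rule borel_measurable_lim_metric) measurable
  have fatou: "(\<integral>\<^sup>+x. ennreal ((norm (F n x - G x))\<^sup>2) \<partial>lborel) \<le> ennreal (((1/4) ^ k)\<^sup>2)"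
    if n: "n \<ge> M k" for n k
  proof -
    have "AE x in lborel. ennreal ((norm (F n x - G x))\<^sup>2) =
        liminf (\<lambda>j. ennreal ((norm (F n x - F (r j) x))\<^sup>2))"
      using conv
    proof eventually_elim
      fix x assume "convergent (\<lambda>k. F (r k) x)"
      then have "(\<lambda>k. F (r k) x) \<longlonglongrightarrow> G x"
        by (simp add: G_def convergent_LIMSEQ_iff)
      then have "(\<lambda>j. ennreal ((norm (F n x - F (r j) x))\<^sup>2)) \<longlonglongrightarrow> ennreal ((norm (F n x - G x))\<^sup>2)"
        by (intro tendsto_intros tendsto_ennrealI)
      then show "ennreal ((norm (F n x - G x))\<^sup>2) = liminf (\<lambda>j. ennreal ((norm (F n x - F (r j) x))\<^sup>2))"
        by (metis lim_imp_Liminf sequentially_bot)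
    qed
    then have "(\<integral>\<^sup>+x. ennreal ((norm (F n x - G x))\<^sup>2) \<partial>lborel) =
        (\<integral>\<^sup>+x. liminf (\<lambda>j. ennreal ((norm (F n x - F (r j) x))\<^sup>2)) \<partial>lborel)"
      by (rule nn_integral_cong_AE)
    also have "\<dots> \<le> liminf (\<lambda>j. \<integral>\<^sup>+x. ennreal ((norm (F n x - F (r j) x))\<^sup>2) \<partial>lborel)"
      by (rule nn_integral_liminf) measurable
    also have "\<dots> \<le> ennreal (((1/4) ^ k)\<^sup>2)"
    proof (rule Liminf_le)
      have "norm (X n - X (r j)) < (1/4) ^ k" if "j \<ge> k" for j
        using M[OF n, of "r j"] that rM[of k] lift_Suc_mono_le[of r, OF rSuc] by (meson order_trans)
      then show "\<forall>\<^sub>F j in sequentially. (\<integral>\<^sup>+x. ennreal ((norm (F n x - F (r j) x))\<^sup>2) \<partial>lborel) \<le> ennreal (((1/4) ^ k)\<^sup>2)"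
        unfolding nn eventually_sequentially
        by (intro exI[of _ k] allI impI ennreal_leI power_mono) (auto intro: less_imp_le)
    qed simp
    finally show ?thesis .
  qed
  have "square_integrable (\<lambda>x. F (M 0) x - G x)"
    unfolding square_integrable_iff_nn using fatou[of 0 "M 0"]
    by (auto intro: le_less_trans)
  from square_integrable_diff[OF F[of "M 0"] this] have G: "square_integrable G"
    by simp
  have lim: "norm (X n - abs_L2 G) \<le> (1/4) ^ k" if "n \<ge> M k" for n k
  proof -
    have "ennreal ((norm (X n - abs_L2 G))\<^sup>2) \<le> ennreal (((1/4) ^ k)\<^sup>2)"
      unfolding XF abs_L2_diff[OF F G]
      using ennreal_norm_abs_L2[OF square_integrable_diff[OF F G]] fatou[OF that] by simp
    then have "(norm (X n - abs_L2 G))\<^sup>2 \<le> ((1/4) ^ k)\<^sup>2"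
      by (simp add: ennreal_le_iff)
    then show ?thesis
      by (rule power2_le_imp_le) simp
  qed
  have "X \<longlonglongrightarrow> abs_L2 G"
  proof (rule LIMSEQ_I)
    fix e :: real assume "e > 0"
    then obtain k where "(1/4::real) ^ k < e"
      using real_arch_pow_inv[of e "1/4"] by auto
    then show "\<exists>no. \<forall>n\<ge>no. norm (X n - abs_L2 G) < e"
      using lim le_less_trans by blast
  qed
  then show "convergent X" by (auto simp: convergent_def)
qed

text \<open>
  Separability. The Bochner integral of the library needs a second countable codomain, and it makes
  Borel measurability of an \<open>L2\<close>-valued function the same as strong measurability.
\<close>

lemma abs_L2_add:
  assumes "square_integrable f" "square_integrable g"
  shows "abs_L2 f + abs_L2 g = abs_L2 (\<lambda>x. f x + g x)"
  using assms by (intro plus_L2.abs_eq) (simp_all add: L2_rel_refl_iff)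

lemma abs_L2_scaleC:
  assumes "square_integrable f"
  shows "c *\<^sub>C abs_L2 f = abs_L2 (\<lambda>x. c * f x)"
  using assms by (intro scaleC_L2.abs_eq) (simp_all add: L2_rel_refl_iff)

lemma zero_L2_eq: "0 = abs_L2 (\<lambda>x. 0)"
  by (simp add: zero_L2_def)

lemma abs_L2_tendsto_dominated:
  fixes F :: "nat \<Rightarrow> real^2 \<Rightarrow> complex"
  assumes w: "square_integrable w"
    and F: "\<And>k. F k \<in> borel_measurable lborel"
    and bd: "\<And>k x. norm (F k x) \<le> norm (w x)"
    and lim: "\<And>x. (\<lambda>k. F k x) \<longlonglongrightarrow> G x"
  shows "(\<lambda>k. abs_L2 (F k)) \<longlonglongrightarrow> abs_L2 G"
proof -
  have [measurable]: "F k \<in> borel_measurable lborel" "w \<in> borel_measurable lborel" for k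
    using F w by (simp_all add: square_integrable_def)
  have [measurable]: "G \<in> borel_measurable lborel"
    by (rule borel_measurable_LIMSEQ_metric[where f = F]) (use lim in auto)
  have bdG: "norm (G x) \<le> norm (w x)" for x
    by (rule LIMSEQ_le_const2[OF tendsto_norm[OF lim]]) (use bd in auto)
  have sF: "square_integrable (F k)" for k
    by (rule square_integrable_bound[OF w w F]) (rule add_increasing2[OF norm_ge_zero bd])
  have sG: "square_integrable G"
    by (rule square_integrable_bound[OF w w _ add_increasing2[OF norm_ge_zero bdG]]) measurable
  have "(\<lambda>k. LINT x|lborel. (norm (F k x - G x))\<^sup>2) \<longlonglongrightarrow> (LINT x|(lborel :: (real^2) measure). (0::real))"
  proof (rule integral_dominated_convergence)
    show "integrable lborel (\<lambda>x. 4 * (norm (w x))\<^sup>2)"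
      using w by (simp add: square_integrable_def)
    show "AE x in lborel. (\<lambda>k. (norm (F k x - G x))\<^sup>2) \<longlonglongrightarrow> 0"
    proof (intro always_eventually allI)
      fix x
      have "(\<lambda>k. (norm (F k x - G x))\<^sup>2) \<longlonglongrightarrow> (norm (G x - G x))\<^sup>2"
        by (intro tendsto_intros lim)
      then show "(\<lambda>k. (norm (F k x - G x))\<^sup>2) \<longlonglongrightarrow> 0" by simp
    qed
    show "AE x in lborel. norm ((norm (F k x - G x))\<^sup>2) \<le> 4 * (norm (w x))\<^sup>2" for k
    proof (intro always_eventually allI)
      fix x
      have "norm (F k x - G x) \<le> 2 * norm (w x)"
        using norm_triangle_ineq4[of "F k x" "G x"] bd[of k x] bdG[of x] by linarith
      then have "(norm (F k x - G x))\<^sup>2 \<le> (2 * norm (w x))\<^sup>2"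
        by (intro power_mono) auto
      then show "norm ((norm (F k x - G x))\<^sup>2) \<le> 4 * (norm (w x))\<^sup>2"
        by (simp add: power_mult_distrib)
    qed
  qed (simp, measurable)
  then have "(\<lambda>k. (norm (abs_L2 (F k) - abs_L2 G))\<^sup>2) \<longlonglongrightarrow> 0"
    by (simp add: abs_L2_diff[OF sF sG] norm_abs_L2[OF square_integrable_diff[OF sF sG]])
  from tendsto_real_sqrt[OF this] have "(\<lambda>k. norm (abs_L2 (F k) - abs_L2 G)) \<longlonglongrightarrow> 0"
    by simp
  then show ?thesis
    by (simp add: LIM_zero_iff tendsto_norm_zero_iff)
qed

lemma norm_scaleC_L2: "norm (c *\<^sub>C f) = norm c * norm f"
proof -
  obtain g where g: "square_integrable g" and f: "f = abs_L2 g"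
    by (rule L2_cases)
  have "(norm (c *\<^sub>C f))\<^sup>2 = (norm c * norm f)\<^sup>2"
    unfolding f abs_L2_scaleC[OF g] norm_abs_L2[OF square_integrable_scale[OF g]]
      power_mult_distrib norm_abs_L2[OF g]
    by (simp add: norm_mult power_mult_distrib)
  then show ?thesis
    by (simp add: power2_eq_iff_nonneg)
qed

lemma scaleC_L2_diff_left: "(a - b) *\<^sub>C f = a *\<^sub>C f - b *\<^sub>C f"
  by transfer (auto simp: L2_rel_def left_diff_distrib intro!: square_integrable_diff square_integrable_scale)

lemma square_integrable_indicator_ball:
  assumes [measurable]: "A \<in> sets borel"
  shows "square_integrable (\<lambda>x. c * indicator (A \<inter> ball 0 (real n)) x)"
proof (rule square_integrable_scale)
  have "emeasure lborel (A \<inter> ball (0::real^2) (real n)) \<le> emeasure lborel (ball (0::real^2) (real n))"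
    by (intro emeasure_mono) auto
  also have "\<dots> < \<infinity>"
    by (rule emeasure_lborel_ball_finite)
  finally have "integrable lborel (\<lambda>x. indicator (A \<inter> ball (0::real^2) (real n)) x :: real)"
    by (intro integrable_real_indicator) auto
  moreover have "(norm (indicator (A \<inter> ball 0 (real n)) x :: complex))\<^sup>2 = indicator (A \<inter> ball 0 (real n)) x" for x
    by (simp add: indicator_def)
  moreover have [measurable]: "ball (0::real^2) (real n) \<in> sets borel"
    by auto
  have "(indicator (A \<inter> ball 0 (real n)) :: real^2 \<Rightarrow> complex) \<in> borel_measurable lborel"
    by measurable
  moreover note this
  ultimately show "square_integrable (indicator (A \<inter> ball 0 (real n)))"
    unfolding square_integrable_def by simp
qed

lemma L2_separable: "\<exists>D :: L2 set. countable D \<and> closure D = UNIV"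
proof -
  obtain B :: "(real^2) set set" where B: "countable B" "topological_basis B"
    using ex_countable_basis by blast
  define GG where "GG = Inter ` {b. finite b \<and> b \<subseteq> B}"
  have GG_countable: "countable GG"
    unfolding GG_def by (intro countable_image countable_Collect_finite_subset B)
  have GG_open: "open A" if "A \<in> GG" for A
    using that B(2) topological_basis_open unfolding GG_def by (auto intro!: open_Inter)
  have GG_stable: "Int_stable GG"
  proof (rule Int_stableI)
    fix a b assume "a \<in> GG" "b \<in> GG"
    then obtain a' b' where "finite a'" "a' \<subseteq> B" "a = \<Inter>a'" "finite b'" "b' \<subseteq> B" "b = \<Inter>b'"
      by (auto simp: GG_def)
    then show "a \<inter> b \<in> GG"
      unfolding GG_def by (intro image_eqI[of _ _ "a' \<union> b'"]) auto
  qed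
  have UNIV_GG: "UNIV \<in> GG"
    unfolding GG_def by (rule image_eqI[of _ _ "{}"]) auto
  have borel_GG: "borel = sigma UNIV GG"
  proof (rule borel_eq_countable_basis[OF GG_countable])
    show "topological_basis GG"
    proof (rule topological_basisI)
      fix O' :: "(real^2) set" and x assume "open O'" "x \<in> O'"
      then obtain b where "b \<in> B" "x \<in> b" "b \<subseteq> O'"
        using topological_basisE[OF B(2)] by metis
      moreover from this have "b \<in> GG"
        unfolding GG_def by (intro image_eqI[of _ _ "{b}"]) auto
      ultimately show "\<exists>b\<in>GG. x \<in> b \<and> b \<subseteq> O'" by blast
    qed (rule GG_open)
  qed
  have sets_borel_GG: "sets borel = sigma_sets UNIV GG"
    unfolding borel_GG by (rule sets_measure_of) simp
  obtain Q :: "complex set" where Q: "countable Q" "\<And>X. open X \<Longrightarrow> X \<noteq> {} \<Longrightarrow> \<exists>d\<in>Q. d \<in> X"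
    by (erule countable_dense_setE)
  have [measurable]: "ball (0::real^2) (real n) \<in> sets borel" for n
    by auto
  have UNIV_borel: "(UNIV :: (real^2) set) \<in> sets borel"
    by simp
  define ind where "ind A n c = abs_L2 (\<lambda>x. c * indicator (A \<inter> ball 0 (real n)) x)"
    for A :: "(real^2) set" and n :: nat and c
  define H where "H = (\<lambda>(A, n, c). ind A n c) ` (GG \<times> (UNIV :: nat set) \<times> Q)"
  define D where "D = sum_list ` lists H"
  define C where "C = closure D"
  have "countable D"
    unfolding D_def H_def by (intro countable_image countable_lists countable_SIGMA GG_countable Q) auto
  have C_lim: "l \<in> C" if "\<And>k. u k \<in> C" "u \<longlonglongrightarrow> l" for u :: "nat \<Rightarrow> L2" and l
    using that closed_sequentially[of C u l] by (auto simp: C_def)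
  have D_zero: "0 \<in> D"
    unfolding D_def by (rule image_eqI[of _ _ "[]"]) auto
  have D_add: "f + g \<in> D" if "f \<in> D" "g \<in> D" for f g
  proof -
    from that obtain xs ys where "xs \<in> lists H" "ys \<in> lists H" "f = sum_list xs" "g = sum_list ys"
      by (auto simp: D_def)
    then show ?thesis
      unfolding D_def by (intro image_eqI[of _ _ "xs @ ys"]) auto
  qed
  have H_D: "h \<in> D" if "h \<in> H" for h
    unfolding D_def using that by (intro image_eqI[of _ _ "[h]"]) auto
  have C_zero: "0 \<in> C"
    using D_zero closure_subset by (auto simp: C_def)
  have C_add: "f + g \<in> C" if f: "f \<in> C" and g: "g \<in> C" for f g
  proof -
    obtain u v where "\<And>k. u k \<in> D" "u \<longlonglongrightarrow> f" "\<And>k. v k \<in> D" "v \<longlonglongrightarrow> g"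
      using f g unfolding C_def closure_sequential by blast
    then have "\<And>k. u k + v k \<in> D" "(\<lambda>k. u k + v k) \<longlonglongrightarrow> f + g"
      by (auto intro: D_add tendsto_add)
    then show ?thesis
      unfolding C_def closure_sequential by (intro exI[of _ "\<lambda>k. u k + v k"]) auto
  qed
  have ind_scale: "ind A n c = c *\<^sub>C ind A n 1" if "A \<in> sets borel" for A n c
    unfolding ind_def using abs_L2_scaleC[OF square_integrable_indicator_ball[OF that, of 1]] by simp
  have ind_GG: "ind A n c \<in> C" if A: "A \<in> GG" for A n c
  proof -
    have A': "A \<in> sets borel" using GG_open[OF A] by auto
    have "\<exists>d\<in>Q. d \<in> ball c (1 / real (Suc k))" for k
      by (rule Q(2)) auto
    then obtain d where d: "\<And>k. d k \<in> Q" "\<And>k. dist c (d k) < 1 / real (Suc k)"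
      unfolding mem_ball by metis
    have "ind A n (d k) \<in> C" for k
    proof -
      have "ind A n (d k) \<in> H"
        unfolding H_def using A d(1) by (intro image_eqI[of _ _ "(A, n, d k)"]) auto
      then show ?thesis
        using H_D closure_subset by (auto simp: C_def)
    qed
    moreover have "(\<lambda>k. ind A n (d k)) \<longlonglongrightarrow> ind A n c"
    proof (rule LIMSEQ_I)
      have lim: "(\<lambda>k. norm (ind A n 1) * (1 / real (Suc k))) \<longlonglongrightarrow> norm (ind A n 1) * 0"
        by (intro tendsto_intros LIMSEQ_Suc[OF lim_1_over_n])
      fix e :: real assume "e > 0"
      then have "\<forall>\<^sub>F k in sequentially. norm (ind A n 1) * (1 / real (Suc k)) < e"
        using order_tendstoD(2)[OF lim] by simp
      moreover have "norm (ind A n (d k) - ind A n c) \<le> norm (ind A n 1) * (1 / real (Suc k))" for k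
      proof -
        have "norm (ind A n (d k) - ind A n c) = norm (d k - c) * norm (ind A n 1)"
          by (simp only: ind_scale[OF A', of n "d k"] ind_scale[OF A', of n c] norm_scaleC_L2
              flip: scaleC_L2_diff_left)
        also have "\<dots> \<le> (1 / real (Suc k)) * norm (ind A n 1)"
          using d(2)[of k] by (intro mult_right_mono) (auto simp: dist_norm norm_minus_commute)
        finally show ?thesis by (simp add: mult.commute)
      qed
      ultimately show "\<exists>no. \<forall>k\<ge>no. norm (ind A n (d k) - ind A n c) < e"
        unfolding eventually_sequentially by (meson le_less_trans)
    qed
    ultimately show ?thesis by (rule C_lim)
  qed
  have ind_C: "ind A n c \<in> C" if A: "A \<in> sets borel" for A n c
  proof -
    have "A \<in> sigma_sets UNIV GG" using A sets_borel_GG by simp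
    then show ?thesis
    proof (induction arbitrary: c rule: sigma_sets_induct_disjoint[OF GG_stable subset_UNIV[of GG, folded Pow_UNIV], consumes 1, case_names basic empty compl union])
      case (basic A)
      then show ?case by (rule ind_GG)
    next
      case empty
      then show ?case using C_zero by (simp add: ind_def zero_L2_eq)
    next
      case (compl A)
      then have A: "A \<in> sets borel" by (simp add: sets_borel_GG)
      have "ind (UNIV - A) n c = ind UNIV n c + ind A n (- c)"
        unfolding ind_def
          abs_L2_add[OF square_integrable_indicator_ball[OF UNIV_borel] square_integrable_indicator_ball[OF A]]
        by (intro arg_cong[where f = abs_L2] ext) (auto simp: indicator_def)
      then show ?case
        using C_add[OF ind_GG[OF UNIV_GG] compl.IH] by simp
    next
      case (union A)
      have A: "A i \<in> sets borel" for i
        using union by (auto simp: sets_borel_GG)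
      define u where "u k = ind (\<Union>i<k. A i) n c" for k
      have "u k \<in> C" for k
      proof (induction k)
        case 0
        then show ?case using C_zero by (simp add: u_def ind_def zero_L2_eq)
      next
        case (Suc k)
        have "x \<notin> A k" if "x \<in> A i" "i < k" for x i
          using union(1) that unfolding disjoint_family_on_def by (metis IntI UNIV_I empty_iff less_irrefl)
        then have "u (Suc k) = u k + ind (A k) n c"
          unfolding u_def ind_def
            abs_L2_add[OF square_integrable_indicator_ball[OF sets.finite_UN[OF finite_lessThan A]]
              square_integrable_indicator_ball[OF A]]
          by (intro arg_cong[where f = abs_L2] ext) (auto simp: indicator_def less_Suc_eq)
        then show ?case
          using C_add[OF Suc.IH union.IH] by simp
      qed
      moreover have "u \<longlonglongrightarrow> ind (\<Union>i. A i) n c"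
        unfolding u_def ind_def
      proof (rule abs_L2_tendsto_dominated[OF square_integrable_indicator_ball[of UNIV c n]])
        show "(\<lambda>x. c * indicator ((\<Union>i<k. A i) \<inter> ball 0 (real n)) x) \<in> borel_measurable lborel" for k
          using A by measurable
        show "norm (c * indicator ((\<Union>i<k. A i) \<inter> ball 0 (real n)) x) \<le> norm (c * indicator (UNIV \<inter> ball 0 (real n)) x)" for k x
          by (auto simp: indicator_def)
        show "(\<lambda>k. c * indicator ((\<Union>i<k. A i) \<inter> ball 0 (real n)) x) \<longlonglongrightarrow> c * indicator ((\<Union>i. A i) \<inter> ball 0 (real n)) x" for x
        proof (cases "\<exists>i. x \<in> A i")
          case True
          then obtain i where "x \<in> A i" by blast
          then have "\<forall>k\<ge>Suc i. c * indicator ((\<Union>i<k. A i) \<inter> ball 0 (real n)) x = c * indicator ((\<Union>i. A i) \<inter> ball 0 (real n)) x"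
            by (auto simp: indicator_def)
          then show ?thesis
            by (intro tendsto_eventually) (auto simp: eventually_sequentially)
        qed (auto simp: indicator_def)
      qed auto
      ultimately show ?case by (rule C_lim)
    qed
  qed
  have "f \<in> C" for f
  proof -
    obtain g where g: "square_integrable g" and f: "f = abs_L2 g"
      by (rule L2_cases)
    have [measurable]: "g \<in> borel_measurable lborel"
      using g by (simp add: square_integrable_def)
    obtain s where s: "\<And>i. simple_function lborel (s i)" "\<And>x. (\<lambda>i. s i x) \<longlonglongrightarrow> g x"
      "\<And>i x. norm (s i x) \<le> 2 * norm (g x)"
      using borel_measurable_implies_sequence_metric[of g lborel 0] by (auto simp: dist_norm)
    have [measurable]: "s i \<in> borel_measurable lborel" for i
      using s(1) by (rule borel_measurable_simple_function)
    define v where "v k x = s k x * indicator (ball 0 (real k)) x" for k x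
    have "abs_L2 (v k) \<in> C" for k
    proof -
      have fin: "finite (range (s k))"
        using simple_functionD(1)[OF s(1), of k] by simp
      define Y where "Y y = s k -` {y}" for y
      have Y: "Y y \<in> sets borel" for y
        using simple_functionD(2)[OF s(1), of k "{y}"] by (simp add: Y_def)
      have "square_integrable (\<lambda>x. \<Sum>y\<in>Z. y * indicator (Y y \<inter> ball 0 (real k)) x) \<and>
          abs_L2 (\<lambda>x. \<Sum>y\<in>Z. y * indicator (Y y \<inter> ball 0 (real k)) x) \<in> C" if "finite Z" for Z
        using that
      proof induction
        case empty
        then show ?case using C_zero by (simp add: zero_L2_eq square_integrable_zero)
      next
        case (insert z Z)
        have "square_integrable (\<lambda>x. z * indicator (Y z \<inter> ball 0 (real k)) x +
            (\<Sum>y\<in>Z. y * indicator (Y y \<inter> ball 0 (real k)) x))"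
          using insert by (intro square_integrable_add square_integrable_indicator_ball Y) auto
        moreover have "abs_L2 (\<lambda>x. z * indicator (Y z \<inter> ball 0 (real k)) x +
            (\<Sum>y\<in>Z. y * indicator (Y y \<inter> ball 0 (real k)) x)) \<in> C"
          using insert C_add[OF ind_C[OF Y[of z], of k z]]
          by (subst abs_L2_add[symmetric]) (auto simp: ind_def intro!: square_integrable_indicator_ball Y)
        ultimately show ?case
          unfolding sum.insert[OF insert.hyps(1,2)] by blast
      qed
      from conjunct2[OF this[OF fin]] show ?thesis
      proof (rule back_subst[where P = "\<lambda>f. f \<in> C"])
        show "abs_L2 (\<lambda>x. \<Sum>y\<in>range (s k). y * indicator (Y y \<inter> ball 0 (real k)) x) = abs_L2 (v k)"
        proof (intro arg_cong[where f = abs_L2] ext)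
          fix x
          have "(\<Sum>y\<in>range (s k). y * indicator (Y y \<inter> ball 0 (real k)) x) =
              (\<Sum>y\<in>range (s k). if s k x = y then y * indicator (ball 0 (real k)) x else 0)"
            by (intro sum.cong) (auto simp: Y_def indicator_def)
          also have "\<dots> = v k x"
            using fin by (simp add: v_def sum.delta)
          finally show "(\<Sum>y\<in>range (s k). y * indicator (Y y \<inter> ball 0 (real k)) x) = v k x" .
        qed
      qed
    qed
    moreover have "(\<lambda>k. abs_L2 (v k)) \<longlonglongrightarrow> abs_L2 g"
    proof (rule abs_L2_tendsto_dominated[OF square_integrable_scale[OF g, of 2]])
      show "v k \<in> borel_measurable lborel" for k
        unfolding v_def by measurable
      show "norm (v k x) \<le> norm (2 * g x)" for k x
        using s(3)[of k x] by (auto simp: v_def indicator_def norm_mult)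
      show "(\<lambda>k. v k x) \<longlonglongrightarrow> g x" for x
      proof -
        obtain n where "norm x < real n" using reals_Archimedean2 by blast
        then have "\<forall>k\<ge>n. v k x = s k x"
          by (auto simp: v_def indicator_def)
        then have "\<forall>\<^sub>F k in sequentially. s k x = v k x"
          unfolding eventually_sequentially by metis
        then show ?thesis
          by (rule Lim_transform_eventually[OF s(2)])
      qed
    qed
    ultimately show ?thesis
      unfolding f by (rule C_lim)
  qed
  with \<open>countable D\<close> show ?thesis
    by (auto simp: C_def)
qed

instance L2 :: second_countable_topology
proof
  obtain D :: "L2 set" where D: "countable D" "closure D = UNIV"
    using L2_separable by blast
  define B where "B = (\<lambda>(d, n). ball d (1 / real (Suc n))) ` (D \<times> UNIV)"
  have "countable B"
    unfolding B_def using D by (intro countable_image countable_SIGMA) auto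
  moreover have "topological_basis B"
  proof (rule topological_basisI)
    show "open b" if "b \<in> B" for b
      using that by (auto simp: B_def)
    fix U :: "L2 set" and f assume "open U" "f \<in> U"
    then obtain e where e: "e > 0" "ball f e \<subseteq> U"
      by (auto simp: open_contains_ball)
    then obtain n where n: "1 / real (Suc n) < e / 2"
      using nat_approx_posE[of "e / 2"] by auto
    have "f \<in> closure D" using D by simp
    then obtain d where d: "d \<in> D" "dist d f < 1 / real (Suc n)"
      unfolding closure_approachable by (metis of_nat_0_less_iff zero_less_Suc zero_less_divide_1_iff)
    have "ball d (1 / real (Suc n)) \<subseteq> ball f e"
    proof
      fix g assume "g \<in> ball d (1 / real (Suc n))"
      then have "dist d g < 1 / real (Suc n)" by simp
      then show "g \<in> ball f e"
        using d(2) n dist_triangle[of f g d] by (simp add: dist_commute)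
    qed
    then show "\<exists>b\<in>B. f \<in> b \<and> b \<subseteq> U"
      using d e by (intro bexI[of _ "ball d (1 / real (Suc n))"]) (auto simp: B_def)
  qed
  ultimately show "\<exists>B :: L2 set set. countable B \<and> open = generate_topology B"
    using topological_basis_imp_subbasis by blast
qed

section \<open>The trilinear operator\<close>

definition perp :: "real^2 \<Rightarrow> real^2" where
  "perp x = vector [- (x $ 2), x $ 1]"

text \<open>
  For square integrable arguments the integral converges absolutely for almost every \<open>\<xi>\<close>. At the
  remaining points the library's convention (the integral of a non-integrable function is \<open>0\<close>) applies.
\<close>

definition CR_integral ::
  "(real^2 \<Rightarrow> complex) \<Rightarrow> (real^2 \<Rightarrow> complex) \<Rightarrow> (real^2 \<Rightarrow> complex) \<Rightarrow> real^2 \<Rightarrow> complex" where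
  "CR_integral f g h \<xi> =
     (LINT l:{-1..1}|lborel. LINT x|lborel.
        f (\<xi> + x) * cnj (g (\<xi> + x + l *\<^sub>R perp x)) * h (\<xi> + l *\<^sub>R perp x))"

lemma linear_perp: "linear perp"
  by (rule linearI) (simp_all add: perp_def vec_eq_iff forall_2)

lemma perp_measurable [measurable]: "perp \<in> borel_measurable borel"
  by (intro borel_measurable_continuous_onI linear_continuous_on linear_perp[THEN linear_conv_bounded_linear[THEN iffD1]])

lemma perp_add: "perp (x + y) = perp x + perp y"
  and perp_scaleR: "perp (c *\<^sub>R x) = c *\<^sub>R perp x"
  and perp_diff: "perp (x - y) = perp x - perp y"
  and perp_perp: "perp (perp x) = - x"
  by (simp_all add: perp_def vec_eq_iff forall_2)

lemma lborel_linear_perp: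
  assumes d: "a\<^sup>2 + b\<^sup>2 > 0"
  shows "lborel = density (distr lborel borel (\<lambda>x. a *\<^sub>R x + b *\<^sub>R perp x)) (\<lambda>_. ennreal (a\<^sup>2 + b\<^sup>2))"
    (is "_ = density (distr lborel borel ?T) _")
proof (rule lborel_eqI)
  define s where "s = a\<^sup>2 + b\<^sup>2"
  have s: "s > 0" using d by (simp add: s_def)
  define G where "G y = (1 / s) *\<^sub>R (a *\<^sub>R y - b *\<^sub>R perp y)" for y
  have linG: "linear G"
    unfolding G_def
    by (intro linear_compose_scale_right linear_compose_sub linear_perp linear_id[unfolded id_def])
  have [measurable]: "?T \<in> borel_measurable borel"
    by measurable
  have lin: "?T (c *\<^sub>R y) = c *\<^sub>R ?T y" for c y
    by (simp add: perp_scaleR scaleR_add_right mult.commute)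
  have KT: "?T (a *\<^sub>R y - b *\<^sub>R perp y) = (a\<^sup>2 + b\<^sup>2) *\<^sub>R y" for y
    unfolding perp_diff perp_add perp_scaleR perp_perp by (simp add: power2_eq_square algebra_simps)
  have TG: "?T (G y) = y" for y
    unfolding G_def lin KT s_def[symmetric] using s by simp
  have TK: "a *\<^sub>R ?T y - b *\<^sub>R perp (?T y) = (a\<^sup>2 + b\<^sup>2) *\<^sub>R y" for y
    unfolding perp_diff perp_add perp_scaleR perp_perp by (simp add: power2_eq_square algebra_simps)
  have GT: "G (?T x) = x" for x
    unfolding G_def TK s_def[symmetric] using s by simp
  have vimage: "?T -` S = G ` S" for S
  proof safe
    fix x assume "?T x \<in> S"
    then show "x \<in> G ` S"
      by (intro image_eqI[of _ _ "?T x"]) (simp_all only: GT)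
  next
    fix x assume "x \<in> S"
    then show "G x \<in> ?T -` S"
      by (simp only: vimage_eq TG)
  qed
  have det: "det (matrix G) = 1 / s"
  proof -
    have G: "G x = vector [1 / s * (a * x$1 + b * x$2), 1 / s * (a * x$2 - b * x$1)]" for x
      unfolding G_def perp_def by (simp only: vec_eq_iff forall_2 vector_scaleR_component vector_minus_component vector_2) simp
    have "det (matrix G) = (1 / s * a) * (1 / s * a) + (1 / s * b) * (1 / s * b)"
      unfolding det_2 matrix_def G vec_lambda_beta vector_2 axis_def by simp
    also have "\<dots> = (1 / s) * (1 / s) * s"
    proof -
      have "(r * a) * (r * a) + (r * b) * (r * b) = r * r * (a\<^sup>2 + b\<^sup>2)" for r :: real
        by (simp add: power2_eq_square algebra_simps)
      then show ?thesis unfolding s_def by blast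
    qed
    also have "\<dots> = 1 / s"
      using s by simp
    finally show ?thesis .
  qed
  fix l u :: "real^2" assume lu: "\<And>i. i \<in> Basis \<Longrightarrow> l \<bullet> i \<le> u \<bullet> i"
  have box: "box l u \<in> lmeasurable"
    by simp
  have "?T -` box l u \<in> sets borel"
    using measurable_sets[of ?T borel borel "box l u"] by simp
  moreover have "G ` box l u \<in> lmeasurable" "measure lebesgue (G ` box l u) = (1 / s) * measure lebesgue (box l u)"
    using measurable_linear_image[OF linG box] measure_linear_image[OF linG box] s by (simp_all add: det)
  ultimately have em: "emeasure lborel (?T -` box l u) = ennreal ((1 / s) * measure lebesgue (box l u))"
    unfolding vimage using emeasure_eq_measure2[of "G ` box l u" lebesgue] by simp
  have "emeasure (density (distr lborel borel ?T) (\<lambda>_. ennreal s)) (box l u) =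
      ennreal s * emeasure lborel (?T -` box l u)"
    by (simp add: emeasure_density nn_integral_cmult_indicator emeasure_distr)
  also have "\<dots> = ennreal (measure lebesgue (box l u))"
    unfolding em using s by (simp flip: ennreal_mult')
  also have "\<dots> = emeasure lborel (box l u)"
    using emeasure_eq_measure2[OF box] by simp
  also have "\<dots> = (\<Prod>b\<in>Basis. (u - l) \<bullet> b)"
    using lu by (rule emeasure_lborel_box)
  finally show "emeasure (density (distr lborel borel ?T) (\<lambda>_. ennreal (a\<^sup>2 + b\<^sup>2))) (box l u) = (\<Prod>b\<in>Basis. (u - l) \<bullet> b)"
    by (simp add: s_def)
qed simp

lemma nn_integral_shift:
  fixes F :: "real^2 \<Rightarrow> ennreal"
  assumes [measurable]: "F \<in> borel_measurable borel"
  shows "(\<integral>\<^sup>+x. F (c + x) \<partial>lborel) = (\<integral>\<^sup>+x. F x \<partial>lborel)"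
proof -
  have "(\<integral>\<^sup>+x. F x \<partial>lborel) = (\<integral>\<^sup>+x. F x \<partial>distr lborel borel ((+) c))"
    by (simp only: lborel_distr_plus)
  also have "\<dots> = (\<integral>\<^sup>+x. F (c + x) \<partial>lborel)"
    by (rule nn_integral_distr) measurable
  finally show ?thesis by simp
qed

lemma nn_integral_linear_perp:
  fixes F :: "real^2 \<Rightarrow> ennreal"
  assumes [measurable]: "F \<in> borel_measurable borel" and d: "a\<^sup>2 + b\<^sup>2 > 0"
  shows "ennreal (a\<^sup>2 + b\<^sup>2) * (\<integral>\<^sup>+x. F (c + a *\<^sub>R x + b *\<^sub>R perp x) \<partial>lborel) = (\<integral>\<^sup>+x. F x \<partial>lborel)"
proof -
  have "(\<integral>\<^sup>+x. F x \<partial>lborel) = (\<integral>\<^sup>+x. F (c + x) \<partial>lborel)"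
    by (simp add: nn_integral_shift)
  also have "\<dots> = (\<integral>\<^sup>+x. F (c + x) \<partial>density (distr lborel borel (\<lambda>x. a *\<^sub>R x + b *\<^sub>R perp x)) (\<lambda>_. ennreal (a\<^sup>2 + b\<^sup>2)))"
    using lborel_linear_perp[OF d] by simp
  also have "\<dots> = (\<integral>\<^sup>+x. ennreal (a\<^sup>2 + b\<^sup>2) * F (c + x) \<partial>distr lborel borel (\<lambda>x. a *\<^sub>R x + b *\<^sub>R perp x))"
    by (rule nn_integral_density) measurable
  also have "\<dots> = (\<integral>\<^sup>+x. ennreal (a\<^sup>2 + b\<^sup>2) * F (c + (a *\<^sub>R x + b *\<^sub>R perp x)) \<partial>lborel)"
    by (rule nn_integral_distr) measurable
  also have "\<dots> = ennreal (a\<^sup>2 + b\<^sup>2) * (\<integral>\<^sup>+x. F (c + (a *\<^sub>R x + b *\<^sub>R perp x)) \<partial>lborel)"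
    by (rule nn_integral_cmult) measurable
  finally show ?thesis by (simp add: add.assoc)
qed

lemma nn_integral_linear_perp_le:
  fixes F :: "real^2 \<Rightarrow> ennreal"
  assumes F: "F \<in> borel_measurable borel" and d: "a\<^sup>2 = 1"
  shows "(\<integral>\<^sup>+x. F (c + a *\<^sub>R x + b *\<^sub>R perp x) \<partial>lborel) \<le> (\<integral>\<^sup>+x. F x \<partial>lborel)" (is "?I \<le> _")
proof -
  have "a\<^sup>2 + b\<^sup>2 \<ge> 1" using d by simp
  then have "ennreal 1 \<le> ennreal (a\<^sup>2 + b\<^sup>2)"
    by (rule ennreal_leI)
  from mult_right_mono[OF this, of ?I] have "?I \<le> ennreal (a\<^sup>2 + b\<^sup>2) * ?I"
    by (simp del: ennreal_plus)
  also have "\<dots> = (\<integral>\<^sup>+x. F x \<partial>lborel)"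
    using \<open>a\<^sup>2 + b\<^sup>2 \<ge> 1\<close> by (intro nn_integral_linear_perp[OF F]) simp
  finally show ?thesis .
qed

lemma AE_linear_perp:
  assumes P: "AE x in lborel. P x" and d: "a\<^sup>2 + b\<^sup>2 > 0"
  shows "AE x in lborel. P (c + a *\<^sub>R x + b *\<^sub>R perp x)"
proof -
  obtain N where N: "{x. \<not> P x} \<subseteq> N" "N \<in> null_sets lborel"
    using P unfolding eventually_ae_filter by auto
  then have [measurable]: "N \<in> sets borel" by auto
  have "ennreal (a\<^sup>2 + b\<^sup>2) * (\<integral>\<^sup>+x. indicator N (c + a *\<^sub>R x + b *\<^sub>R perp x) \<partial>lborel) = (\<integral>\<^sup>+x. indicator N x \<partial>lborel)"
    by (rule nn_integral_linear_perp[OF _ d]) measurable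
  also have "\<dots> = 0"
    using N(2) by auto
  finally have "(\<integral>\<^sup>+x. indicator N (c + a *\<^sub>R x + b *\<^sub>R perp x) \<partial>lborel) = 0"
    using d by (auto simp: ennreal_eq_0_iff)
  then have "AE x in lborel. indicator N (c + a *\<^sub>R x + b *\<^sub>R perp x) = (0::ennreal)"
    by (subst (asm) nn_integral_0_iff_AE) measurable
  then show ?thesis
    by eventually_elim (use N(1) in \<open>auto simp: indicator_def split: if_splits\<close>)
qed

lemma norm_integral_le_nn_integral: "ennreal (norm (integral\<^sup>L M f)) \<le> (\<integral>\<^sup>+x. ennreal (norm (f x)) \<partial>M)"
  by (cases "integrable M f") (auto simp: integral_norm_bound_ennreal not_integrable_integral_eq)

lemma CR_integral_measurable:
  assumes [measurable]: "f \<in> borel_measurable borel" "g \<in> borel_measurable borel" "h \<in> borel_measurable borel"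
  shows "CR_integral f g h \<in> borel_measurable borel"
  unfolding CR_integral_def set_lebesgue_integral_def by measurable

lemma CR_integral_cong:
  assumes "L2_rel f f'" "L2_rel g g'" "L2_rel h h'"
  shows "CR_integral f g h \<xi> = CR_integral f' g' h' \<xi>"
proof -
  have [measurable]: "f \<in> borel_measurable borel" "g \<in> borel_measurable borel" "h \<in> borel_measurable borel"
    "f' \<in> borel_measurable borel" "g' \<in> borel_measurable borel" "h' \<in> borel_measurable borel"
    using assms by (auto simp: L2_rel_def square_integrable_def)
  have eq: "AE x in lborel. f x = f' x" "AE x in lborel. g x = g' x" "AE x in lborel. h x = h' x"
    using assms by (auto simp: L2_rel_def)
  have inner: "(LINT x|lborel. f (\<xi> + x) * cnj (g (\<xi> + x + l *\<^sub>R perp x)) * h (\<xi> + l *\<^sub>R perp x)) =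
      (LINT x|lborel. f' (\<xi> + x) * cnj (g' (\<xi> + x + l *\<^sub>R perp x)) * h' (\<xi> + l *\<^sub>R perp x))"
    if "l \<noteq> 0" for l
  proof (rule integral_cong_AE)
    have "AE x in lborel. f (\<xi> + x) = f' (\<xi> + x)"
      using AE_linear_perp[OF eq(1), of 1 0 \<xi>] by simp
    moreover have "AE x in lborel. g (\<xi> + x + l *\<^sub>R perp x) = g' (\<xi> + x + l *\<^sub>R perp x)"
      using AE_linear_perp[OF eq(2), of 1 l \<xi>] by (simp add: add_pos_nonneg)
    moreover have "AE x in lborel. h (\<xi> + l *\<^sub>R perp x) = h' (\<xi> + l *\<^sub>R perp x)"
      using AE_linear_perp[OF eq(3), of 0 l \<xi>] that by simp
    ultimately show "AE x in lborel. f (\<xi> + x) * cnj (g (\<xi> + x + l *\<^sub>R perp x)) * h (\<xi> + l *\<^sub>R perp x) =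
        f' (\<xi> + x) * cnj (g' (\<xi> + x + l *\<^sub>R perp x)) * h' (\<xi> + l *\<^sub>R perp x)"
      by eventually_elim simp
  qed measurable
  show ?thesis
    unfolding CR_integral_def set_lebesgue_integral_def
  proof (rule integral_cong_AE)
    have "AE l in lborel. l \<noteq> (0::real)"
      by (rule AE_lborel_singleton)
    then show "AE l in lborel. indicat_real {- 1..1} l *\<^sub>R
          (LINT x|lborel. f (\<xi> + x) * cnj (g (\<xi> + x + l *\<^sub>R perp x)) * h (\<xi> + l *\<^sub>R perp x)) =
        indicat_real {- 1..1} l *\<^sub>R
          (LINT x|lborel. f' (\<xi> + x) * cnj (g' (\<xi> + x + l *\<^sub>R perp x)) * h' (\<xi> + l *\<^sub>R perp x))"
      by eventually_elim (subst inner, assumption, rule refl)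
  qed measurable
qed

lemma CR_integral_square_integrable:
  assumes f: "square_integrable f" and g: "square_integrable g" and h: "square_integrable h"
  shows "square_integrable (CR_integral f g h)"
proof -
  have [measurable]: "f \<in> borel_measurable borel" "g \<in> borel_measurable borel" "h \<in> borel_measurable borel"
    using assms by (auto simp: square_integrable_def)
  define F G H where "F x = ennreal (norm (f x))" and "G x = ennreal (norm (g x))"
    and "H x = ennreal (norm (h x))" for x
  have [measurable]: "F \<in> borel_measurable borel" "G \<in> borel_measurable borel" "H \<in> borel_measurable borel"
    unfolding F_def G_def H_def by measurable
  define I :: "real \<Rightarrow> ennreal" where "I l = indicator {-1..1} l" for l
  have [measurable]: "I \<in> borel_measurable borel"
    unfolding I_def by measurable
  have I2: "(I l)\<^sup>2 = I l" and II: "I l * I l = I l" for l by (auto simp: I_def indicator_def)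
  have intI: "(\<integral>\<^sup>+l. I l * c \<partial>lborel) = 2 * c" for c
  proof -
    have "(\<integral>\<^sup>+l. I l * c \<partial>lborel) = (\<integral>\<^sup>+l. I l \<partial>lborel) * c"
      by (rule nn_integral_multc) measurable
    also have "(\<integral>\<^sup>+l. I l \<partial>lborel) = 2"
      by (simp add: I_def)
    finally show ?thesis .
  qed
  let ?M = "lborel \<Otimes>\<^sub>M lborel :: (real \<times> (real^2)) measure"
  have fst: "(\<integral>\<^sup>+(l, x). K l x \<partial>?M) = (\<integral>\<^sup>+l. \<integral>\<^sup>+x. K l x \<partial>lborel \<partial>lborel)"
    if "(\<lambda>(l, x). K l x) \<in> borel_measurable ?M" for K
    using lborel.nn_integral_fst[OF that] by simp
  have L2: "(\<integral>\<^sup>+x. (F x)\<^sup>2 \<partial>lborel) < \<infinity>" "(\<integral>\<^sup>+x. (G x)\<^sup>2 \<partial>lborel) < \<infinity>" "(\<integral>\<^sup>+x. (H x)\<^sup>2 \<partial>lborel) < \<infinity>"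
    using f g h by (simp_all add: square_integrable_iff_nn F_def G_def H_def ennreal_power)
  have "(ennreal (norm (CR_integral f g h \<xi>)))\<^sup>2 \<le>
      (2 * (\<integral>\<^sup>+x. (G x)\<^sup>2 \<partial>lborel)) * (\<integral>\<^sup>+l. \<integral>\<^sup>+x. I l * ((F (\<xi> + x))\<^sup>2 * (H (\<xi> + l *\<^sub>R perp x))\<^sup>2) \<partial>lborel \<partial>lborel)" for \<xi>
  proof -
    have "ennreal (norm (CR_integral f g h \<xi>)) \<le>
        (\<integral>\<^sup>+l. ennreal (norm (indicat_real {- 1..1} l *\<^sub>R
          (LINT x|lborel. f (\<xi> + x) * cnj (g (\<xi> + x + l *\<^sub>R perp x)) * h (\<xi> + l *\<^sub>R perp x)))) \<partial>lborel)"
      unfolding CR_integral_def set_lebesgue_integral_def by (rule norm_integral_le_nn_integral)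
    also have "\<dots> \<le> (\<integral>\<^sup>+l. \<integral>\<^sup>+x. (I l * G (\<xi> + x + l *\<^sub>R perp x)) * (I l * (F (\<xi> + x) * H (\<xi> + l *\<^sub>R perp x))) \<partial>lborel \<partial>lborel)"
    proof (rule nn_integral_mono)
      fix l :: real
      have "ennreal (norm (LINT x|lborel. f (\<xi> + x) * cnj (g (\<xi> + x + l *\<^sub>R perp x)) * h (\<xi> + l *\<^sub>R perp x)))
          \<le> (\<integral>\<^sup>+x. ennreal (norm (f (\<xi> + x) * cnj (g (\<xi> + x + l *\<^sub>R perp x)) * h (\<xi> + l *\<^sub>R perp x))) \<partial>lborel)"
        by (rule norm_integral_le_nn_integral)
      also have "\<dots> = (\<integral>\<^sup>+x. G (\<xi> + x + l *\<^sub>R perp x) * (F (\<xi> + x) * H (\<xi> + l *\<^sub>R perp x)) \<partial>lborel)"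
        by (intro nn_integral_cong) (simp add: F_def G_def H_def norm_mult ennreal_mult mult.assoc mult.left_commute)
      finally show "ennreal (norm (indicat_real {- 1..1} l *\<^sub>R
          (LINT x|lborel. f (\<xi> + x) * cnj (g (\<xi> + x + l *\<^sub>R perp x)) * h (\<xi> + l *\<^sub>R perp x)))) \<le>
          (\<integral>\<^sup>+x. (I l * G (\<xi> + x + l *\<^sub>R perp x)) * (I l * (F (\<xi> + x) * H (\<xi> + l *\<^sub>R perp x))) \<partial>lborel)"
        by (cases "l \<in> {-1..1}") (simp_all add: I_def)
    qed
    also have "\<dots> = (\<integral>\<^sup>+(l, x). (I l * G (\<xi> + x + l *\<^sub>R perp x)) * (I l * (F (\<xi> + x) * H (\<xi> + l *\<^sub>R perp x))) \<partial>?M)"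
      by (rule fst[symmetric]) measurable
    finally have "(ennreal (norm (CR_integral f g h \<xi>)))\<^sup>2 \<le>
        (\<integral>\<^sup>+(l, x). (I l * G (\<xi> + x + l *\<^sub>R perp x)) * (I l * (F (\<xi> + x) * H (\<xi> + l *\<^sub>R perp x))) \<partial>?M)\<^sup>2"
      by (intro power_mono) auto
    also have "\<dots> \<le> (\<integral>\<^sup>+(l, x). (I l * G (\<xi> + x + l *\<^sub>R perp x))\<^sup>2 \<partial>?M) *
        (\<integral>\<^sup>+(l, x). (I l * (F (\<xi> + x) * H (\<xi> + l *\<^sub>R perp x)))\<^sup>2 \<partial>?M)"
      unfolding case_prod_beta by (rule Cauchy_Schwarz_nn_integral) measurable
    also have "(\<integral>\<^sup>+(l, x). (I l * (F (\<xi> + x) * H (\<xi> + l *\<^sub>R perp x)))\<^sup>2 \<partial>?M) =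
        (\<integral>\<^sup>+l. \<integral>\<^sup>+x. I l * ((F (\<xi> + x))\<^sup>2 * (H (\<xi> + l *\<^sub>R perp x))\<^sup>2) \<partial>lborel \<partial>lborel)"
      unfolding power_mult_distrib I2 by (rule fst) measurable
    also have "(\<integral>\<^sup>+(l, x). (I l * G (\<xi> + x + l *\<^sub>R perp x))\<^sup>2 \<partial>?M) =
        (\<integral>\<^sup>+l. \<integral>\<^sup>+x. (I l * G (\<xi> + x + l *\<^sub>R perp x))\<^sup>2 \<partial>lborel \<partial>lborel)"
      by (rule fst) measurable
    also have "\<dots> = (\<integral>\<^sup>+l. I l * (\<integral>\<^sup>+x. (G (\<xi> + x + l *\<^sub>R perp x))\<^sup>2 \<partial>lborel) \<partial>lborel)"
      unfolding power_mult_distrib I2 by (intro nn_integral_cong nn_integral_cmult) measurable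
    also have "\<dots> \<le> (\<integral>\<^sup>+l. I l * (\<integral>\<^sup>+x. (G x)\<^sup>2 \<partial>lborel) \<partial>lborel)"
    proof (rule nn_integral_mono, rule mult_left_mono)
      show "(\<integral>\<^sup>+x. (G (\<xi> + x + l *\<^sub>R perp x))\<^sup>2 \<partial>lborel) \<le> (\<integral>\<^sup>+x. (G x)\<^sup>2 \<partial>lborel)" for l
        using nn_integral_linear_perp_le[of "\<lambda>x. (G x)\<^sup>2" 1 \<xi> l] by simp
    qed simp
    finally show ?thesis
      by (simp add: intI mult_right_mono)
  qed
  then have "(\<integral>\<^sup>+\<xi>. (ennreal (norm (CR_integral f g h \<xi>)))\<^sup>2 \<partial>lborel) \<le>
      (\<integral>\<^sup>+\<xi>. (2 * (\<integral>\<^sup>+x. (G x)\<^sup>2 \<partial>lborel)) * (\<integral>\<^sup>+l. \<integral>\<^sup>+x. I l * ((F (\<xi> + x))\<^sup>2 * (H (\<xi> + l *\<^sub>R perp x))\<^sup>2) \<partial>lborel \<partial>lborel) \<partial>lborel)"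
    by (intro nn_integral_mono)
  also have "\<dots> = (2 * (\<integral>\<^sup>+x. (G x)\<^sup>2 \<partial>lborel)) *
      (\<integral>\<^sup>+\<xi>. \<integral>\<^sup>+l. \<integral>\<^sup>+x. I l * ((F (\<xi> + x))\<^sup>2 * (H (\<xi> + l *\<^sub>R perp x))\<^sup>2) \<partial>lborel \<partial>lborel \<partial>lborel)"
    by (intro nn_integral_cmult) measurable
  also have "(\<integral>\<^sup>+\<xi>. \<integral>\<^sup>+l. \<integral>\<^sup>+x. I l * ((F (\<xi> + x))\<^sup>2 * (H (\<xi> + l *\<^sub>R perp x))\<^sup>2) \<partial>lborel \<partial>lborel \<partial>lborel)
      = (\<integral>\<^sup>+l. \<integral>\<^sup>+\<xi>. \<integral>\<^sup>+x. I l * ((F (\<xi> + x))\<^sup>2 * (H (\<xi> + l *\<^sub>R perp x))\<^sup>2) \<partial>lborel \<partial>lborel \<partial>lborel)"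
    by (rule lborel_pair.Fubini'[symmetric]) measurable
  also have "\<dots> = (\<integral>\<^sup>+l. I l * (\<integral>\<^sup>+\<xi>. \<integral>\<^sup>+x. (F (\<xi> + x))\<^sup>2 * (H (\<xi> + l *\<^sub>R perp x))\<^sup>2 \<partial>lborel \<partial>lborel) \<partial>lborel)"
    by (intro nn_integral_cong) (simp add: nn_integral_cmult)
  also have "\<dots> \<le> (\<integral>\<^sup>+l. I l * ((\<integral>\<^sup>+x. (F x)\<^sup>2 \<partial>lborel) * (\<integral>\<^sup>+x. (H x)\<^sup>2 \<partial>lborel)) \<partial>lborel)"
  proof (rule nn_integral_mono, rule mult_left_mono)
    fix l :: real
    have "(\<integral>\<^sup>+\<xi>. \<integral>\<^sup>+x. (F (\<xi> + x))\<^sup>2 * (H (\<xi> + l *\<^sub>R perp x))\<^sup>2 \<partial>lborel \<partial>lborel) =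
        (\<integral>\<^sup>+x. \<integral>\<^sup>+\<xi>. (F (\<xi> + x))\<^sup>2 * (H (\<xi> + l *\<^sub>R perp x))\<^sup>2 \<partial>lborel \<partial>lborel)"
      by (rule lborel_pair.Fubini') measurable
    also have "\<dots> = (\<integral>\<^sup>+x. \<integral>\<^sup>+\<xi>. (F \<xi>)\<^sup>2 * (H (\<xi> + (-1) *\<^sub>R x + l *\<^sub>R perp x))\<^sup>2 \<partial>lborel \<partial>lborel)"
    proof (rule nn_integral_cong)
      fix x :: "real^2"
      show "(\<integral>\<^sup>+\<xi>. (F (\<xi> + x))\<^sup>2 * (H (\<xi> + l *\<^sub>R perp x))\<^sup>2 \<partial>lborel) =
          (\<integral>\<^sup>+\<xi>. (F \<xi>)\<^sup>2 * (H (\<xi> + (-1) *\<^sub>R x + l *\<^sub>R perp x))\<^sup>2 \<partial>lborel)"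
        by (subst nn_integral_shift[of _ x, symmetric]) (simp_all add: algebra_simps)
    qed
    also have "\<dots> = (\<integral>\<^sup>+\<xi>. \<integral>\<^sup>+x. (F \<xi>)\<^sup>2 * (H (\<xi> + (-1) *\<^sub>R x + l *\<^sub>R perp x))\<^sup>2 \<partial>lborel \<partial>lborel)"
      by (rule lborel_pair.Fubini'[symmetric]) measurable
    also have "\<dots> = (\<integral>\<^sup>+\<xi>. (F \<xi>)\<^sup>2 * (\<integral>\<^sup>+x. (H (\<xi> + (-1) *\<^sub>R x + l *\<^sub>R perp x))\<^sup>2 \<partial>lborel) \<partial>lborel)"
      by (intro nn_integral_cong nn_integral_cmult) measurable
    also have "\<dots> \<le> (\<integral>\<^sup>+\<xi>. (F \<xi>)\<^sup>2 * (\<integral>\<^sup>+x. (H x)\<^sup>2 \<partial>lborel) \<partial>lborel)"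
      by (rule nn_integral_mono, rule mult_left_mono, rule nn_integral_linear_perp_le[where F = "\<lambda>x. (H x)\<^sup>2"]) auto
    also have "\<dots> = (\<integral>\<^sup>+x. (F x)\<^sup>2 \<partial>lborel) * (\<integral>\<^sup>+x. (H x)\<^sup>2 \<partial>lborel)"
      by (rule nn_integral_multc) measurable
    finally show "(\<integral>\<^sup>+\<xi>. \<integral>\<^sup>+x. (F (\<xi> + x))\<^sup>2 * (H (\<xi> + l *\<^sub>R perp x))\<^sup>2 \<partial>lborel \<partial>lborel)
        \<le> (\<integral>\<^sup>+x. (F x)\<^sup>2 \<partial>lborel) * (\<integral>\<^sup>+x. (H x)\<^sup>2 \<partial>lborel)" .
  qed simp
  finally have "(\<integral>\<^sup>+\<xi>. (ennreal (norm (CR_integral f g h \<xi>)))\<^sup>2 \<partial>lborel) \<le>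
      (2 * (\<integral>\<^sup>+x. (G x)\<^sup>2 \<partial>lborel)) * (2 * ((\<integral>\<^sup>+x. (F x)\<^sup>2 \<partial>lborel) * (\<integral>\<^sup>+x. (H x)\<^sup>2 \<partial>lborel)))"
    by (simp add: intI mult_left_mono)
  also have "\<dots> < \<infinity>"
    using L2 by (simp add: ennreal_mult_less_top)
  finally show ?thesis
    unfolding square_integrable_iff_nn
    using CR_integral_measurable[of f g h] by (simp add: ennreal_power)
qed

text \<open>
  The obligation discharged here is that \<open>CR_integral\<close> respects equality almost everywhere and
  maps square integrable functions to a square integrable function.
\<close>

lift_definition CR_trilinear :: "L2 \<Rightarrow> L2 \<Rightarrow> L2 \<Rightarrow> L2" is CR_integral
proof -
  fix f f' g g' h h' assume *: "L2_rel f f'" "L2_rel g g'" "L2_rel h h'"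
  have "CR_integral f g h = CR_integral f' g' h'"
    using CR_integral_cong[OF *] by blast
  moreover have "square_integrable (CR_integral f g h)"
    using * by (auto simp: L2_rel_def CR_integral_square_integrable)
  ultimately show "L2_rel (CR_integral f g h) (CR_integral f' g' h')"
    by (simp add: L2_rel_def)
qed

section \<open>The spaces $L^\infty([0,T],L^2)$ and $L^1([0,T],L^2)$\<close>

text \<open>
  Elements are represented by functions on \<open>real\<close> of which only the values on \<open>{0..T}\<close> matter.
  Functions that agree almost everywhere are not identified; all notions below except
  \<open>CR_solution\<close> are invariant under such changes.
\<close>

definition Linf_norm :: "real \<Rightarrow> (real \<Rightarrow> L2) \<Rightarrow> ereal" where
  "Linf_norm T f = esssup (lebesgue_on {0..T}) (\<lambda>t. ereal (norm (f t)))"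

definition Linf_L2 :: "real \<Rightarrow> (real \<Rightarrow> L2) set" where
  "Linf_L2 T = {f \<in> borel_measurable (lebesgue_on {0..T}). Linf_norm T f < \<infinity>}"

definition L1_L2 :: "real \<Rightarrow> (real \<Rightarrow> L2) set" where
  "L1_L2 T = {g. integrable (lebesgue_on {0..T}) g}"

definition duality_pairing :: "real \<Rightarrow> (real \<Rightarrow> L2) \<Rightarrow> (real \<Rightarrow> L2) \<Rightarrow> complex" where
  "duality_pairing T f g = (LINT t|lebesgue_on {0..T}. cinner_L2 (f t) (g t))"

text \<open>
  $L^\infty([0,T],L^2)$ is the dual of $L^1([0,T],L^2)$ under this pairing, so the weak-* topology is
  the coarsest one for which the evaluations \<open>\<lambda>f. duality_pairing T f g\<close> are continuous. It
  is obtained as the pullback of the topology of pointwise convergence on functions of \<open>g\<close>.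
\<close>

definition weak_star_topology :: "real \<Rightarrow> (real \<Rightarrow> L2) topology" where
  "weak_star_topology T =
     pullback_topology (Linf_L2 T) (\<lambda>f. \<lambda>g\<in>L1_L2 T. duality_pairing T f g)
       (product_topology (\<lambda>_. euclidean) (L1_L2 T))"

lemma limitin_weak_star_topology:
  "limitin (weak_star_topology T) F f sequentially \<longleftrightarrow>
     f \<in> Linf_L2 T \<and> (\<forall>\<^sub>F n in sequentially. F n \<in> Linf_L2 T) \<and>
     (\<forall>g\<in>L1_L2 T. (\<lambda>n. duality_pairing T (F n) g) \<longlonglongrightarrow> duality_pairing T f g)"
proof -
  define ev where "ev f = (\<lambda>g\<in>L1_L2 T. duality_pairing T f g)" for f
  define P where "P = product_topology (\<lambda>_. euclidean :: complex topology) (L1_L2 T)"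
  have ev: "ev h \<in> topspace P" for h
    by (auto simp: ev_def P_def)
  have "limitin (weak_star_topology T) F f sequentially \<longleftrightarrow>
      f \<in> Linf_L2 T \<and> (\<forall>\<^sub>F n in sequentially. F n \<in> Linf_L2 T) \<and> limitin P (\<lambda>n. ev (F n)) (ev f) sequentially"
    (is "?L \<longleftrightarrow> ?A \<and> ?B \<and> ?R")
  proof
    assume L: ?L
    have top: "topspace (weak_star_topology T) = Linf_L2 T"
      using ev by (auto simp: weak_star_topology_def topspace_pullback_topology ev_def P_def)
    have A: ?A using L top by (auto simp: limitin_def)
    have B: ?B using L top openin_topspace[of "weak_star_topology T"] unfolding limitin_def by metis
    have "\<forall>\<^sub>F n in sequentially. ev (F n) \<in> U" if U: "openin P U" "ev f \<in> U" for U
    proof -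
      have "openin (weak_star_topology T) (ev -` U \<inter> Linf_L2 T)"
        using U(1) unfolding weak_star_topology_def openin_pullback_topology ev_def P_def by blast
      then have "\<forall>\<^sub>F n in sequentially. F n \<in> ev -` U \<inter> Linf_L2 T"
        using L A U(2) unfolding limitin_def by blast
      then show ?thesis by eventually_elim auto
    qed
    with A B show "?A \<and> ?B \<and> ?R" using ev by (auto simp: limitin_def)
  next
    assume R: "?A \<and> ?B \<and> ?R"
    show ?L
      unfolding limitin_def
    proof (intro conjI allI impI)
      show "f \<in> topspace (weak_star_topology T)"
        using R ev by (auto simp: weak_star_topology_def topspace_pullback_topology ev_def P_def)
      fix V assume V: "openin (weak_star_topology T) V \<and> f \<in> V"
      then obtain U where U: "openin P U" "V = ev -` U \<inter> Linf_L2 T"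
        unfolding weak_star_topology_def openin_pullback_topology ev_def P_def by blast
      then have "\<forall>\<^sub>F n in sequentially. ev (F n) \<in> U"
        using R V unfolding limitin_def by blast
      with conjunct1[OF conjunct2[OF R]] show "\<forall>\<^sub>F n in sequentially. F n \<in> V"
        by eventually_elim (auto simp: U)
    qed
  qed
  also have "limitin P (\<lambda>n. ev (F n)) (ev f) sequentially \<longleftrightarrow>
      (\<forall>g\<in>L1_L2 T. (\<lambda>n. duality_pairing T (F n) g) \<longlonglongrightarrow> duality_pairing T f g)"
    using ev unfolding P_def limitin_componentwise by (auto simp: ev_def)
  finally show ?thesis .
qed

section \<open>Solutions of (CR)\<close>

definition CR_solution :: "real \<Rightarrow> (real \<Rightarrow> L2) \<Rightarrow> bool" where
  "CR_solution T f \<longleftrightarrow>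
     f \<in> Linf_L2 T \<and>
     (\<forall>t\<in>{0..T}. f t = f 0 + \<i> *\<^sub>C (LINT s|lebesgue_on {0..t}. CR_trilinear (f s) (f s) (f s)))"

end

theory Submission
  imports Defs "HOL-Library.Diagonal_Subsequence"
begin

text \<open>
  The point is that \<open>F \<mapsto> \<T>(F,F,F)\<close> is weakly sequentially continuous on \<open>L\<^sup>2\<close>, although it is
  cubic. Once this is known, the result is a compactness argument in time.

  \<^emph>\<open>Weak continuity.\<close> The four points at which \<open>f\<close>, \<open>g\<close>, \<open>h\<close> and a test function \<open>k\<close> are evaluated
  are the corners of a rectangle, with \<open>f\<close>, \<open>h\<close> at the ends of one diagonal and \<open>g\<close>, \<open>k\<close> at the ends
  of the other. The diagonals have the same midpoint \<open>m\<close> and the same length, so with \<open>\<plusminus>v\<close> and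
  \<open>\<plusminus>S v\<close> their half-diagonals, \<open>S\<close> is a rotation that depends on \<open>\<lambda>\<close> only. In these coordinates
  the pairing of \<open>\<T>(f,g,h)\<close> with \<open>k\<close> becomes the integral over \<open>(m, v)\<close> of
  \<open>f(m + v) h(m - v) K(m, v)\<close>, where the kernel \<open>K\<close> is a weighted average over \<open>\<lambda>\<close> of the conjugate of
  \<open>g(m + S v) k(m - S v)\<close>; see \<open>cinner_CR_trilinear\<close>.
  For complex numbers \<open>z \<noteq> w\<close>, acting on the plane by rotation and scaling, the map
  \<open>(m, v) \<mapsto> (m + z v, m + w v)\<close> multiplies Lebesgue measure by a constant. Hence
  \<open>a(m + z v) b(m + w v)\<close> is square integrable in \<open>(m, v)\<close> when \<open>a\<close>, \<open>b\<close> are, and integrates to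
  something that tends to \<open>0\<close> against any fixed square integrable function when \<open>a\<close> stays bounded and
  \<open>b\<close> tends weakly to \<open>0\<close>: this is \<open>ends_weakly_null\<close>, the statement that a Hilbert--Schmidt operator
  is compact. Two consequences cover all cases.
  \<^item> The kernel \<open>K\<close> lies in \<open>L\<^sup>2\<close>, so the pairing tends to \<open>0\<close> when \<open>f\<close> or \<open>h\<close> tends weakly to \<open>0\<close>,
    the other stays bounded, and \<open>g\<close>, \<open>k\<close> are fixed.
  \<^item> When \<open>g\<close> tends weakly to \<open>0\<close>, the kernel \<open>K\<close> tends to \<open>0\<close> in norm. The square of its norm is a double
    integral over parameters \<open>\<lambda>\<close>, \<open>\<lambda>'\<close>. For \<open>\<lambda> \<noteq> \<lambda>'\<close> the rotations differ, the two copies of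
    \<open>g\<close> sit at \<open>m + S v\<close> and \<open>m + S' v\<close>, and the compactness just mentioned applies; dominated
    convergence does the rest (\<open>diagonal_kernel_weakly_null\<close>).

  Writing \<open>\<T>(X,X,X) - \<T>(x,x,x)\<close> as \<open>\<T>(X,X-x,X) + \<T>(X-x,x,X) + \<T>(x,x,X-x)\<close> gives
  \<open>weak_limit_CR_trilinear\<close>.

  \<^emph>\<open>Compactness in time.\<close> \<open>\<T>\<close> is bounded, so solutions that are bounded by \<open>C\<close> are Lipschitz in time with
  a constant that depends on \<open>C\<close> only. A weak form of the Arzela--Ascoli theorem, valid in separable
  Hilbert spaces, yields a subsequence that converges weakly at \<^emph>\<open>every\<close> time
  (\<open>weak_Arzela_Ascoli\<close>). Weak continuity and dominated convergence let one pass to the limit in the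
  integral equation tested against a fixed vector, and in the duality pairing with an element of
  \<open>L\<^sup>1([0,T],L\<^sup>2)\<close>.
\<close>

section \<open>Rectangles and linear changes of variables\<close>

text \<open>
  The plane is identified with \<open>\<complex>\<close>, so that \<open>perp\<close> is multiplication by \<open>\<i>\<close>. All linear maps
  that occur are then multiplications, and products and inverses of such maps are computed in \<open>\<complex>\<close>.
\<close>
definition complex_act :: "complex \<Rightarrow> real^2 \<Rightarrow> real^2" (infixr "\<odot>" 76) where
  "z \<odot> x = Re z *\<^sub>R x + Im z *\<^sub>R perp x"

lemma complex_act_measurable [measurable (raw)]:
  assumes [measurable]: "c \<in> borel_measurable M" "X \<in> borel_measurable M"
  shows "(\<lambda>u. c u \<odot> X u) \<in> borel_measurable M"
proof -
  have [measurable]: "Re \<in> borel_measurable borel" "Im \<in> borel_measurable borel"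
    by (intro borel_measurable_continuous_onI continuous_intros)+
  show ?thesis
    unfolding complex_act_def by measurable
qed

lemma complex_act_one: "1 \<odot> x = x"
  and complex_act_diff_left: "(z - w) \<odot> x = z \<odot> x - w \<odot> x"
  and complex_act_minus_left: "(- z) \<odot> x = - (z \<odot> x)"
  and complex_act_mult: "(z * w) \<odot> x = z \<odot> w \<odot> x"
  by (simp_all add: complex_act_def perp_add perp_scaleR perp_perp algebra_simps)

lemma nn_integral_complex_act:
  fixes F :: "real^2 \<Rightarrow> ennreal"
  assumes "F \<in> borel_measurable borel" "w \<noteq> 0"
  shows "ennreal ((norm w)\<^sup>2) * (\<integral>\<^sup>+x. F (c + w \<odot> x) \<partial>lborel) = (\<integral>\<^sup>+x. F x \<partial>lborel)"
proof -
  have "(Re w)\<^sup>2 + (Im w)\<^sup>2 > 0"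
    using assms(2) by (metis cmod_power2 zero_less_norm_iff zero_less_power)
  from nn_integral_linear_perp[OF assms(1) this, of c] show ?thesis
    by (simp add: complex_act_def add.assoc cmod_power2)
qed

abbreviation plane_pairs :: "((real^2) \<times> (real^2)) measure" where
  "plane_pairs \<equiv> lborel \<Otimes>\<^sub>M lborel"

text \<open>
  The image of Lebesgue measure under \<open>T\<close>, multiplied by \<open>k\<close>, is Lebesgue measure. For
  a linear isomorphism \<open>T\<close> of real 4-space, \<open>k\<close> is the absolute value of its determinant.
\<close>
definition scales_pairs :: "real \<Rightarrow> ((real^2) \<times> (real^2) \<Rightarrow> (real^2) \<times> (real^2)) \<Rightarrow> bool" where
  "scales_pairs k T \<longleftrightarrow> k > 0 \<and> T \<in> measurable plane_pairs plane_pairs \<and>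
     (\<forall>F\<in>borel_measurable plane_pairs. ennreal k * (\<integral>\<^sup>+u. F (T u) \<partial>plane_pairs) = (\<integral>\<^sup>+u. F u \<partial>plane_pairs))"

lemma scales_pairs_nn_integral:
  assumes "scales_pairs k T" "F \<in> borel_measurable plane_pairs"
  shows "ennreal k * (\<integral>\<^sup>+u. F (T u) \<partial>plane_pairs) = (\<integral>\<^sup>+u. F u \<partial>plane_pairs)"
  using assms by (auto simp: scales_pairs_def)

lemma scales_pairs_shear:
  assumes "b \<noteq> 0"
  shows "scales_pairs ((norm b)\<^sup>2) (\<lambda>u. (fst u + a \<odot> snd u, b \<odot> snd u))"
  unfolding scales_pairs_def
proof (intro conjI ballI)
  show "(norm b)\<^sup>2 > 0"
    using assms by simp
  show "(\<lambda>u. (fst u + a \<odot> snd u, b \<odot> snd u)) \<in> measurable plane_pairs plane_pairs"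
    by measurable
  fix F :: "(real^2) \<times> (real^2) \<Rightarrow> ennreal" assume F[measurable]: "F \<in> borel_measurable plane_pairs"
  have "(\<integral>\<^sup>+u. F (fst u + a \<odot> snd u, b \<odot> snd u) \<partial>plane_pairs) =
      (\<integral>\<^sup>+x. \<integral>\<^sup>+\<xi>. F (\<xi> + a \<odot> x, b \<odot> x) \<partial>lborel \<partial>lborel)"
    by (subst lborel_pair.nn_integral_snd[symmetric]) auto
  also have "\<dots> = (\<integral>\<^sup>+x. \<integral>\<^sup>+\<xi>. F (\<xi>, b \<odot> x) \<partial>lborel \<partial>lborel)"
  proof (rule nn_integral_cong)
    show "(\<integral>\<^sup>+\<xi>. F (\<xi> + a \<odot> x, b \<odot> x) \<partial>lborel) = (\<integral>\<^sup>+\<xi>. F (\<xi>, b \<odot> x) \<partial>lborel)" for x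
      using nn_integral_shift[of "\<lambda>\<xi>. F (\<xi>, b \<odot> x)" "a \<odot> x"] by (simp add: add.commute)
  qed
  also have "ennreal ((norm b)\<^sup>2) * \<dots> = ennreal ((norm b)\<^sup>2) * (\<integral>\<^sup>+x. (\<lambda>y. \<integral>\<^sup>+\<xi>. F (\<xi>, y) \<partial>lborel) (0 + b \<odot> x) \<partial>lborel)"
    by simp
  also have "\<dots> = (\<integral>\<^sup>+y. \<integral>\<^sup>+\<xi>. F (\<xi>, y) \<partial>lborel \<partial>lborel)"
    by (rule nn_integral_complex_act[OF _ assms]) measurable
  also have "\<dots> = (\<integral>\<^sup>+u. F u \<partial>plane_pairs)"
    by (rule lborel_pair.nn_integral_snd) measurable
  finally show "ennreal ((norm b)\<^sup>2) * (\<integral>\<^sup>+u. F (fst u + a \<odot> snd u, b \<odot> snd u) \<partial>plane_pairs) = (\<integral>\<^sup>+u. F u \<partial>plane_pairs)" .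
qed

lemma scales_pairs_shift:
  "scales_pairs 1 (\<lambda>u. (fst u, fst u + snd u))"
  unfolding scales_pairs_def
proof (intro conjI ballI)
  show "(\<lambda>u. (fst u, fst u + snd u)) \<in> measurable plane_pairs plane_pairs"
    by measurable
  fix F :: "(real^2) \<times> (real^2) \<Rightarrow> ennreal" assume F[measurable]: "F \<in> borel_measurable plane_pairs"
  have "(\<integral>\<^sup>+u. F (fst u, fst u + snd u) \<partial>plane_pairs) = (\<integral>\<^sup>+\<xi>. \<integral>\<^sup>+x. F (\<xi>, \<xi> + x) \<partial>lborel \<partial>lborel)"
    by (subst lborel.nn_integral_fst[symmetric]) auto
  also have "\<dots> = (\<integral>\<^sup>+\<xi>. \<integral>\<^sup>+x. F (\<xi>, x) \<partial>lborel \<partial>lborel)"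
    by (intro nn_integral_cong nn_integral_shift) measurable
  also have "\<dots> = (\<integral>\<^sup>+u. F u \<partial>plane_pairs)"
    by (rule lborel.nn_integral_fst) measurable
  finally show "ennreal 1 * (\<integral>\<^sup>+u. F (fst u, fst u + snd u) \<partial>plane_pairs) = (\<integral>\<^sup>+u. F u \<partial>plane_pairs)"
    by simp
qed simp

text \<open>
  The substitution behind every compactness statement below: the points \<open>m + z v\<close> and \<open>m + w v\<close> are
  independent coordinates as soon as \<open>z \<noteq> w\<close>. It is a shear composed with a scaling of \<open>v\<close> by
  \<open>w - z\<close> and the map \<open>(a, b) \<mapsto> (a, a + b)\<close>.
\<close>
lemma scales_pairs_ends:
  assumes "z \<noteq> w"
  shows "scales_pairs ((norm (z - w))\<^sup>2) (\<lambda>u. (fst u + z \<odot> snd u, fst u + w \<odot> snd u))"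
  unfolding scales_pairs_def
proof (intro conjI ballI)
  show "(norm (z - w))\<^sup>2 > 0"
    using assms by simp
  show "(\<lambda>u. (fst u + z \<odot> snd u, fst u + w \<odot> snd u)) \<in> measurable plane_pairs plane_pairs"
    by measurable
  fix F :: "(real^2) \<times> (real^2) \<Rightarrow> ennreal" assume F[measurable]: "F \<in> borel_measurable plane_pairs"
  have F': "(\<lambda>u. F (fst u, fst u + snd u)) \<in> borel_measurable plane_pairs"
    by measurable
  have eq: "fst u + w \<odot> snd u = fst u + z \<odot> snd u + (w - z) \<odot> snd u" for u :: "(real^2) \<times> (real^2)"
    by (simp add: complex_act_diff_left)
  have "ennreal ((norm (w - z))\<^sup>2) *
      (\<integral>\<^sup>+u. F (fst u + z \<odot> snd u, fst u + z \<odot> snd u + (w - z) \<odot> snd u) \<partial>plane_pairs) =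
      (\<integral>\<^sup>+u. F (fst u, fst u + snd u) \<partial>plane_pairs)"
    using scales_pairs_nn_integral[OF scales_pairs_shear F', of "w - z" z] assms by simp
  also have "\<dots> = (\<integral>\<^sup>+u. F u \<partial>plane_pairs)"
    using scales_pairs_shift F by (simp add: scales_pairs_def)
  finally show "ennreal ((norm (z - w))\<^sup>2) * (\<integral>\<^sup>+u. F (fst u + z \<odot> snd u, fst u + w \<odot> snd u) \<partial>plane_pairs) =
      (\<integral>\<^sup>+u. F u \<partial>plane_pairs)"
    by (simp only: eq[symmetric] norm_minus_commute)
qed

lemma scales_pairs_integral:
  fixes f :: "(real^2) \<times> (real^2) \<Rightarrow> complex"
  assumes T: "scales_pairs k T" and f[measurable]: "f \<in> borel_measurable plane_pairs"
  shows "(\<integral>u. f u \<partial>plane_pairs) = complex_of_real k * (\<integral>u. f (T u) \<partial>plane_pairs)"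
proof -
  have k: "k > 0" and [measurable]: "T \<in> measurable plane_pairs plane_pairs"
    using T by (auto simp: scales_pairs_def)
  have "plane_pairs = density (distr plane_pairs plane_pairs T) (\<lambda>_. ennreal k)"
  proof (rule measure_eqI)
    fix A assume "A \<in> sets plane_pairs"
    then have A [measurable]: "A \<in> sets plane_pairs" .
    have "emeasure (density (distr plane_pairs plane_pairs T) (\<lambda>_. ennreal k)) A =
        (\<integral>\<^sup>+u. ennreal k * indicator A u \<partial>distr plane_pairs plane_pairs T)"
      by (rule emeasure_density) (use A in auto)
    also have "\<dots> = (\<integral>\<^sup>+u. ennreal k * indicator A (T u) \<partial>plane_pairs)"
      by (rule nn_integral_distr) (use A in measurable)
    also have "\<dots> = ennreal k * (\<integral>\<^sup>+u. indicator A (T u) \<partial>plane_pairs)"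
      by (rule nn_integral_cmult) (use A in measurable)
    also have "\<dots> = (\<integral>\<^sup>+u. indicator A u \<partial>plane_pairs)"
      by (rule scales_pairs_nn_integral[OF T]) (use A in measurable)
    finally show "emeasure plane_pairs A = emeasure (density (distr plane_pairs plane_pairs T) (\<lambda>_. ennreal k)) A"
      using A by simp
  qed simp
  then have "(\<integral>u. f u \<partial>plane_pairs) = (\<integral>u. f u \<partial>density (distr plane_pairs plane_pairs T) (\<lambda>_. ennreal k))"
    by simp
  also have "\<dots> = (\<integral>u. k *\<^sub>R f u \<partial>distr plane_pairs plane_pairs T)"
    by (rule integral_density) (use k in auto)
  also have "\<dots> = (\<integral>u. k *\<^sub>R f (T u) \<partial>plane_pairs)"
    by (rule integral_distr) measurable
  finally show ?thesis
    by (simp add: scaleR_conv_of_real)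
qed

section \<open>Products of a bounded and a weakly null sequence\<close>

text \<open>
  Squared norms take values in \<open>ennreal\<close>: Tonelli's theorem and the Cauchy--Schwarz inequality then
  hold for all measurable functions, and integrability is read off at the end.
\<close>
definition sqnorm :: "'a measure \<Rightarrow> ('a \<Rightarrow> complex) \<Rightarrow> ennreal" where
  "sqnorm M f = (\<integral>\<^sup>+x. ennreal ((norm (f x))\<^sup>2) \<partial>M)"

lemma square_integrable_iff_sqnorm:
  "square_integrable f \<longleftrightarrow> f \<in> borel_measurable borel \<and> sqnorm lborel f < \<infinity>"
  by (simp add: square_integrable_iff_nn sqnorm_def)

lemma sqnorm_cnj [simp]: "sqnorm M (\<lambda>x. cnj (f x)) = sqnorm M f"
  by (simp add: sqnorm_def)

lemma sqnorm_abs_L2: "square_integrable f \<Longrightarrow> sqnorm lborel f = ennreal ((norm (abs_L2 f))\<^sup>2)"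
  by (simp add: sqnorm_def ennreal_norm_abs_L2)

lemma nn_integral_mult_le_sqnorm:
  assumes [measurable]: "f \<in> borel_measurable M" "g \<in> borel_measurable M"
  shows "(\<integral>\<^sup>+x. ennreal (norm (f x * g x)) \<partial>M)\<^sup>2 \<le> sqnorm M f * sqnorm M g"
  using Cauchy_Schwarz_nn_integral[of "\<lambda>x. ennreal (norm (f x))" M "\<lambda>x. ennreal (norm (g x))"]
  by (simp add: sqnorm_def norm_mult ennreal_mult ennreal_power)

lemma integral_mult_le_sqnorm:
  assumes "f \<in> borel_measurable M" "g \<in> borel_measurable M"
  shows "ennreal ((norm (\<integral>x. f x * g x \<partial>M))\<^sup>2) \<le> sqnorm M f * sqnorm M g"
proof -
  have "(ennreal (norm (\<integral>x. f x * g x \<partial>M)))\<^sup>2 \<le> (\<integral>\<^sup>+x. ennreal (norm (f x * g x)) \<partial>M)\<^sup>2"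
    by (intro power_mono norm_integral_le_nn_integral) auto
  also have "\<dots> \<le> sqnorm M f * sqnorm M g"
    by (rule nn_integral_mult_le_sqnorm[OF assms])
  finally show ?thesis
    by (simp add: ennreal_power)
qed

lemma integrable_mult_sqnorm:
  assumes [measurable]: "f \<in> borel_measurable M" "g \<in> borel_measurable M"
    and fin: "sqnorm M f < \<infinity>" "sqnorm M g < \<infinity>"
  shows "integrable M (\<lambda>x. f x * g x)"
proof (rule integrableI_bounded)
  have "(\<integral>\<^sup>+x. ennreal (norm (f x * g x)) \<partial>M)\<^sup>2 < \<infinity>"
    using nn_integral_mult_le_sqnorm[of f M g] fin
    by (auto intro: le_less_trans simp: ennreal_mult_less_top)
  then show "(\<integral>\<^sup>+x. ennreal (norm (f x * g x)) \<partial>M) < \<infinity>"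
    by (simp add: power_less_top_ennreal)
qed measurable

lemma integral_mult_tendsto_0:
  assumes meas: "\<And>n. f n \<in> borel_measurable M" "\<And>n. g n \<in> borel_measurable M"
    and f: "\<And>n. sqnorm M (f n) \<le> C" "C < \<infinity>" and g: "(\<lambda>n. sqnorm M (g n)) \<longlonglongrightarrow> 0"
  shows "(\<lambda>n. \<integral>x. f n x * g n x \<partial>M) \<longlonglongrightarrow> 0"
proof -
  have "(\<lambda>n. C * sqnorm M (g n)) \<longlonglongrightarrow> C * 0"
    by (rule ennreal_tendsto_cmult[OF _ g]) (use f(2) in simp)
  then have lim: "(\<lambda>n. C * sqnorm M (g n)) \<longlonglongrightarrow> 0"
    by simp
  have "(\<lambda>n. ennreal ((norm (\<integral>x. f n x * g n x \<partial>M))\<^sup>2)) \<longlonglongrightarrow> 0"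
  proof (rule tendsto_sandwich[OF _ _ tendsto_const lim])
    show "\<forall>\<^sub>F n in sequentially. ennreal ((norm (\<integral>x. f n x * g n x \<partial>M))\<^sup>2) \<le> C * sqnorm M (g n)"
      by (intro always_eventually allI order_trans[OF integral_mult_le_sqnorm[OF meas] mult_right_mono] f(1)) simp
  qed auto
  then have "(\<lambda>n. (norm (\<integral>x. f n x * g n x \<partial>M))\<^sup>2) \<longlonglongrightarrow> 0"
    by (simp add: tendsto_ennreal_iff flip: ennreal_0)
  from tendsto_real_sqrt[OF this] show ?thesis
    by (simp add: tendsto_norm_zero_iff)
qed

lemma sqnorm_tensor:
  assumes [measurable]: "a \<in> borel_measurable borel" "b \<in> borel_measurable borel"
  shows "sqnorm plane_pairs (\<lambda>u. a (fst u) * b (snd u)) = sqnorm lborel a * sqnorm lborel b"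
proof -
  have "sqnorm plane_pairs (\<lambda>u. a (fst u) * b (snd u)) =
      (\<integral>\<^sup>+x. \<integral>\<^sup>+y. ennreal ((norm (a x))\<^sup>2) * ennreal ((norm (b y))\<^sup>2) \<partial>lborel \<partial>lborel)"
    unfolding sqnorm_def
    by (subst lborel.nn_integral_fst[symmetric]) (auto simp: norm_mult power_mult_distrib ennreal_mult)
  also have "\<dots> = (\<integral>\<^sup>+x. ennreal ((norm (a x))\<^sup>2) * sqnorm lborel b \<partial>lborel)"
    unfolding sqnorm_def by (intro nn_integral_cong nn_integral_cmult) measurable
  also have "\<dots> = sqnorm lborel a * sqnorm lborel b"
    unfolding sqnorm_def by (rule nn_integral_multc) measurable
  finally show ?thesis .
qed

lemma sqnorm_ends:
  assumes [measurable]: "a \<in> borel_measurable borel" "b \<in> borel_measurable borel" and zw: "z \<noteq> w"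
  shows "ennreal ((norm (z - w))\<^sup>2) * sqnorm plane_pairs (\<lambda>u. a (fst u + z \<odot> snd u) * b (fst u + w \<odot> snd u)) =
    sqnorm lborel a * sqnorm lborel b"
  using scales_pairs_nn_integral[OF scales_pairs_ends[OF zw], of "\<lambda>u. ennreal ((norm (a (fst u) * b (snd u)))\<^sup>2)"]
    sqnorm_tensor[of a b] by (simp add: sqnorm_def)

lemma sqnorm_ends_finite:
  assumes "square_integrable a" "square_integrable b" and zw: "z \<noteq> w"
  shows "sqnorm plane_pairs (\<lambda>u. a (fst u + z \<odot> snd u) * b (fst u + w \<odot> snd u)) < \<infinity>" (is "?N < _")
proof -
  have "ennreal ((norm (z - w))\<^sup>2) * ?N < \<infinity>"
    using sqnorm_ends[of a b z w] assms by (simp add: square_integrable_iff_sqnorm ennreal_mult_less_top)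
  moreover have "(norm (z - w))\<^sup>2 > 0"
    using zw by simp
  ultimately show ?thesis
    by (auto simp: ennreal_mult_less_top ennreal_eq_0_iff simp del: zero_less_power2 zero_less_power)
qed

definition weakly_null :: "(nat \<Rightarrow> real^2 \<Rightarrow> complex) \<Rightarrow> bool" where
  "weakly_null s \<longleftrightarrow> (\<forall>\<phi>. square_integrable \<phi> \<longrightarrow> (\<lambda>n. \<integral>x. s n x * cnj (\<phi> x) \<partial>lborel) \<longlonglongrightarrow> 0)"

text \<open>
  Compactness of the Hilbert--Schmidt operator with kernel \<open>\<Phi>\<close>. It maps \<open>s n\<close> to
  \<open>G n x = \<integral>y. s n y * \<Phi> (x, y)\<close>, which tends to \<open>0\<close> for almost every \<open>x\<close> by weak
  convergence and is dominated, by Cauchy--Schwarz, by a multiple of the norm of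
  \<open>\<Phi> (x, \<cdot>)\<close>. So
  \<open>G n\<close> tends to \<open>0\<close> in norm, and pairing it with the bounded sequence \<open>r\<close> gives \<open>0\<close> in the limit.
\<close>
lemma tensor_weakly_null:
  assumes r: "\<And>n. r n \<in> borel_measurable borel" "\<And>n. sqnorm lborel (r n) \<le> C"
    and s: "\<And>n. s n \<in> borel_measurable borel" "\<And>n. sqnorm lborel (s n) \<le> C"
    and C: "C < \<infinity>" and null: "weakly_null s"
    and \<Phi>[measurable]: "\<Phi> \<in> borel_measurable plane_pairs" and fin: "sqnorm plane_pairs \<Phi> < \<infinity>"
  shows "(\<lambda>n. \<integral>u. r n (fst u) * s n (snd u) * \<Phi> u \<partial>plane_pairs) \<longlonglongrightarrow> 0"
proof -
  note [measurable] = r(1) s(1)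
  define G where "G n x = (\<integral>y. s n y * \<Phi> (x, y) \<partial>lborel)" for n x
  have [measurable]: "G n \<in> borel_measurable borel" for n
    unfolding G_def by measurable
  have N: "(\<integral>\<^sup>+x. sqnorm lborel (\<lambda>y. \<Phi> (x, y)) \<partial>lborel) = sqnorm plane_pairs \<Phi>"
    unfolding sqnorm_def by (rule lborel.nn_integral_fst) measurable
  have Nm [measurable]: "(\<lambda>x. sqnorm lborel (\<lambda>y. \<Phi> (x, y))) \<in> borel_measurable borel"
    unfolding sqnorm_def by measurable
  have le: "ennreal ((norm (G n x))\<^sup>2) \<le> C * sqnorm lborel (\<lambda>y. \<Phi> (x, y))" for n x
  proof -
    have "ennreal ((norm (G n x))\<^sup>2) \<le> sqnorm lborel (s n) * sqnorm lborel (\<lambda>y. \<Phi> (x, y))"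
      unfolding G_def by (rule integral_mult_le_sqnorm) measurable
    also have "\<dots> \<le> C * sqnorm lborel (\<lambda>y. \<Phi> (x, y))"
      using s(2) by (rule mult_right_mono) simp
    finally show ?thesis .
  qed
  have "AE x in lborel. sqnorm lborel (\<lambda>y. \<Phi> (x, y)) \<noteq> \<infinity>"
    by (rule nn_integral_PInf_AE) (use N fin in auto)
  then have lim: "AE x in lborel. (\<lambda>n. ennreal ((norm (G n x))\<^sup>2)) \<longlonglongrightarrow> 0"
  proof eventually_elim
    fix x assume "sqnorm lborel (\<lambda>y. \<Phi> (x, y)) \<noteq> \<infinity>"
    then have "square_integrable (\<lambda>y. cnj (\<Phi> (x, y)))"
      by (simp add: square_integrable_iff_sqnorm less_top)
    then have "(\<lambda>n. G n x) \<longlonglongrightarrow> 0"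
      using null unfolding weakly_null_def G_def by fastforce
    then have "(\<lambda>n. (norm (G n x))\<^sup>2) \<longlonglongrightarrow> (norm (0::complex))\<^sup>2"
      by (intro tendsto_intros)
    then show "(\<lambda>n. ennreal ((norm (G n x))\<^sup>2)) \<longlonglongrightarrow> 0"
      by (simp add: tendsto_ennreal_iff flip: ennreal_0)
  qed
  have "(\<lambda>n. sqnorm lborel (G n)) \<longlonglongrightarrow> (\<integral>\<^sup>+x. 0 \<partial>(lborel :: (real^2) measure))"
    unfolding sqnorm_def
  proof (rule nn_integral_dominated_convergence[where w = "\<lambda>x. C * sqnorm lborel (\<lambda>y. \<Phi> (x, y))"])
    show "(\<integral>\<^sup>+x. C * sqnorm lborel (\<lambda>y. \<Phi> (x, y)) \<partial>lborel) < \<infinity>"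
      using C fin N by (simp add: nn_integral_cmult ennreal_mult_less_top)
  qed (use le lim in auto)
  then have G0: "(\<lambda>n. sqnorm lborel (G n)) \<longlonglongrightarrow> 0"
    by simp
  have "(\<integral>u. r n (fst u) * s n (snd u) * \<Phi> u \<partial>plane_pairs) = (\<integral>x. r n x * G n x \<partial>lborel)" for n
  proof -
    have "sqnorm plane_pairs (\<lambda>u. r n (fst u) * s n (snd u)) < \<infinity>"
      using sqnorm_tensor[of "r n" "s n"] r(2)[of n] s(2)[of n] C
      by (auto simp: ennreal_mult_less_top intro: le_less_trans)
    then have "integrable plane_pairs (\<lambda>u. r n (fst u) * s n (snd u) * \<Phi> u)"
      by (intro integrable_mult_sqnorm fin) measurable
    from lborel_pair.integral_fst'[OF this]
    show ?thesis
      by (simp add: G_def mult.assoc)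
  qed
  moreover have "(\<lambda>n. \<integral>x. r n x * G n x \<partial>lborel) \<longlonglongrightarrow> 0"
    by (rule integral_mult_tendsto_0[OF _ _ r(2) C G0]) measurable
  ultimately show ?thesis
    by simp
qed

text \<open>
  The preceding lemma in the coordinates \<open>(m, v)\<close>. Solving \<open>a = m + z v\<close>, \<open>b = m + w v\<close>
  for \<open>v = (a - b) / (z - w)\<close> and \<open>m = a - z v\<close> turns \<open>\<Phi>\<close> into a square integrable function
  of \<open>(a, b)\<close>.
\<close>
lemma ends_weakly_null:
  assumes r: "\<And>n. r n \<in> borel_measurable borel" "\<And>n. sqnorm lborel (r n) \<le> C"
    and s: "\<And>n. s n \<in> borel_measurable borel" "\<And>n. sqnorm lborel (s n) \<le> C"
    and C: "C < \<infinity>" and null: "weakly_null s"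
    and \<Phi>[measurable]: "\<Phi> \<in> borel_measurable plane_pairs" and fin: "sqnorm plane_pairs \<Phi> < \<infinity>"
    and zw: "z \<noteq> w"
  shows "(\<lambda>n. \<integral>u. r n (fst u + z \<odot> snd u) * s n (fst u + w \<odot> snd u) * \<Phi> u \<partial>plane_pairs) \<longlonglongrightarrow> 0"
proof -
  note [measurable] = r(1) s(1)
  let ?T = "\<lambda>u. (fst u + z \<odot> snd u, fst u + w \<odot> snd u)"
  define y where "y u = inverse (z - w) \<odot> (fst u - snd u)" for u :: "(real^2) \<times> (real^2)"
  define \<Phi>' where "\<Phi>' u = \<Phi> (fst u - z \<odot> y u, y u)" for u
  have [measurable]: "\<Phi>' \<in> borel_measurable plane_pairs"
    unfolding \<Phi>'_def y_def by measurable
  have y: "y (?T u) = snd u" for u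
  proof -
    have "y (?T u) = inverse (z - w) \<odot> (z - w) \<odot> snd u"
      by (simp add: y_def complex_act_diff_left)
    also have "\<dots> = snd u"
      using zw by (simp add: complex_act_mult[symmetric] complex_act_one)
    finally show ?thesis .
  qed
  have \<Phi>': "\<Phi>' (?T u) = \<Phi> u" for u
    unfolding \<Phi>'_def y by simp
  note T = scales_pairs_ends[OF zw]
  have "sqnorm plane_pairs \<Phi>' = ennreal ((norm (z - w))\<^sup>2) * sqnorm plane_pairs \<Phi>"
    using scales_pairs_nn_integral[OF T, of "\<lambda>u. ennreal ((norm (\<Phi>' u))\<^sup>2)"] by (simp add: sqnorm_def \<Phi>')
  then have "sqnorm plane_pairs \<Phi>' < \<infinity>"
    using fin by (simp add: ennreal_mult_less_top)
  from tensor_weakly_null[OF r s C null _ this]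
  have "(\<lambda>n. \<integral>u. r n (fst u) * s n (snd u) * \<Phi>' u \<partial>plane_pairs) \<longlonglongrightarrow> 0"
    by simp
  moreover have "(\<integral>u. r n (fst u) * s n (snd u) * \<Phi>' u \<partial>plane_pairs) =
      complex_of_real ((norm (z - w))\<^sup>2) *
        (\<integral>u. r n (fst u + z \<odot> snd u) * s n (fst u + w \<odot> snd u) * \<Phi> u \<partial>plane_pairs)" for n
    using scales_pairs_integral[OF T, of "\<lambda>u. r n (fst u) * s n (snd u) * \<Phi>' u"] by (simp add: \<Phi>')
  moreover have "complex_of_real ((norm (z - w))\<^sup>2) \<noteq> 0"
    using zw by simp
  ultimately show ?thesis
    by (simp add: tendsto_mult_left_iff[where l = 0, simplified] del: of_real_power)
qed

section \<open>The trilinear operator in terms of the diagonals of rectangles\<close>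

text \<open>
  The rectangle with corners \<open>\<xi>\<close>, \<open>\<xi> + x\<close>, \<open>\<xi> + x + l perp x\<close>, \<open>\<xi> + l perp x\<close>, that is with sides
  \<open>x\<close> and \<open>\<i> l x\<close>, has the half-diagonals \<open>(1 + \<i> l) x / 2\<close> and \<open>(1 - \<i> l) x / 2\<close>. Their quotient
  has modulus 1, and it determines \<open>l\<close>.
\<close>
definition rectangle_rotation :: "real \<Rightarrow> complex" where
  "rectangle_rotation l = (1 + \<i> * of_real l) / (1 - \<i> * of_real l)"

lemma one_minus_i_real_nz: "1 - \<i> * complex_of_real l \<noteq> 0"
  by (simp add: complex_eq_iff)

lemma norm_rectangle_rotation: "norm (rectangle_rotation l) = 1"
proof -
  have "norm (1 + \<i> * complex_of_real l) = norm (1 - \<i> * complex_of_real l)"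
    by (simp add: cmod_def)
  then show ?thesis
    using one_minus_i_real_nz[of l] by (simp add: rectangle_rotation_def norm_divide)
qed

lemma rectangle_rotation_inj: "rectangle_rotation l = rectangle_rotation l' \<longleftrightarrow> l = l'"
proof
  assume "rectangle_rotation l = rectangle_rotation l'"
  then have "(1 + \<i> * of_real l) * (1 - \<i> * of_real l') = (1 + \<i> * of_real l') * (1 - \<i> * of_real l)"
    using one_minus_i_real_nz[of l] one_minus_i_real_nz[of l']
    by (simp add: rectangle_rotation_def frac_eq_eq)
  then show "l = l'"
    by (simp add: complex_eq_iff)
qed simp

lemma rectangle_rotation_measurable [measurable]: "rectangle_rotation \<in> borel_measurable borel"
  unfolding rectangle_rotation_def
  by (intro borel_measurable_continuous_onI continuous_intros) (simp add: one_minus_i_real_nz)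

text \<open>
  The factor \<open>4 / (1 + l\<^sup>2)\<close> is the Jacobian of \<open>x \<mapsto> (1 - \<i> l) x / 2\<close>, inverted.
\<close>
definition rotation_weight :: "real \<Rightarrow> real" where
  "rotation_weight l = indicator {-1..1} l * (4 / (1 + l\<^sup>2))"

lemma rotation_weight_measurable [measurable]: "rotation_weight \<in> borel_measurable borel"
  unfolding rotation_weight_def by measurable

lemma rotation_weight_bounds: "0 \<le> rotation_weight l" "rotation_weight l \<le> 4 * indicator {-1..1} l"
proof -
  have "4 / (1 + l\<^sup>2) \<le> 4"
    by (simp add: divide_le_eq add_pos_nonneg)
  then show "rotation_weight l \<le> 4 * indicator {-1..1} l"
    by (auto simp: rotation_weight_def indicator_def)
  show "0 \<le> rotation_weight l"
    by (auto simp: rotation_weight_def)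
qed

text \<open>
  The contribution of the angle parameter \<open>l\<close> and of the diagonal from \<open>g\<close> to \<open>k\<close>; integrating it over \<open>l\<close>
  leaves a function of the other diagonal alone.
\<close>
definition diagonal_density ::
  "(real^2 \<Rightarrow> complex) \<Rightarrow> (real^2 \<Rightarrow> complex) \<Rightarrow> real \<Rightarrow> (real^2) \<times> (real^2) \<Rightarrow> complex" where
  "diagonal_density g k l u = of_real (rotation_weight l) *
     (cnj (g (fst u + rectangle_rotation l \<odot> snd u)) * cnj (k (fst u - rectangle_rotation l \<odot> snd u)))"

definition diagonal_kernel ::
  "(real^2 \<Rightarrow> complex) \<Rightarrow> (real^2 \<Rightarrow> complex) \<Rightarrow> (real^2) \<times> (real^2) \<Rightarrow> complex" where
  "diagonal_kernel g k u = (\<integral>l. diagonal_density g k l u \<partial>lborel)"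

lemma diagonal_density_measurable [measurable (raw)]:
  assumes [measurable]: "g \<in> borel_measurable borel" "k \<in> borel_measurable borel"
    "L \<in> borel_measurable M" "(\<lambda>x. fst (U x)) \<in> borel_measurable M" "(\<lambda>x. snd (U x)) \<in> borel_measurable M"
  shows "(\<lambda>x. diagonal_density g k (L x) (U x)) \<in> borel_measurable M"
  unfolding diagonal_density_def by measurable

lemma diagonal_kernel_measurable [measurable]:
  assumes [measurable]: "g \<in> borel_measurable borel" "k \<in> borel_measurable borel"
  shows "diagonal_kernel g k \<in> borel_measurable plane_pairs"
  unfolding diagonal_kernel_def by measurable

text \<open>
  The constant \<open>4\<close> is the squared modulus of \<open>z - (- z)\<close>.
\<close>
lemma sqnorm_opposite:
  assumes "a \<in> borel_measurable borel" "b \<in> borel_measurable borel" "norm z = 1"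
  shows "4 * sqnorm plane_pairs (\<lambda>u. a (fst u + z \<odot> snd u) * b (fst u - z \<odot> snd u)) =
    sqnorm lborel a * sqnorm lborel b"
proof -
  have "z \<noteq> - z"
  proof
    assume "z = - z"
    then have "2 * z = 0" by (metis add.right_inverse mult_2)
    then show False using assms(3) by auto
  qed
  moreover have "(norm (z - - z))\<^sup>2 = 4"
    using assms(3) by (simp add: norm_mult flip: mult_2)
  ultimately show ?thesis
    using sqnorm_ends[OF assms(1,2), of z "- z"] by (simp add: complex_act_minus_left)
qed

lemma ennreal_le_of_4_mult: "4 * N = (c :: ennreal) \<Longrightarrow> N \<le> c"
proof -
  assume "4 * N = c"
  moreover have "1 * N \<le> 4 * N"
    by (intro mult_right_mono) auto
  ultimately show "N \<le> c" by simp
qed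

lemma sqnorm_scale: 
  assumes "f \<in> borel_measurable M"
  shows "sqnorm M (\<lambda>x. c * f x) = ennreal ((norm c)\<^sup>2) * sqnorm M f"
  unfolding sqnorm_def norm_mult power_mult_distrib using assms
  by (simp add: ennreal_mult nn_integral_cmult)

lemma sqnorm_diagonal_density:
  assumes [measurable]: "g \<in> borel_measurable borel" "k \<in> borel_measurable borel"
  shows "sqnorm plane_pairs (diagonal_density g k l) \<le>
    indicator {-1..1} l * (4 * (sqnorm lborel g * sqnorm lborel k))"
proof -
  let ?F = "\<lambda>u. cnj (g (fst u + rectangle_rotation l \<odot> snd u)) * cnj (k (fst u - rectangle_rotation l \<odot> snd u))"
  have F: "4 * sqnorm plane_pairs ?F = sqnorm lborel g * sqnorm lborel k"
    using sqnorm_opposite[of "\<lambda>x. cnj (g x)" "\<lambda>x. cnj (k x)" "rectangle_rotation l"] norm_rectangle_rotation by simp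
  have "(rotation_weight l)\<^sup>2 \<le> (4 * indicator {-1..1} l)\<^sup>2"
    using rotation_weight_bounds by (intro power_mono) auto
  then have "ennreal ((rotation_weight l)\<^sup>2) \<le> indicator {-1..1} l * 16"
    by (auto simp: indicator_def split: if_splits intro: ennreal_leI[of _ 16, simplified])
  then have "ennreal ((rotation_weight l)\<^sup>2) * sqnorm plane_pairs ?F \<le> indicator {-1..1} l * 16 * sqnorm plane_pairs ?F"
    by (rule mult_right_mono) simp
  also have "\<dots> = indicator {-1..1} l * (4 * (4 * sqnorm plane_pairs ?F))"
    by (simp add: mult.assoc[symmetric])
  finally show ?thesis
    unfolding F diagonal_density_def by (subst sqnorm_scale) (simp_all add: F)
qed

lemma nn_integral_indicator_unit_cmult: "(\<integral>\<^sup>+l. indicator {-1..1::real} l * c \<partial>lborel) = 2 * (c::ennreal)"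
  by (simp add: nn_integral_multc)

interpretation line_plane_pairs: pair_sigma_finite "lborel :: real measure" plane_pairs
  by (simp add: pair_sigma_finite.intro lborel.sigma_finite_measure_axioms lborel_pair.sigma_finite_measure_axioms)

text \<open>
  Cauchy--Schwarz in the angle parameter, over an interval of length 2, followed by the bound for each
  parameter.
\<close>
lemma sqnorm_diagonal_kernel:
  assumes [measurable]: "g \<in> borel_measurable borel" "k \<in> borel_measurable borel"
  shows "sqnorm plane_pairs (diagonal_kernel g k) \<le> 16 * (sqnorm lborel g * sqnorm lborel k)"
proof -
  have "ennreal ((norm (diagonal_kernel g k u))\<^sup>2) \<le> 2 * (\<integral>\<^sup>+l. ennreal ((norm (diagonal_density g k l u))\<^sup>2) \<partial>lborel)" 
    (is "_ \<le> 2 * ?S u") for u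
  proof -
    have "diagonal_kernel g k u = (\<integral>l. indicator {-1..1} l * diagonal_density g k l u \<partial>lborel)"
      unfolding diagonal_kernel_def diagonal_density_def rotation_weight_def
      by (intro Bochner_Integration.integral_cong) (auto simp: indicator_def)
    also have "ennreal ((norm \<dots>)\<^sup>2) \<le> sqnorm lborel (indicator {-1..1::real}) * ?S u"
      unfolding sqnorm_def[symmetric, of lborel "\<lambda>l. diagonal_density g k l u"]
      by (rule integral_mult_le_sqnorm) measurable
    also have "sqnorm lborel (indicator {-1..1::real}) = 2"
    proof -
      have "ennreal ((norm (indicator {-1..1} l :: complex))\<^sup>2) = indicator {-1..1} l * 1" for l :: real
        by (simp add: indicator_def)
      then show ?thesis
        unfolding sqnorm_def using nn_integral_indicator_unit_cmult[of 1] by simp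
    qed
    finally show ?thesis .
  qed
  then have "sqnorm plane_pairs (diagonal_kernel g k) \<le> (\<integral>\<^sup>+u. 2 * ?S u \<partial>plane_pairs)"
    unfolding sqnorm_def[of plane_pairs "diagonal_kernel g k"] by (intro nn_integral_mono)
  also have "\<dots> = 2 * (\<integral>\<^sup>+u. ?S u \<partial>plane_pairs)"
    by (rule nn_integral_cmult) measurable
  also have "(\<integral>\<^sup>+u. ?S u \<partial>plane_pairs) = (\<integral>\<^sup>+l. sqnorm plane_pairs (diagonal_density g k l) \<partial>lborel)"
    unfolding sqnorm_def by (rule line_plane_pairs.Fubini') measurable
  also have "\<dots> \<le> (\<integral>\<^sup>+l. indicator {-1..1::real} l * (4 * (sqnorm lborel g * sqnorm lborel k)) \<partial>lborel)"
    by (intro nn_integral_mono sqnorm_diagonal_density) measurable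
  also have "\<dots> = 2 * (4 * (sqnorm lborel g * sqnorm lborel k))"
    by (rule nn_integral_indicator_unit_cmult)
  also have "2 * \<dots> = 16 * (sqnorm lborel g * sqnorm lborel k)"
    by (simp add: mult.assoc[symmetric])
  finally show ?thesis
    by (simp add: mult_left_mono)
qed

text \<open>
  Before the integration over \<open>l\<close> the integrand is additive in each function pointwise, and it is
  absolutely integrable. Additivity of the integral therefore needs no discussion of
  exceptional null sets.
\<close>
definition rectangle_integrand ::
  "(real^2 \<Rightarrow> complex) \<Rightarrow> (real^2 \<Rightarrow> complex) \<Rightarrow> (real^2 \<Rightarrow> complex) \<Rightarrow> (real^2 \<Rightarrow> complex) \<Rightarrow>
    real \<times> (real^2) \<times> (real^2) \<Rightarrow> complex" where
  "rectangle_integrand f g h k = (\<lambda>(l, u). f (fst u + snd u) * h (fst u - snd u) * diagonal_density g k l u)"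

lemma rectangle_integrand_measurable [measurable]:
  assumes [measurable]: "f \<in> borel_measurable borel" "g \<in> borel_measurable borel"
    "h \<in> borel_measurable borel" "k \<in> borel_measurable borel"
  shows "rectangle_integrand f g h k \<in> borel_measurable (lborel \<Otimes>\<^sub>M plane_pairs)"
  unfolding rectangle_integrand_def by measurable

lemma nn_integral_mult_le_sum_sqnorm:
  assumes [measurable]: "a \<in> borel_measurable M" "b \<in> borel_measurable M"
  shows "(\<integral>\<^sup>+x. ennreal (norm (a x * b x)) \<partial>M) \<le> sqnorm M a + sqnorm M b"
proof -
  have "(\<integral>\<^sup>+x. ennreal (norm (a x * b x)) \<partial>M) \<le>
      (\<integral>\<^sup>+x. ennreal ((norm (a x))\<^sup>2) + ennreal ((norm (b x))\<^sup>2) \<partial>M)"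
  proof (rule nn_integral_mono)
    fix x
    have "norm (a x * b x) \<le> (norm (a x))\<^sup>2 + (norm (b x))\<^sup>2"
      using sum_squares_bound[of "norm (a x)" "norm (b x)"] mult_nonneg_nonneg[OF norm_ge_zero norm_ge_zero, of "a x" "b x"]
      unfolding norm_mult by linarith
    then show "ennreal (norm (a x * b x)) \<le> ennreal ((norm (a x))\<^sup>2) + ennreal ((norm (b x))\<^sup>2)"
      by (simp flip: ennreal_plus)
  qed
  also have "\<dots> = sqnorm M a + sqnorm M b"
    unfolding sqnorm_def by (rule nn_integral_add) measurable
  finally show ?thesis .
qed

lemma sqnorm_fixed_diagonal:
  assumes "f \<in> borel_measurable borel" "h \<in> borel_measurable borel"
  shows "4 * sqnorm plane_pairs (\<lambda>u. f (fst u + snd u) * h (fst u - snd u)) = sqnorm lborel f * sqnorm lborel h"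
  using sqnorm_opposite[OF assms, of 1] by (simp add: complex_act_one)

text \<open>
  A bound uniform in \<open>l\<close>, for the applications of Fubini's theorem. It comes from \<open>|a b| \<le> |a|\<^sup>2 + |b|\<^sup>2\<close>, applied to the products along the two
  diagonals.
\<close>
lemma nn_integral_rectangle_integrand:
  assumes sq: "square_integrable f" "square_integrable g" "square_integrable h" "square_integrable k"
  obtains C where "C < \<infinity>"
    "\<And>l. (\<integral>\<^sup>+u. ennreal (norm (rectangle_integrand f g h k (l, u))) \<partial>plane_pairs) \<le> indicator {-1..1} l * C"
proof -
  have [measurable]: "f \<in> borel_measurable borel" "g \<in> borel_measurable borel"
    "h \<in> borel_measurable borel" "k \<in> borel_measurable borel"
    using sq by (auto simp: square_integrable_def)
  define C where "C = sqnorm lborel f * sqnorm lborel h + 4 * (sqnorm lborel g * sqnorm lborel k)"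
  have "C < \<infinity>"
    using sq by (simp add: C_def square_integrable_iff_sqnorm ennreal_mult_less_top)
  moreover have "(\<integral>\<^sup>+u. ennreal (norm (rectangle_integrand f g h k (l, u))) \<partial>plane_pairs) \<le> indicator {-1..1} l * C" for l
  proof (cases "l \<in> {-1..1}")
    case True
    have "(\<integral>\<^sup>+u. ennreal (norm (rectangle_integrand f g h k (l, u))) \<partial>plane_pairs) \<le>
        sqnorm plane_pairs (\<lambda>u. f (fst u + snd u) * h (fst u - snd u)) + sqnorm plane_pairs (diagonal_density g k l)"
      unfolding rectangle_integrand_def prod.case by (rule nn_integral_mult_le_sum_sqnorm) measurable
    also have "\<dots> \<le> C"
      unfolding C_def
      using sqnorm_diagonal_density[of g k l] True
      by (intro add_mono ennreal_le_of_4_mult[OF sqnorm_fixed_diagonal]) auto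
    finally show ?thesis using True by simp
  next
    case False
    then show ?thesis
      by (simp add: rectangle_integrand_def diagonal_density_def rotation_weight_def)
  qed
  ultimately show ?thesis by (rule that)
qed

lemma rectangle_integrand_integrable:
  assumes sq: "square_integrable f" "square_integrable g" "square_integrable h" "square_integrable k"
  shows "integrable (lborel \<Otimes>\<^sub>M plane_pairs) (rectangle_integrand f g h k)"
proof (rule integrableI_bounded)
  have [measurable]: "f \<in> borel_measurable borel" "g \<in> borel_measurable borel"
    "h \<in> borel_measurable borel" "k \<in> borel_measurable borel"
    using sq by (auto simp: square_integrable_def)
  show "rectangle_integrand f g h k \<in> borel_measurable (lborel \<Otimes>\<^sub>M plane_pairs)"
    by measurable
  obtain C where C: "C < \<infinity>"
    "\<And>l. (\<integral>\<^sup>+u. ennreal (norm (rectangle_integrand f g h k (l, u))) \<partial>plane_pairs) \<le> indicator {-1..1} l * C"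
    using nn_integral_rectangle_integrand[OF sq] by blast
  have "(\<integral>\<^sup>+x. ennreal (norm (rectangle_integrand f g h k x)) \<partial>(lborel \<Otimes>\<^sub>M plane_pairs)) =
      (\<integral>\<^sup>+l. \<integral>\<^sup>+u. ennreal (norm (rectangle_integrand f g h k (l, u))) \<partial>plane_pairs \<partial>lborel)"
    by (rule lborel_pair.nn_integral_fst[symmetric]) measurable
  also have "\<dots> \<le> (\<integral>\<^sup>+l. indicator {-1..1::real} l * C \<partial>lborel)"
    by (intro nn_integral_mono C(2))
  also have "\<dots> < \<infinity>"
    using C(1) by (simp only: nn_integral_indicator_unit_cmult) (simp add: ennreal_mult_less_top)
  finally show "(\<integral>\<^sup>+x. ennreal (norm (rectangle_integrand f g h k x)) \<partial>(lborel \<Otimes>\<^sub>M plane_pairs)) < \<infinity>" .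
qed

lemma rectangle_corners:
  fixes \<xi> x :: "real^2" and l :: real
  defines "m \<equiv> \<xi> + ((1 + \<i> * of_real l) / 2) \<odot> x" and "v \<equiv> ((1 - \<i> * of_real l) / 2) \<odot> x"
  shows "m + v = \<xi> + x" "m - v = \<xi> + l *\<^sub>R perp x"
    "m + rectangle_rotation l \<odot> v = \<xi> + x + l *\<^sub>R perp x" "m - rectangle_rotation l \<odot> v = \<xi>"
proof -
  have "rectangle_rotation l \<odot> v = (rectangle_rotation l * ((1 - \<i> * of_real l) / 2)) \<odot> x"
    by (simp only: v_def complex_act_mult)
  also have "rectangle_rotation l * ((1 - \<i> * of_real l) / 2) = (1 + \<i> * of_real l) / 2"
    using one_minus_i_real_nz[of l] by (simp add: rectangle_rotation_def)
  finally have rot: "rectangle_rotation l \<odot> v = ((1 + \<i> * of_real l) / 2) \<odot> x" .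
  show "m - rectangle_rotation l \<odot> v = \<xi>"
    unfolding rot unfolding m_def by simp
  show "m + rectangle_rotation l \<odot> v = \<xi> + x + l *\<^sub>R perp x"
    unfolding rot unfolding m_def complex_act_def by (simp add: vec_eq_iff field_simps)
  show "m + v = \<xi> + x" "m - v = \<xi> + l *\<^sub>R perp x"
    unfolding m_def v_def complex_act_def by (simp_all add: vec_eq_iff field_simps)
qed

text \<open>
  For each fixed \<open>l\<close> the change of variables \<open>T l\<close> from a corner and a side to the centre and
  a half-diagonal is linear. It is applied between two uses of Fubini's theorem: the definition of
  the operator integrates over \<open>l\<close> before \<open>\<xi>\<close>, and this order is exchanged first.
\<close>
lemma CR_integral_pairing:
  assumes sq: "square_integrable f" "square_integrable g" "square_integrable h" "square_integrable k"
  shows "(\<integral>\<xi>. CR_integral f g h \<xi> * cnj (k \<xi>) \<partial>lborel) =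
    (\<integral>x. rectangle_integrand f g h k x \<partial>(lborel \<Otimes>\<^sub>M plane_pairs))"
proof -
  have [measurable]: "f \<in> borel_measurable borel" "g \<in> borel_measurable borel"
    "h \<in> borel_measurable borel" "k \<in> borel_measurable borel"
    using sq by (auto simp: square_integrable_def)
  define H where "H l u = indicator {-1..1} l * (f (fst u + snd u) * cnj (g (fst u + snd u + l *\<^sub>R perp (snd u))) *
    h (fst u + l *\<^sub>R perp (snd u))) * cnj (k (fst u))" for l :: real and u :: "(real^2) \<times> (real^2)"
  define T where "T l u = (fst u + ((1 + \<i> * of_real l) / 2) \<odot> snd u, ((1 - \<i> * of_real l) / 2) \<odot> snd u)"
    for l :: real and u :: "(real^2) \<times> (real^2)"
  have H_measurable [measurable (raw)]: "(\<lambda>x. H (L x) (U x)) \<in> borel_measurable M"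
    if [measurable]: "L \<in> borel_measurable M" "(\<lambda>x. fst (U x)) \<in> borel_measurable M" "(\<lambda>x. snd (U x)) \<in> borel_measurable M" for L U and M :: "'x measure"
    unfolding H_def by measurable
  have norm_half: "(norm ((1 - \<i> * of_real l) / 2))\<^sup>2 = (1 + l\<^sup>2) / 4" for l :: real
    by (simp add: norm_divide power_divide cmod_power2)
  have scales: "scales_pairs ((1 + l\<^sup>2) / 4) (T l)" for l
    using scales_pairs_shear[of "(1 - \<i> * of_real l) / 2" "(1 + \<i> * of_real l) / 2"] one_minus_i_real_nz[of l]
    unfolding norm_half T_def by simp
  have T: "rectangle_integrand f g h k (l, T l u) = of_real (4 / (1 + l\<^sup>2)) * H l u" for l u
    unfolding rectangle_integrand_def diagonal_density_def prod.case T_def fst_conv snd_conv rectangle_corners H_def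
      rotation_weight_def
    by (simp add: indicator_def)
  have pos: "1 + l\<^sup>2 > 0" for l :: real
    by (simp add: add_pos_nonneg)
  have inv: "(1 + l\<^sup>2) / 4 * (4 / (1 + l\<^sup>2)) = 1" for l :: real
    using pos[of l] by simp
  have norm_T: "norm (rectangle_integrand f g h k (l, T l u)) = 4 / (1 + l\<^sup>2) * norm (H l u)" for l u
    unfolding T norm_mult norm_of_real using pos[of l] by simp
  have nn: "(\<integral>\<^sup>+u. ennreal (norm (H l u)) \<partial>plane_pairs) =
      (\<integral>\<^sup>+u. ennreal (norm (rectangle_integrand f g h k (l, u))) \<partial>plane_pairs)" for l
  proof -
    have "(\<integral>\<^sup>+u. ennreal (norm (rectangle_integrand f g h k (l, u))) \<partial>plane_pairs) =
        ennreal ((1 + l\<^sup>2) / 4) * (\<integral>\<^sup>+u. ennreal (norm (rectangle_integrand f g h k (l, T l u))) \<partial>plane_pairs)"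
      by (rule scales_pairs_nn_integral[OF scales, symmetric]) measurable
    also have "(\<integral>\<^sup>+u. ennreal (norm (rectangle_integrand f g h k (l, T l u))) \<partial>plane_pairs) =
        ennreal (4 / (1 + l\<^sup>2)) * (\<integral>\<^sup>+u. ennreal (norm (H l u)) \<partial>plane_pairs)"
      unfolding norm_T using pos[of l] by (subst nn_integral_cmult[symmetric]) (measurable, simp flip: ennreal_mult)
    also have "ennreal ((1 + l\<^sup>2) / 4) * \<dots> =
        ennreal ((1 + l\<^sup>2) / 4 * (4 / (1 + l\<^sup>2))) * (\<integral>\<^sup>+u. ennreal (norm (H l u)) \<partial>plane_pairs)"
      using pos[of l] by (subst ennreal_mult) (auto simp: mult.assoc)
    finally show ?thesis
      unfolding inv by simp
  qed
  have int: "(\<integral>u. H l u \<partial>plane_pairs) = (\<integral>u. rectangle_integrand f g h k (l, u) \<partial>plane_pairs)" for l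
  proof -
    have "(\<integral>u. rectangle_integrand f g h k (l, u) \<partial>plane_pairs) =
        of_real ((1 + l\<^sup>2) / 4) * (\<integral>u. rectangle_integrand f g h k (l, T l u) \<partial>plane_pairs)"
      by (rule scales_pairs_integral[OF scales]) measurable
    also have "\<dots> = of_real ((1 + l\<^sup>2) / 4 * (4 / (1 + l\<^sup>2))) * (\<integral>u. H l u \<partial>plane_pairs)"
      unfolding T integral_mult_right_zero of_real_mult by (simp only: mult.assoc)
    finally show ?thesis
      unfolding inv by simp
  qed
  obtain C where C: "C < \<infinity>"
    "\<And>l. (\<integral>\<^sup>+u. ennreal (norm (rectangle_integrand f g h k (l, u))) \<partial>plane_pairs) \<le> indicator {-1..1} l * C"
    using nn_integral_rectangle_integrand[OF sq] by blast
  have H_int: "integrable plane_pairs (H l)" for l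
  proof (rule integrableI_bounded)
    have "(\<integral>\<^sup>+u. ennreal (norm (H l u)) \<partial>plane_pairs) \<le> indicator {-1..1} l * C"
      unfolding nn by (rule C(2))
    also have "\<dots> < \<infinity>"
      using C(1) by (simp add: indicator_def)
    finally show "(\<integral>\<^sup>+u. ennreal (norm (H l u)) \<partial>plane_pairs) < \<infinity>" .
  qed measurable
  define J where "J l \<xi> = (\<integral>x. H l (\<xi>, x) \<partial>lborel)" for l \<xi>
  have J_measurable [measurable]: "(\<lambda>(l, \<xi>). J l \<xi>) \<in> borel_measurable (lborel \<Otimes>\<^sub>M lborel)"
    unfolding J_def by measurable
  have J_int: "integrable (lborel \<Otimes>\<^sub>M lborel) (\<lambda>(l, \<xi>). J l \<xi>)"
  proof (rule integrableI_bounded)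
    have "(\<integral>\<^sup>+y. ennreal (norm (case y of (l, \<xi>) \<Rightarrow> J l \<xi>)) \<partial>(lborel \<Otimes>\<^sub>M lborel)) =
        (\<integral>\<^sup>+l. \<integral>\<^sup>+\<xi>. ennreal (norm (J l \<xi>)) \<partial>lborel \<partial>lborel)"
      by (subst lborel.nn_integral_fst[symmetric]) auto
    also have "\<dots> \<le> (\<integral>\<^sup>+l. \<integral>\<^sup>+\<xi>. \<integral>\<^sup>+x. ennreal (norm (H l (\<xi>, x))) \<partial>lborel \<partial>lborel \<partial>lborel)"
      unfolding J_def by (intro nn_integral_mono norm_integral_le_nn_integral)
    also have "\<dots> = (\<integral>\<^sup>+l. \<integral>\<^sup>+u. ennreal (norm (H l u)) \<partial>plane_pairs \<partial>lborel)"
      by (intro nn_integral_cong lborel.nn_integral_fst) measurable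
    also have "\<dots> \<le> (\<integral>\<^sup>+l. indicator {-1..1::real} l * C \<partial>lborel)"
      unfolding nn by (intro nn_integral_mono C(2))
    also have "\<dots> < \<infinity>"
      using C(1) by (simp only: nn_integral_indicator_unit_cmult) (simp add: ennreal_mult_less_top)
    finally show "(\<integral>\<^sup>+y. ennreal (norm (case y of (l, \<xi>) \<Rightarrow> J l \<xi>)) \<partial>(lborel \<Otimes>\<^sub>M lborel)) < \<infinity>" .
  qed (rule J_measurable)
  have ind: "complex_of_real (indicat_real {-1..1} l) = indicator {-1..1} l" for l :: real
    by (simp add: indicator_def)
  have "CR_integral f g h \<xi> * cnj (k \<xi>) = (\<integral>l. J l \<xi> \<partial>lborel)" for \<xi>
    unfolding CR_integral_def set_lebesgue_integral_def J_def H_def fst_conv snd_conv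
    by (simp only: integral_mult_left_zero integral_mult_right_zero scaleR_conv_of_real ind)
  then have "(\<integral>\<xi>. CR_integral f g h \<xi> * cnj (k \<xi>) \<partial>lborel) = (\<integral>\<xi>. \<integral>l. J l \<xi> \<partial>lborel \<partial>lborel)"
    by simp
  also have "\<dots> = (\<integral>l. \<integral>\<xi>. J l \<xi> \<partial>lborel \<partial>lborel)"
    by (rule lborel_pair.Fubini_integral[OF J_int])
  also have "\<dots> = (\<integral>l. \<integral>u. H l u \<partial>plane_pairs \<partial>lborel)"
    unfolding J_def by (simp only: lborel_pair.integral_fst'[OF H_int])
  also have "\<dots> = (\<integral>x. rectangle_integrand f g h k x \<partial>(lborel \<Otimes>\<^sub>M plane_pairs))"
    unfolding int by (rule line_plane_pairs.integral_fst'[OF rectangle_integrand_integrable[OF sq]])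
  finally show ?thesis .
qed

lemma rectangle_integral_kernel:
  assumes sq: "square_integrable f" "square_integrable g" "square_integrable h" "square_integrable k"
  shows "(\<integral>x. rectangle_integrand f g h k x \<partial>(lborel \<Otimes>\<^sub>M plane_pairs)) =
    (\<integral>u. f (fst u + snd u) * h (fst u - snd u) * diagonal_kernel g k u \<partial>plane_pairs)"
proof -
  have "(\<integral>x. rectangle_integrand f g h k x \<partial>(lborel \<Otimes>\<^sub>M plane_pairs)) =
      (\<integral>u. \<integral>l. rectangle_integrand f g h k (l, u) \<partial>lborel \<partial>plane_pairs)"
    using line_plane_pairs.integral_snd[of "\<lambda>l u. rectangle_integrand f g h k (l, u)"]
      rectangle_integrand_integrable[OF sq] by simp
  then show ?thesis
    by (simp add: rectangle_integrand_def diagonal_kernel_def)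
qed

section \<open>A weakly null entry makes the diagonal kernel small\<close>

interpretation line_pairs_plane_pairs: pair_sigma_finite "lborel \<Otimes>\<^sub>M lborel :: (real \<times> real) measure" plane_pairs
  by (simp add: pair_sigma_finite.intro lborel_pair.sigma_finite_measure_axioms)

text \<open>
  The squared norm of the kernel is the integral over \<open>q = (l, l')\<close> of \<open>\<beta> n q\<close>, in which
  \<open>r n\<close> occurs at the two points \<open>m + S v\<close> and \<open>m + S' v\<close>. Off the diagonal \<open>l = l'\<close>, a null set,
  these are independent coordinates, and the remaining factor, formed from \<open>k\<close> at \<open>m - S v\<close> and
  \<open>m - S' v\<close>, is square integrable for the same reason. A bound on \<open>\<beta> n q\<close> that is uniform in \<open>n\<close> and
  \<open>q\<close> permits dominated convergence.
\<close>
lemma diagonal_kernel_weakly_null: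
  assumes r: "\<And>n. r n \<in> borel_measurable borel" "\<And>n. sqnorm lborel (r n) \<le> C" and C: "C < \<infinity>"
    and null: "weakly_null r" and k: "square_integrable k"
  shows "(\<lambda>n. sqnorm plane_pairs (diagonal_kernel (r n) k)) \<longlonglongrightarrow> 0"
proof -
  let ?LL = "lborel \<Otimes>\<^sub>M lborel :: (real \<times> real) measure"
  have k_measurable [measurable]: "k \<in> borel_measurable borel" and k_fin: "sqnorm lborel k < \<infinity>"
    using k by (auto simp: square_integrable_iff_sqnorm)
  note [measurable] = r(1)
  define B where "B n q u = diagonal_density (r n) k (fst q) u * cnj (diagonal_density (r n) k (snd q) u)" for n q u
  have B_measurable [measurable (raw)]: "(\<lambda>x. B n (Q x) (U x)) \<in> borel_measurable M"
    if [measurable]: "(\<lambda>x. fst (Q x)) \<in> borel_measurable M" "(\<lambda>x. snd (Q x)) \<in> borel_measurable M" "(\<lambda>x. fst (U x)) \<in> borel_measurable M" "(\<lambda>x. snd (U x)) \<in> borel_measurable M"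
    for n Q U and M :: "'x measure"
    unfolding B_def by measurable
  define \<beta> where "\<beta> n q = (\<integral>u. B n q u \<partial>plane_pairs)" for n q
  have [measurable]: "\<beta> n \<in> borel_measurable ?LL" for n
    unfolding \<beta>_def by measurable
  define S where "S = {-1..1::real} \<times> {-1..1::real}"
  define D where "D = 8 * (C * sqnorm lborel k)"
  have D: "D < \<infinity>"
    using C k_fin by (simp add: D_def ennreal_mult_less_top)
  have S_measurable [measurable]: "S \<in> sets ?LL"
    unfolding S_def by measurable
  have S_int: "(\<integral>\<^sup>+q. D * indicator S q \<partial>?LL) < \<infinity>"
  proof -
    have "emeasure ?LL S = emeasure lborel {-1..1::real} * emeasure lborel {-1..1::real}"
      unfolding S_def by (rule lborel.emeasure_pair_measure_Times) auto
    then show ?thesis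
      using D unfolding nn_integral_cmult_indicator[OF S_measurable] by (simp add: ennreal_mult_less_top)
  qed
  have dens: "sqnorm plane_pairs (diagonal_density (r n) k l) \<le> 4 * (C * sqnorm lborel k)" for n l
  proof -
    have "sqnorm plane_pairs (diagonal_density (r n) k l) \<le>
        indicator {-1..1} l * (4 * (sqnorm lborel (r n) * sqnorm lborel k))"
      by (rule sqnorm_diagonal_density) measurable
    also have "\<dots> \<le> 1 * (4 * (C * sqnorm lborel k))"
      using r(2)[of n] by (intro mult_mono) (auto simp: indicator_def)
    finally show ?thesis by simp
  qed
  have nn_B: "(\<integral>\<^sup>+u. ennreal (norm (B n q u)) \<partial>plane_pairs) \<le> D * indicator S q" for n q
  proof (cases "q \<in> S")
    case True
    have "(\<integral>\<^sup>+u. ennreal (norm (B n q u)) \<partial>plane_pairs) \<le>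
        sqnorm plane_pairs (diagonal_density (r n) k (fst q)) + sqnorm plane_pairs (\<lambda>u. cnj (diagonal_density (r n) k (snd q) u))"
      unfolding B_def by (rule nn_integral_mult_le_sum_sqnorm) measurable
    also have "\<dots> \<le> 4 * (C * sqnorm lborel k) + 4 * (C * sqnorm lborel k)"
      unfolding sqnorm_cnj by (intro add_mono dens)
    also have "\<dots> = D"
      unfolding D_def by (simp flip: distrib_right)
    finally show ?thesis using True by simp
  next
    case False
    then have "B n q u = 0" for u
      by (cases q) (auto simp: S_def B_def diagonal_density_def rotation_weight_def indicator_def)
    then show ?thesis by simp
  qed
  have B_int: "integrable (?LL \<Otimes>\<^sub>M plane_pairs) (\<lambda>(q, u). B n q u)" for n
  proof (rule integrableI_bounded)
    have "(\<integral>\<^sup>+x. ennreal (norm (case x of (q, u) \<Rightarrow> B n q u)) \<partial>(?LL \<Otimes>\<^sub>M plane_pairs)) =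
        (\<integral>\<^sup>+q. \<integral>\<^sup>+u. ennreal (norm (B n q u)) \<partial>plane_pairs \<partial>?LL)"
      by (subst lborel_pair.nn_integral_fst[symmetric]) auto
    also have "\<dots> \<le> (\<integral>\<^sup>+q. D * indicator S q \<partial>?LL)"
      by (intro nn_integral_mono nn_B)
    finally show "(\<integral>\<^sup>+x. ennreal (norm (case x of (q, u) \<Rightarrow> B n q u)) \<partial>(?LL \<Otimes>\<^sub>M plane_pairs)) < \<infinity>"
      using S_int by (rule le_less_trans)
  qed measurable
  have le: "sqnorm plane_pairs (diagonal_kernel (r n) k) \<le> (\<integral>\<^sup>+q. ennreal (norm (\<beta> n q)) \<partial>?LL)" for n
  proof -
    let ?K = "diagonal_kernel (r n) k"
    have "sqnorm plane_pairs ?K \<le> 16 * (sqnorm lborel (r n) * sqnorm lborel k)"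
      by (rule sqnorm_diagonal_kernel) measurable
    also have "\<dots> < \<infinity>"
      using r(2)[of n] C k_fin by (auto simp: ennreal_mult_less_top intro: le_less_trans)
    finally have K_fin: "sqnorm plane_pairs ?K < \<infinity>" .
    have K_int: "integrable plane_pairs (\<lambda>u. (norm (?K u))\<^sup>2)"
      by (rule integrableI_bounded) (use K_fin in \<open>measurable, simp add: sqnorm_def\<close>)
    have "sqnorm plane_pairs ?K = ennreal (\<integral>u. (norm (?K u))\<^sup>2 \<partial>plane_pairs)"
      unfolding sqnorm_def by (rule nn_integral_eq_integral[OF K_int]) simp
    also have "(\<integral>u. (norm (?K u))\<^sup>2 \<partial>plane_pairs) = norm (complex_of_real (\<integral>u. (norm (?K u))\<^sup>2 \<partial>plane_pairs))"
      by simp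
    also have "complex_of_real (\<integral>u. (norm (?K u))\<^sup>2 \<partial>plane_pairs) = (\<integral>u. ?K u * cnj (?K u) \<partial>plane_pairs)"
      by (simp flip: integral_complex_of_real complex_norm_square)
    also have "\<dots> = (\<integral>u. \<integral>q. B n q u \<partial>?LL \<partial>plane_pairs)"
    proof (rule integral_cong_AE)
      have "AE u in plane_pairs. integrable ?LL (\<lambda>q. B n q u)"
        by (rule line_pairs_plane_pairs.AE_integrable_snd[OF B_int])
      then show "AE u in plane_pairs. ?K u * cnj (?K u) = (\<integral>q. B n q u \<partial>?LL)"
      proof eventually_elim
        fix u assume "integrable ?LL (\<lambda>q. B n q u)"
        from lborel_pair.integral_fst'[OF this]
        show "?K u * cnj (?K u) = (\<integral>q. B n q u \<partial>?LL)"
          by (simp add: B_def diagonal_kernel_def)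
      qed
    qed measurable
    also have "\<dots> = (\<integral>q. \<beta> n q \<partial>?LL)"
      unfolding \<beta>_def by (rule line_pairs_plane_pairs.Fubini_integral[OF B_int])
    finally show ?thesis
      using norm_integral_le_nn_integral[of ?LL "\<beta> n"] by simp
  qed
  have lim: "(\<lambda>n. \<beta> n (l, l')) \<longlonglongrightarrow> 0" if "l' \<noteq> l" for l l'
  proof -
    let ?z = "rectangle_rotation l" and ?w = "rectangle_rotation l'"
    define \<Phi> where "\<Phi> u = of_real (rotation_weight l * rotation_weight l') *
      (cnj (k (fst u + (- ?z) \<odot> snd u)) * k (fst u + (- ?w) \<odot> snd u))" for u
    have zw: "?z \<noteq> ?w"
      using that by (simp add: rectangle_rotation_inj)
    have \<Phi>_measurable: "\<Phi> \<in> borel_measurable plane_pairs"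
      unfolding \<Phi>_def by measurable
    have \<Phi>_fin: "sqnorm plane_pairs \<Phi> < \<infinity>"
    proof -
      have "square_integrable (\<lambda>x. cnj (k x))"
        using k by (simp add: square_integrable_iff_sqnorm)
      from sqnorm_ends_finite[OF this k, of "- ?z" "- ?w"]
      show ?thesis
        unfolding \<Phi>_def using zw by (subst sqnorm_scale) (measurable, simp add: ennreal_mult_less_top)
    qed
    have "(\<lambda>n. \<integral>u. cnj (r n (fst u + ?z \<odot> snd u)) * r n (fst u + ?w \<odot> snd u) * \<Phi> u \<partial>plane_pairs) \<longlonglongrightarrow> 0"
      by (rule ends_weakly_null[of "\<lambda>n x. cnj (r n x)", OF _ _ r C null \<Phi>_measurable \<Phi>_fin zw])
        (auto simp: r)
    also have "(\<lambda>n. \<integral>u. cnj (r n (fst u + ?z \<odot> snd u)) * r n (fst u + ?w \<odot> snd u) * \<Phi> u \<partial>plane_pairs) = (\<lambda>n. \<beta> n (l, l'))"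
      unfolding \<beta>_def
      by (intro ext Bochner_Integration.integral_cong)
        (simp_all add: B_def \<Phi>_def diagonal_density_def complex_act_minus_left)
    finally show ?thesis .
  qed
  have ae: "AE q in ?LL. (\<lambda>n. ennreal (norm (\<beta> n q))) \<longlonglongrightarrow> 0"
  proof -
    have "AE q in ?LL. snd q \<noteq> fst q"
    proof (rule lborel_pair.AE_pair_measure)
      show "{q \<in> space ?LL. snd q \<noteq> fst q} \<in> sets ?LL"
        by measurable
    qed (use AE_lborel_singleton in auto)
    then show ?thesis
    proof eventually_elim
      fix q :: "real \<times> real" assume "snd q \<noteq> fst q"
      then have "(\<lambda>n. norm (\<beta> n q)) \<longlonglongrightarrow> 0"
        using lim[of "snd q" "fst q"] by (simp add: tendsto_norm_zero)
      then show "(\<lambda>n. ennreal (norm (\<beta> n q))) \<longlonglongrightarrow> 0"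
        by (simp flip: ennreal_0)
    qed
  qed
  have "(\<lambda>n. \<integral>\<^sup>+q. ennreal (norm (\<beta> n q)) \<partial>?LL) \<longlonglongrightarrow> (\<integral>\<^sup>+q. 0 \<partial>?LL)"
  proof (rule nn_integral_dominated_convergence[where w = "\<lambda>q. D * indicator S q"])
    show "AE q in ?LL. ennreal (norm (\<beta> n q)) \<le> D * indicator S q" for n
      unfolding \<beta>_def by (intro always_eventually allI order_trans[OF norm_integral_le_nn_integral nn_B])
  qed (use ae S_int in auto)
  then have "(\<lambda>n. \<integral>\<^sup>+q. ennreal (norm (\<beta> n q)) \<partial>?LL) \<longlonglongrightarrow> 0"
    by simp
  then show ?thesis
    by (rule tendsto_sandwich[OF _ _ tendsto_const, rotated 2]) (use le in auto)
qed

section \<open>The trilinear operator on equivalence classes\<close>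

lemma square_integrable_rep_L2: "square_integrable (rep_L2 F)"
  and abs_rep_L2: "abs_L2 (rep_L2 F) = F"
  using Quotient_rep_reflp[OF Quotient_L2, of F] Quotient_abs_rep[OF Quotient_L2, of F]
  by (simp_all add: L2_rel_refl_iff)

lemma sqnorm_rep_L2: "sqnorm lborel (rep_L2 F) = ennreal ((norm F)\<^sup>2)"
  using sqnorm_abs_L2[OF square_integrable_rep_L2] by (simp add: abs_rep_L2)

lemma rep_L2_measurable: "rep_L2 F \<in> borel_measurable borel"
  using square_integrable_rep_L2[of F] by (simp add: square_integrable_def)

text \<open>
  Measurability, continuity and weak convergence of the Hermitian product follow from those of the real
  inner product.
\<close>
lemma cinner_L2_eq_inner: "cinner_L2 F G = Complex (inner F G) (inner F (\<i> *\<^sub>C G))"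
proof -
  obtain f where f: "square_integrable f" "F = abs_L2 f" by (rule L2_cases)
  obtain g where g: "square_integrable g" "G = abs_L2 g" by (rule L2_cases)
  have "cinner_L2 F (\<i> *\<^sub>C G) = (\<integral>x. f x * cnj (\<i> * g x) \<partial>lborel)"
    unfolding f(2) g(2) abs_L2_scaleC[OF g(1)]
    using f(1) square_integrable_scale[OF g(1), of \<i>] by (intro cinner_L2.abs_eq) (simp_all add: L2_rel_refl_iff)
  also have "\<dots> = (\<integral>x. - \<i> * (f x * cnj (g x)) \<partial>lborel)"
    by (simp add: mult.left_commute)
  also have "\<dots> = - \<i> * (\<integral>x. f x * cnj (g x) \<partial>lborel)"
    by (rule integral_mult_right_zero)
  also have "(\<integral>x. f x * cnj (g x) \<partial>lborel) = cinner_L2 F G"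
    unfolding f(2) g(2) using f(1) g(1) by (intro cinner_L2.abs_eq[symmetric]) (simp_all add: L2_rel_refl_iff)
  finally have "inner F (\<i> *\<^sub>C G) = Im (cinner_L2 F G)"
    by (simp add: inner_L2_eq_Re)
  then show ?thesis
    by (simp add: inner_L2_eq_Re)
qed

lemma L2_eqI: "F = G" if "\<And>K. cinner_L2 F K = cinner_L2 G K"
proof -
  have "\<forall>K. inner F K = inner G K"
    unfolding inner_L2_eq_Re that by simp
  then show ?thesis
    by (simp only: vector_eq_rdot)
qed

lemma cinner_L2_diff_left: "cinner_L2 (F - G) K = cinner_L2 F K - cinner_L2 G K"
  by (simp add: cinner_L2_eq_inner inner_diff_left complex_eq_iff)

lemma cinner_CR_trilinear_abs:
  assumes sq: "square_integrable f" "square_integrable g" "square_integrable h" "square_integrable k"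
  shows "cinner_L2 (CR_trilinear (abs_L2 f) (abs_L2 g) (abs_L2 h)) (abs_L2 k) =
    (\<integral>x. rectangle_integrand f g h k x \<partial>(lborel \<Otimes>\<^sub>M plane_pairs))"
proof -
  have "CR_trilinear (abs_L2 f) (abs_L2 g) (abs_L2 h) = abs_L2 (CR_integral f g h)"
    using sq by (intro CR_trilinear.abs_eq) (simp_all add: L2_rel_refl_iff)
  moreover have "cinner_L2 (abs_L2 (CR_integral f g h)) (abs_L2 k) = (\<integral>\<xi>. CR_integral f g h \<xi> * cnj (k \<xi>) \<partial>lborel)"
    using sq by (intro cinner_L2.abs_eq) (simp_all add: L2_rel_refl_iff CR_integral_square_integrable)
  ultimately show ?thesis
    using CR_integral_pairing[OF sq] by simp
qed

lemma cinner_CR_trilinear: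
  "cinner_L2 (CR_trilinear F G H) K =
    (\<integral>u. rep_L2 F (fst u + snd u) * rep_L2 H (fst u - snd u) * diagonal_kernel (rep_L2 G) (rep_L2 K) u \<partial>plane_pairs)"
  using cinner_CR_trilinear_abs[of "rep_L2 F" "rep_L2 G" "rep_L2 H" "rep_L2 K"]
    rectangle_integral_kernel[of "rep_L2 F" "rep_L2 G" "rep_L2 H" "rep_L2 K"]
  by (simp add: square_integrable_rep_L2 abs_rep_L2)

lemma CR_trilinear_diff:
  "CR_trilinear (F - F') G H = CR_trilinear F G H - CR_trilinear F' G H" (is ?A)
  "CR_trilinear F (G - G') H = CR_trilinear F G H - CR_trilinear F G' H" (is ?B)
  "CR_trilinear F G (H - H') = CR_trilinear F G H - CR_trilinear F G H'" (is ?C)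
proof -
  have eq: "cinner_L2 (CR_trilinear X Y Z) K = (\<integral>x. rectangle_integrand a b c d x \<partial>(lborel \<Otimes>\<^sub>M plane_pairs))"
    if "X = abs_L2 a" "Y = abs_L2 b" "Z = abs_L2 c" "K = abs_L2 d"
      "square_integrable a" "square_integrable b" "square_integrable c" "square_integrable d" for X Y Z K a b c d
    using that cinner_CR_trilinear_abs by simp
  note rep = abs_rep_L2[symmetric] square_integrable_rep_L2
  have diff: "X - X' = abs_L2 (\<lambda>x. rep_L2 X x - rep_L2 X' x)" "square_integrable (\<lambda>x. rep_L2 X x - rep_L2 X' x)" for X X'
    using abs_L2_diff[of "rep_L2 X" "rep_L2 X'"] by (simp_all add: square_integrable_diff square_integrable_rep_L2 abs_rep_L2)
  note R = eq[OF rep(1) rep(1) rep(1) rep(1) rep(2) rep(2) rep(2) rep(2)]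
  note int = rectangle_integrand_integrable[OF rep(2) rep(2) rep(2) rep(2)]
  show ?A
  proof (rule L2_eqI)
    fix K
    have "rectangle_integrand (\<lambda>x. rep_L2 F x - rep_L2 F' x) (rep_L2 G) (rep_L2 H) (rep_L2 K) =
        (\<lambda>x. rectangle_integrand (rep_L2 F) (rep_L2 G) (rep_L2 H) (rep_L2 K) x -
          rectangle_integrand (rep_L2 F') (rep_L2 G) (rep_L2 H) (rep_L2 K) x)"
      by (auto simp: fun_eq_iff rectangle_integrand_def left_diff_distrib)
    then show "cinner_L2 (CR_trilinear (F - F') G H) K = cinner_L2 (CR_trilinear F G H - CR_trilinear F' G H) K"
      unfolding cinner_L2_diff_left eq[OF diff(1) rep(1) rep(1) rep(1) diff(2) rep(2) rep(2) rep(2)]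
        R[of F G H K] R[of F' G H K]
      using int by simp
  qed
  show ?B
  proof (rule L2_eqI)
    fix K
    have "rectangle_integrand (rep_L2 F) (\<lambda>x. rep_L2 G x - rep_L2 G' x) (rep_L2 H) (rep_L2 K) =
        (\<lambda>x. rectangle_integrand (rep_L2 F) (rep_L2 G) (rep_L2 H) (rep_L2 K) x -
          rectangle_integrand (rep_L2 F) (rep_L2 G') (rep_L2 H) (rep_L2 K) x)"
      by (auto simp: fun_eq_iff rectangle_integrand_def diagonal_density_def left_diff_distrib right_diff_distrib)
    then show "cinner_L2 (CR_trilinear F (G - G') H) K = cinner_L2 (CR_trilinear F G H - CR_trilinear F G' H) K"
      unfolding cinner_L2_diff_left eq[OF rep(1) diff(1) rep(1) rep(1) rep(2) diff(2) rep(2) rep(2)]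
        R[of F G H K] R[of F G' H K]
      using int by simp
  qed
  show ?C
  proof (rule L2_eqI)
    fix K
    have "rectangle_integrand (rep_L2 F) (rep_L2 G) (\<lambda>x. rep_L2 H x - rep_L2 H' x) (rep_L2 K) =
        (\<lambda>x. rectangle_integrand (rep_L2 F) (rep_L2 G) (rep_L2 H) (rep_L2 K) x -
          rectangle_integrand (rep_L2 F) (rep_L2 G) (rep_L2 H') (rep_L2 K) x)"
      by (auto simp: fun_eq_iff rectangle_integrand_def left_diff_distrib right_diff_distrib)
    then show "cinner_L2 (CR_trilinear F G (H - H')) K = cinner_L2 (CR_trilinear F G H - CR_trilinear F G H') K"
      unfolding cinner_L2_diff_left eq[OF rep(1) rep(1) diff(1) rep(1) rep(2) rep(2) diff(2) rep(2)]
        R[of F G H K] R[of F G H' K]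
      using int by simp
  qed
qed

text \<open>
  The entries are exchanged in the order middle, left, right. In each term that results, the
  middle entry is either fixed or the difference \<open>X - x\<close> itself, as the compactness statements
  require.
\<close>
lemma CR_trilinear_cube_diff:
  "CR_trilinear X X X - CR_trilinear x x x =
    CR_trilinear X (X - x) X + (CR_trilinear (X - x) x X + CR_trilinear x x (X - x))"
  unfolding CR_trilinear_diff by simp

text \<open>
  The bound on the pairing with an arbitrary vector is used for the vector \<open>\<T>(F,G,H)\<close> itself.
\<close>
lemma norm_CR_trilinear: "norm (CR_trilinear F G H) \<le> 4 * (norm F * norm G * norm H)"
proof -
  define X where "X = CR_trilinear F G H"
  note [measurable] = rep_L2_measurable
  have "ennreal ((norm (cinner_L2 X X))\<^sup>2) \<le>
      sqnorm plane_pairs (\<lambda>u. rep_L2 F (fst u + snd u) * rep_L2 H (fst u - snd u)) *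
      sqnorm plane_pairs (diagonal_kernel (rep_L2 G) (rep_L2 X))"
    unfolding X_def cinner_CR_trilinear[of F G H] by (rule integral_mult_le_sqnorm) measurable
  also have "\<dots> \<le> (sqnorm lborel (rep_L2 F) * sqnorm lborel (rep_L2 H)) *
      (16 * (sqnorm lborel (rep_L2 G) * sqnorm lborel (rep_L2 X)))"
    by (intro mult_mono ennreal_le_of_4_mult[OF sqnorm_fixed_diagonal] sqnorm_diagonal_kernel) measurable
  also have "\<dots> = ennreal (((norm F)\<^sup>2 * (norm H)\<^sup>2) * (16 * ((norm G)\<^sup>2 * (norm X)\<^sup>2)))"
    by (simp add: sqnorm_rep_L2 ennreal_mult)
  also have "((norm F)\<^sup>2 * (norm H)\<^sup>2) * (16 * ((norm G)\<^sup>2 * (norm X)\<^sup>2)) = (4 * (norm F * norm G * norm H) * norm X)\<^sup>2"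
    by (simp add: power_mult_distrib algebra_simps)
  finally have "(norm (cinner_L2 X X))\<^sup>2 \<le> (4 * (norm F * norm G * norm H) * norm X)\<^sup>2"
    by (simp add: ennreal_le_iff)
  then have "norm (cinner_L2 X X) \<le> 4 * (norm F * norm G * norm H) * norm X"
    by (rule power2_le_imp_le) simp
  moreover have "norm X * norm X \<le> norm (cinner_L2 X X)"
    using complex_Re_le_cmod[of "cinner_L2 X X"] power2_norm_eq_inner[of X]
    by (simp add: inner_L2_eq_Re power2_eq_square)
  ultimately have "norm X * norm X \<le> 4 * (norm F * norm G * norm H) * norm X"
    by simp
  then show ?thesis
    unfolding X_def[symmetric] by (cases "norm X = 0") (auto simp: mult_le_cancel_right)
qed

lemma tendsto_CR_trilinear:
  assumes X: "(X \<longlongrightarrow> x) Fl"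
  shows "((\<lambda>n. CR_trilinear (X n) (X n) (X n)) \<longlongrightarrow> CR_trilinear x x x) Fl"
proof (rule Lim_null_comparison[THEN LIM_zero_cancel])
  let ?b = "\<lambda>n. 4 * (norm (X n) * norm (X n - x) * norm (X n)) +
    (4 * (norm (X n - x) * norm x * norm (X n)) + 4 * (norm x * norm x * norm (X n - x)))"
  show "\<forall>\<^sub>F n in Fl. norm (CR_trilinear (X n) (X n) (X n) - CR_trilinear x x x) \<le> ?b n"
    unfolding CR_trilinear_cube_diff
    by (intro always_eventually allI order_trans[OF norm_triangle_ineq] add_mono norm_CR_trilinear)
  have "(?b \<longlongrightarrow> 4 * (norm x * norm (x - x) * norm x) +
    (4 * (norm (x - x) * norm x * norm x) + 4 * (norm x * norm x * norm (x - x)))) Fl"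
    by (intro tendsto_intros X)
  then show "(?b \<longlongrightarrow> 0) Fl"
    by simp
qed

lemma CR_trilinear_measurable:
  assumes "f \<in> borel_measurable M"
  shows "(\<lambda>t. CR_trilinear (f t) (f t) (f t)) \<in> borel_measurable M"
proof -
  have "continuous_on UNIV (\<lambda>F. CR_trilinear F F F)"
    unfolding continuous_on_def by (intro ballI tendsto_CR_trilinear tendsto_ident_at)
  from borel_measurable_continuous_onI[OF this] assms show ?thesis
    by (rule measurable_compose[rotated])
qed

lemma scaleC_L2_diff_right: "c *\<^sub>C (F - G) = c *\<^sub>C F - c *\<^sub>C G"
  by transfer (auto simp: L2_rel_def right_diff_distrib intro!: square_integrable_diff square_integrable_scale)

lemma inner_scaleC_i_left: "inner (\<i> *\<^sub>C F) G = - inner F (\<i> *\<^sub>C G)"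
proof -
  obtain f where f: "square_integrable f" "F = abs_L2 f" by (rule L2_cases)
  obtain g where g: "square_integrable g" "G = abs_L2 g" by (rule L2_cases)
  have "cinner_L2 (\<i> *\<^sub>C F) G = (\<integral>x. (\<i> * f x) * cnj (g x) \<partial>lborel)"
    unfolding f(2) g(2) abs_L2_scaleC[OF f(1)]
    using g(1) square_integrable_scale[OF f(1), of \<i>] by (intro cinner_L2.abs_eq) (simp_all add: L2_rel_refl_iff)
  also have "\<dots> = \<i> * (\<integral>x. f x * cnj (g x) \<partial>lborel)"
    unfolding mult.assoc by (rule integral_mult_right_zero)
  also have "(\<integral>x. f x * cnj (g x) \<partial>lborel) = cinner_L2 F G"
    unfolding f(2) g(2) using f(1) g(1) by (intro cinner_L2.abs_eq[symmetric]) (simp_all add: L2_rel_refl_iff)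
  finally have "cinner_L2 (\<i> *\<^sub>C F) G = \<i> * cinner_L2 F G" .
  then have "inner (\<i> *\<^sub>C F) G = - Im (cinner_L2 F G)"
    by (simp add: inner_L2_eq_Re)
  then show ?thesis
    by (simp add: cinner_L2_eq_inner)
qed

lemma norm_cinner_L2_le: "norm (cinner_L2 F G) \<le> 2 * (norm F * norm G)"
  using cmod_le[of "cinner_L2 F G"] Cauchy_Schwarz_ineq2[of F G] Cauchy_Schwarz_ineq2[of F "\<i> *\<^sub>C G"]
  by (simp add: cinner_L2_eq_inner norm_scaleC_L2)

lemma cinner_L2_measurable:
  assumes [measurable]: "f \<in> borel_measurable M" "g \<in> borel_measurable M"
  shows "(\<lambda>t. cinner_L2 (f t) (g t)) \<in> borel_measurable M"
proof -
  have "continuous_on UNIV (\<lambda>F. \<i> *\<^sub>C F)"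
    by (rule lipschitz_on_continuous_on[of 1], rule lipschitz_onI)
      (simp_all add: dist_norm norm_scaleC_L2 flip: scaleC_L2_diff_right)
  then have [measurable]: "(\<lambda>F. \<i> *\<^sub>C F) \<in> borel_measurable borel"
    by (rule borel_measurable_continuous_onI)
  show ?thesis
    unfolding cinner_L2_eq_inner Complex_eq by measurable
qed

section \<open>Weak limits in a Hilbert space\<close>

definition weak_limit :: "(nat \<Rightarrow> 'a::real_inner) \<Rightarrow> 'a \<Rightarrow> bool" where
  "weak_limit X x \<longleftrightarrow> (\<forall>\<phi>. (\<lambda>n. inner (X n) \<phi>) \<longlonglongrightarrow> inner x \<phi>)"

text \<open>
  The representing vector minimises \<open>J x = |x|\<^sup>2 - 2 \<Lambda> x\<close>. By the parallelogram law
  a minimising sequence is Cauchy, and at the minimum the derivative of \<open>J\<close> in each direction vanishes.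
\<close>
lemma riesz_representation:
  fixes \<Lambda> :: "'a::{real_inner, banach} \<Rightarrow> real"
  assumes "bounded_linear \<Lambda>"
  obtains x where "\<And>\<phi>. \<Lambda> \<phi> = inner x \<phi>"
proof -
  interpret bounded_linear \<Lambda> by fact
  define J where "J x = (norm x)\<^sup>2 - 2 * \<Lambda> x" for x
  obtain K where K: "\<And>x. norm (\<Lambda> x) \<le> norm x * K"
    using bounded by blast
  have J_ge: "J x \<ge> - K\<^sup>2" for x
  proof -
    have "\<Lambda> x \<le> norm x * K"
      using K[of x] by simp
    then have "J x + K\<^sup>2 \<ge> (norm x - K)\<^sup>2"
      by (simp add: J_def power2_diff)
    then show ?thesis
      using zero_le_power2[of "norm x - K"] by linarith
  qed
  define I where "I = Inf (range J)"
  have bdd: "bdd_below (range J)"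
    using J_ge by (intro bdd_belowI[of _ "- K\<^sup>2"]) auto
  have I_le: "I \<le> J x" for x
    unfolding I_def using bdd by (intro cInf_lower) auto
  have "\<exists>x. J x < I + 1 / real (Suc n)" for n
    using cInf_lessD[of "range J" "I + 1 / real (Suc n)"] unfolding I_def by auto
  then obtain X where X: "\<And>n. J (X n) < I + 1 / real (Suc n)"
    by metis
  have parallelogram: "(norm (x - y))\<^sup>2 = 2 * J x + 2 * J y - 4 * J ((1/2) *\<^sub>R (x + y))" for x y
    unfolding J_def scaleR add power2_norm_eq_inner inner_simps by (simp add: inner_commute field_simps)
  have close: "(norm (X m - X n))\<^sup>2 \<le> 2 / real (Suc m) + 2 / real (Suc n)" for m n
    using parallelogram[of "X m" "X n"] X[of m] X[of n] I_le[of "(1/2) *\<^sub>R (X m + X n)"] by simp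
  have "Cauchy X"
  proof (rule metric_CauchyI)
    fix e :: real assume e: "e > 0"
    then obtain N where N: "1 / real (Suc N) < e\<^sup>2 / 4"
      using nat_approx_posE[of "e\<^sup>2 / 4"] by auto
    have "dist (X m) (X n) < e" if "m \<ge> N" "n \<ge> N" for m n
    proof -
      have le: "1 / real (Suc m) \<le> 1 / real (Suc N)" "1 / real (Suc n) \<le> 1 / real (Suc N)"
        using that by (auto intro!: divide_left_mono)
      have "(norm (X m - X n))\<^sup>2 < e\<^sup>2"
        using close[of m n] N le by simp
      then show ?thesis
        using e by (simp add: dist_norm power2_less_imp_less)
    qed
    then show "\<exists>M. \<forall>m\<ge>M. \<forall>n\<ge>M. dist (X m) (X n) < e" by blast
  qed
  then obtain x where x: "X \<longlonglongrightarrow> x"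
    by (auto simp: Cauchy_convergent_iff convergent_def)
  have Jx: "J x \<le> I"
  proof (rule LIMSEQ_le)
    show "(\<lambda>n. J (X n)) \<longlonglongrightarrow> J x"
      unfolding J_def by (intro tendsto_intros tendsto x)
    show "(\<lambda>n. I + 1 / real (Suc n)) \<longlonglongrightarrow> I"
      using tendsto_add[OF tendsto_const LIMSEQ_Suc[OF lim_1_over_n], of I] by simp
  qed (use X less_imp_le in blast)
  have "\<Lambda> \<phi> = inner x \<phi>" for \<phi>
  proof (rule ccontr)
    define d where "d = inner x \<phi> - \<Lambda> \<phi>"
    assume "\<Lambda> \<phi> \<noteq> inner x \<phi>"
    then have d: "d \<noteq> 0" by (simp add: d_def)
    have J_add: "J (x + t *\<^sub>R \<phi>) = J x + 2 * t * d + t\<^sup>2 * (norm \<phi>)\<^sup>2" for t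
      unfolding J_def d_def add scaleR power2_norm_eq_inner inner_simps
      by (simp add: inner_commute power2_eq_square algebra_simps)
    \<comment> \<open>The quadratic polynomial \<open>J (x + t \<phi>) - J x\<close> in \<open>t\<close> is negative at \<open>t = - d / s\<close>, since
      \<open>s\<close> exceeds its leading coefficient; adding 1 covers \<open>\<phi> = 0\<close>.\<close>
    define s where "s = (norm \<phi>)\<^sup>2 + 1"
    have s: "s > 0" by (simp add: s_def add_nonneg_pos)
    have "0 \<le> 2 * (- d / s) * d + (- d / s)\<^sup>2 * (norm \<phi>)\<^sup>2"
      using Jx I_le[of "x + (- d / s) *\<^sub>R \<phi>"] J_add[of "- d / s"] by linarith
    also have "\<dots> \<le> 2 * (- d / s) * d + (- d / s)\<^sup>2 * s"
      by (intro add_left_mono mult_left_mono) (simp_all add: s_def)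
    also have "\<dots> = - (d\<^sup>2 / s)"
      using s by (simp add: power2_eq_square field_simps)
    also have "\<dots> < 0"
      using d s by simp
    finally show False by simp
  qed
  then show ?thesis by (rule that)
qed

lemma weak_limit_norm_le:
  fixes x :: "'a::real_inner"
  assumes "weak_limit X x" "\<And>n. norm (X n) \<le> C"
  shows "norm x \<le> C"
proof -
  have "inner (X n) x \<le> C * norm x" for n
    using norm_cauchy_schwarz[of "X n" x] mult_right_mono[OF assms(2)[of n], of "norm x"] by simp
  then have "inner x x \<le> C * norm x"
    using assms(1) unfolding weak_limit_def by (intro LIMSEQ_le_const2[of "\<lambda>n. inner (X n) x"]) auto
  then have "norm x * norm x \<le> C * norm x"
    by (simp add: power2_norm_eq_inner[symmetric] power2_eq_square)
  then show ?thesis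
    using order_trans[OF norm_ge_zero assms(2)[of 0]] by (cases "x = 0") (auto simp: mult_le_cancel_right)
qed

text \<open>
  The limits of the inner products define a bounded linear functional, which is represented by the
  weak limit.
\<close>
lemma weak_limit_exists:
  fixes X :: "nat \<Rightarrow> 'a::{real_inner, banach}"
  assumes conv: "\<And>\<phi>. convergent (\<lambda>n. inner (X n) \<phi>)" and X: "\<And>n. norm (X n) \<le> C"
  obtains x where "weak_limit X x"
proof -
  define \<Lambda> where "\<Lambda> \<phi> = lim (\<lambda>n. inner (X n) \<phi>)" for \<phi>
  have lim: "(\<lambda>n. inner (X n) \<phi>) \<longlonglongrightarrow> \<Lambda> \<phi>" for \<phi>
    unfolding \<Lambda>_def using conv by (simp add: convergent_LIMSEQ_iff)
  have "bounded_linear \<Lambda>"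
  proof (rule bounded_linear_intro)
    show "\<Lambda> (\<phi> + \<psi>) = \<Lambda> \<phi> + \<Lambda> \<psi>" for \<phi> \<psi>
      using LIMSEQ_unique[OF lim[of "\<phi> + \<psi>"]] tendsto_add[OF lim lim, of \<phi> \<psi>] by (simp add: inner_add_right)
    show "\<Lambda> (c *\<^sub>R \<phi>) = c *\<^sub>R \<Lambda> \<phi>" for c \<phi>
      using LIMSEQ_unique[OF lim[of "c *\<^sub>R \<phi>"]] tendsto_mult_left[OF lim, of c \<phi>] by simp
    show "norm (\<Lambda> \<phi>) \<le> norm \<phi> * C" for \<phi>
    proof (rule LIMSEQ_le_const2[OF tendsto_norm[OF lim]], intro exI allI impI)
      show "norm (inner (X n) \<phi>) \<le> norm \<phi> * C" for n
        using Cauchy_Schwarz_ineq2[of "X n" \<phi>] mult_right_mono[OF X[of n], of "norm \<phi>"] by (simp add: mult.commute)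
    qed
  qed
  then obtain x where "\<And>\<phi>. \<Lambda> \<phi> = inner x \<phi>"
    using riesz_representation by blast
  then have "weak_limit X x"
    using lim by (simp add: weak_limit_def)
  then show ?thesis by (rule that)
qed

lemma common_convergent_subsequence:
  fixes a :: "nat \<Rightarrow> nat \<Rightarrow> real"
  assumes "\<And>k. bounded (range (a k))"
  obtains r where "strict_mono r" "\<And>k. convergent (a k \<circ> r)"
proof -
  interpret subseqs "\<lambda>k s. convergent (a k \<circ> s)"
  proof
    fix k and s :: "nat \<Rightarrow> nat" assume "strict_mono s"
    have "bounded (range (a k \<circ> s))"
      using assms[of k] by (rule bounded_subset) auto
    then obtain l r where "strict_mono r" "((a k \<circ> s) \<circ> r) \<longlonglongrightarrow> l"
      using bounded_imp_convergent_subsequence by blast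
    then show "\<exists>r'. strict_mono r' \<and> convergent (a k \<circ> (s \<circ> r'))"
      by (auto simp: o_assoc convergent_def)
  qed
  have "convergent (a k \<circ> (diagseq \<circ> (+) (Suc k)))" for k
    by (rule diagseq_holds) (metis convergent_subseq_convergent o_assoc)
  then have "convergent (a k \<circ> diagseq)" for k
    using convergent_ignore_initial_segment[of "a k \<circ> diagseq" "Suc k"]
    by (simp only: o_def add.commute[of _ "Suc k"])
  then show ?thesis
    using subseq_diagseq that by blast
qed

text \<open>
  A diagonal sequence makes the inner products converge for all times in a countable dense subset
  of \<open>I\<close> and all test vectors in a countable dense set. Uniform boundedness and the common Lipschitz
  constant carry the Cauchy property over to all times and all test vectors.
\<close>
lemma weak_Arzela_Ascoli:
  fixes F :: "nat \<Rightarrow> real \<Rightarrow> 'a::{real_inner, banach, second_countable_topology}"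
  assumes bound: "\<And>n t. t \<in> I \<Longrightarrow> norm (F n t) \<le> C"
    and lipschitz: "\<And>n s t. s \<in> I \<Longrightarrow> t \<in> I \<Longrightarrow> norm (F n s - F n t) \<le> L * \<bar>s - t\<bar>"
  obtains r g where "strict_mono r" "\<And>t. t \<in> I \<Longrightarrow> weak_limit (\<lambda>n. F (r n) t) (g t)"
proof (cases "I = {}")
  case True
  then show ?thesis using that[of id] by (auto simp: strict_mono_id)
next
  case False
  obtain Q where Q: "countable Q" "Q \<subseteq> I" "I \<subseteq> closure Q"
    using separable[of I] by blast
  obtain D :: "'a set" where D: "countable D" "\<And>U. open U \<Longrightarrow> U \<noteq> {} \<Longrightarrow> \<exists>d\<in>D. d \<in> U"
    by (erule countable_dense_setE)
  have "Q \<noteq> {}"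
    using Q(3) False by auto
  moreover have "D \<noteq> {}"
    using D(2)[of UNIV] by auto
  ultimately have QD: "countable (Q \<times> D)" "Q \<times> D \<noteq> {}"
    using Q D by auto
  define e where "e = from_nat_into (Q \<times> D)"
  have e: "e k \<in> Q \<times> D" for k
    unfolding e_def by (rule from_nat_into[OF QD(2)])
  define a where "a k n = inner (F n (fst (e k))) (snd (e k))" for k n
  have "bounded (range (a k))" for k
  proof (rule boundedI)
    fix y assume "y \<in> range (a k)"
    then obtain n where y: "y = a k n" by auto
    have "fst (e k) \<in> I"
      using e[of k] Q by auto
    then show "norm y \<le> C * norm (snd (e k))"
      unfolding y a_def real_norm_def
      by (intro order_trans[OF Cauchy_Schwarz_ineq2 mult_right_mono] bound) auto
  qed
  then obtain r where r: "strict_mono r" "\<And>k. convergent (a k \<circ> r)"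
    using common_convergent_subsequence[of a] by blast
  have conv_QD: "convergent (\<lambda>n. inner (F (r n) q) d)" if "q \<in> Q" "d \<in> D" for q d
  proof -
    have "\<exists>k. e k = (q, d)"
      using that from_nat_into_surj[OF QD(1), of "(q, d)"] by (auto simp: e_def)
    then obtain k where "e k = (q, d)" ..
    then show ?thesis
      using r(2)[of k] by (simp add: a_def o_def)
  qed
  have conv: "convergent (\<lambda>n. inner (F (r n) t) \<phi>)" if t: "t \<in> I" for t \<phi>
  proof (rule Cauchy_convergent, rule metric_CauchyI)
    fix \<epsilon> :: real assume \<epsilon>: "\<epsilon> > 0"
    have C: "C \<ge> 0"
      using bound[OF t, of 0] norm_ge_zero[of "F 0 t"] by linarith
    \<comment> \<open>Replacing \<open>(t, \<phi>)\<close> by the nearby pair \<open>(q, d)\<close> costs \<open>\<epsilon> / 8\<close> for each component,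
      hence \<open>\<epsilon> / 4\<close> for each of the two indices; \<open>\<epsilon> / 2\<close> is left for the convergence at \<open>(q, d)\<close>.\<close>
    have "\<epsilon> / (8 * (C + 1)) > 0"
      using \<epsilon> C by simp
    then have "\<exists>d\<in>D. d \<in> ball \<phi> (\<epsilon> / (8 * (C + 1)))"
      by (intro D(2)) (auto simp del: mem_ball)
    then obtain d where d: "d \<in> D" "norm (\<phi> - d) < \<epsilon> / (8 * (C + 1))"
      by (auto simp only: mem_ball dist_norm)
    have pos: "8 * (\<bar>L\<bar> * norm d + 1) > 0"
      by (simp add: add_nonneg_pos)
    then have "\<epsilon> / (8 * (\<bar>L\<bar> * norm d + 1)) > 0"
      using \<epsilon> by simp
    then obtain q where q: "q \<in> Q" "\<bar>t - q\<bar> < \<epsilon> / (8 * (\<bar>L\<bar> * norm d + 1))"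
      using Q(3) t unfolding closure_approachable by (metis dist_commute dist_real_def subsetD closure_approachable)
    have qI: "q \<in> I"
      using q Q by auto
    have near: "\<bar>inner (F (r n) t) \<phi> - inner (F (r n) q) d\<bar> < \<epsilon> / 4" for n
    proof -
      have "\<bar>inner (F (r n) t) \<phi> - inner (F (r n) q) d\<bar> \<le>
          \<bar>inner (F (r n) t) (\<phi> - d)\<bar> + \<bar>inner (F (r n) t - F (r n) q) d\<bar>"
        by (simp add: inner_diff_left inner_diff_right)
      moreover have "\<bar>inner (F (r n) t) (\<phi> - d)\<bar> < \<epsilon> / 8"
      proof -
        have "\<bar>inner (F (r n) t) (\<phi> - d)\<bar> \<le> C * norm (\<phi> - d)"
          by (intro order_trans[OF Cauchy_Schwarz_ineq2 mult_right_mono] bound t) auto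
        also have "\<dots> \<le> (C + 1) * norm (\<phi> - d)"
          by (simp add: distrib_right)
        also have "\<dots> < \<epsilon> / 8"
          using d(2) C by (simp add: field_simps)
        finally show ?thesis .
      qed
      moreover have "\<bar>inner (F (r n) t - F (r n) q) d\<bar> < \<epsilon> / 8"
      proof -
        have "\<bar>inner (F (r n) t - F (r n) q) d\<bar> \<le> L * \<bar>t - q\<bar> * norm d"
          by (intro order_trans[OF Cauchy_Schwarz_ineq2 mult_right_mono] lipschitz t qI) auto
        also have "\<dots> \<le> \<bar>L\<bar> * \<bar>t - q\<bar> * norm d"
          by (intro mult_right_mono) auto
        also have "\<dots> \<le> (\<bar>L\<bar> * norm d + 1) * \<bar>t - q\<bar>"
          by (simp add: algebra_simps)
        also have "\<dots> < \<epsilon> / 8"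
          using q(2) pos by (simp add: field_simps)
        finally show ?thesis .
      qed
      ultimately show ?thesis by linarith
    qed
    obtain l where "(\<lambda>n. inner (F (r n) q) d) \<longlonglongrightarrow> l"
      using conv_QD[OF q(1) d(1)] by (auto simp: convergent_def)
    then have "Cauchy (\<lambda>n. inner (F (r n) q) d)"
      by (rule LIMSEQ_imp_Cauchy)
    then obtain M where M: "\<And>m n. m \<ge> M \<Longrightarrow> n \<ge> M \<Longrightarrow> dist (inner (F (r m) q) d) (inner (F (r n) q) d) < \<epsilon> / 2"
      using metric_CauchyD[of _ "\<epsilon> / 2"] \<epsilon> by (metis half_gt_zero)
    have "dist (inner (F (r m) t) \<phi>) (inner (F (r n) t) \<phi>) < \<epsilon>" if "m \<ge> M" "n \<ge> M" for m n
      using M[OF that] near[of m] near[of n] unfolding dist_real_def by linarith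
    then show "\<exists>M. \<forall>m\<ge>M. \<forall>n\<ge>M. dist (inner (F (r m) t) \<phi>) (inner (F (r n) t) \<phi>) < \<epsilon>"
      by blast
  qed
  have "\<exists>x. weak_limit (\<lambda>n. F (r n) t) x" if "t \<in> I" for t
    using weak_limit_exists[of "\<lambda>n. F (r n) t" C] conv[OF that] bound[OF that] by blast
  then obtain g where "\<And>t. t \<in> I \<Longrightarrow> weak_limit (\<lambda>n. F (r n) t) (g t)"
    by metis
  with r(1) show ?thesis by (rule that)
qed

section \<open>Weak continuity of the trilinear operator\<close>

lemma weak_limit_diff: "weak_limit X x \<Longrightarrow> weak_limit (\<lambda>n. X n - x) 0"
  by (auto simp: weak_limit_def inner_diff_left LIM_zero)

lemma weak_limit_cinner: "weak_limit X x \<Longrightarrow> (\<lambda>n. cinner_L2 (X n) \<phi>) \<longlonglongrightarrow> cinner_L2 x \<phi>"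
  by (auto simp: weak_limit_def cinner_L2_eq_inner intro!: tendsto_Complex)

lemma weakly_null_rep_L2:
  assumes "weak_limit X 0"
  shows "weakly_null (\<lambda>n. rep_L2 (X n))"
  unfolding weakly_null_def
proof (intro allI impI)
  fix \<phi> :: "real^2 \<Rightarrow> complex" assume \<phi>: "square_integrable \<phi>"
  have "cinner_L2 F (abs_L2 \<phi>) = (\<integral>x. rep_L2 F x * cnj (\<phi> x) \<partial>lborel)" for F
    using cinner_L2.abs_eq[of "rep_L2 F" \<phi>] \<phi>
    by (simp add: L2_rel_refl_iff square_integrable_rep_L2 abs_rep_L2)
  moreover have "cinner_L2 0 (abs_L2 \<phi>) = 0"
    using cinner_L2_diff_left[of 0 0] by simp
  then have "(\<lambda>n. cinner_L2 (X n) (abs_L2 \<phi>)) \<longlonglongrightarrow> 0"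
    using weak_limit_cinner[OF assms, of "abs_L2 \<phi>"] by simp
  ultimately show "(\<lambda>n. \<integral>x. rep_L2 (X n) x * cnj (\<phi> x) \<partial>lborel) \<longlonglongrightarrow> 0"
    by simp
qed

text \<open>
  When the null sequence is in the middle, the diagonal kernel tends to \<open>0\<close> in norm while the
  products of the two outer functions stay bounded. When it is in an outer place, the kernel is a fixed
  square integrable function, and the two outer functions sit at \<open>m + v\<close> and \<open>m - v\<close>.
\<close>
lemma
  assumes null: "weak_limit R 0" and R: "\<And>n. norm (R n) \<le> C" and X: "\<And>n. norm (X n) \<le> C"
  shows CR_trilinear_null_middle: "(\<lambda>n. cinner_L2 (CR_trilinear (X n) (R n) (X n)) K) \<longlonglongrightarrow> 0"
    and CR_trilinear_null_left: "(\<lambda>n. cinner_L2 (CR_trilinear (R n) G (X n)) K) \<longlonglongrightarrow> 0"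
    and CR_trilinear_null_right: "(\<lambda>n. cinner_L2 (CR_trilinear (X n) G (R n)) K) \<longlonglongrightarrow> 0"
proof -
  note [measurable] = rep_L2_measurable
  have sq: "sqnorm lborel (rep_L2 (Z n)) \<le> ennreal (C\<^sup>2)" if "\<And>n. norm (Z n) \<le> C" for Z :: "nat \<Rightarrow> L2" and n
    unfolding sqnorm_rep_L2 using that[of n] by (intro ennreal_leI power_mono) auto
  have sqX: "sqnorm lborel (rep_L2 (X n)) \<le> ennreal (C\<^sup>2)"
    and sqR: "sqnorm lborel (rep_L2 (R n)) \<le> ennreal (C\<^sup>2)" for n
    using sq[of X] sq[of R] X R by auto
  note null' = weakly_null_rep_L2[OF null]
  have "sqnorm plane_pairs (\<lambda>u. rep_L2 (X n) (fst u + snd u) * rep_L2 (X n) (fst u - snd u)) \<le>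
      ennreal (C\<^sup>2) * ennreal (C\<^sup>2)" for n
  proof -
    have "sqnorm plane_pairs (\<lambda>u. rep_L2 (X n) (fst u + snd u) * rep_L2 (X n) (fst u - snd u)) \<le>
        sqnorm lborel (rep_L2 (X n)) * sqnorm lborel (rep_L2 (X n))"
      by (intro ennreal_le_of_4_mult[OF sqnorm_fixed_diagonal]) measurable
    also have "\<dots> \<le> ennreal (C\<^sup>2) * ennreal (C\<^sup>2)"
      by (intro mult_mono sqX) auto
    finally show ?thesis .
  qed
  moreover have "(\<lambda>n. sqnorm plane_pairs (diagonal_kernel (rep_L2 (R n)) (rep_L2 K))) \<longlonglongrightarrow> 0"
    by (rule diagonal_kernel_weakly_null[where r = "\<lambda>n. rep_L2 (R n)", OF _ sqR _ null' square_integrable_rep_L2]) auto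
  ultimately show "(\<lambda>n. cinner_L2 (CR_trilinear (X n) (R n) (X n)) K) \<longlonglongrightarrow> 0"
    unfolding cinner_CR_trilinear
    by (intro integral_mult_tendsto_0[where C = "ennreal (C\<^sup>2) * ennreal (C\<^sup>2)"]) (auto simp: ennreal_mult_less_top)
  have K: "sqnorm plane_pairs (diagonal_kernel (rep_L2 G) (rep_L2 K)) < \<infinity>"
  proof -
    have "sqnorm plane_pairs (diagonal_kernel (rep_L2 G) (rep_L2 K)) \<le>
        16 * (sqnorm lborel (rep_L2 G) * sqnorm lborel (rep_L2 K))"
      by (rule sqnorm_diagonal_kernel) measurable
    also have "\<dots> < \<infinity>"
      by (simp add: sqnorm_rep_L2 ennreal_mult_less_top)
    finally show ?thesis .
  qed
  have ends: "(\<lambda>n. \<integral>u. rep_L2 (X n) (fst u + z \<odot> snd u) * rep_L2 (R n) (fst u + w \<odot> snd u) *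
      diagonal_kernel (rep_L2 G) (rep_L2 K) u \<partial>plane_pairs) \<longlonglongrightarrow> 0" if "z \<noteq> w" for z w
    by (rule ends_weakly_null[where r = "\<lambda>n. rep_L2 (X n)" and s = "\<lambda>n. rep_L2 (R n)",
        OF _ sqX _ sqR _ null' _ K that]) auto
  show "(\<lambda>n. cinner_L2 (CR_trilinear (R n) G (X n)) K) \<longlonglongrightarrow> 0"
    using ends[of "-1" 1] unfolding cinner_CR_trilinear
    by (simp add: complex_act_minus_left complex_act_one mult.commute[of "rep_L2 (X _) _"])
  show "(\<lambda>n. cinner_L2 (CR_trilinear (X n) G (R n)) K) \<longlonglongrightarrow> 0"
    using ends[of 1 "-1"] unfolding cinner_CR_trilinear
    by (simp add: complex_act_minus_left complex_act_one)
qed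

text \<open>
  Each of the three terms of \<open>CR_trilinear_cube_diff\<close> contains the weakly null sequence \<open>X n - x\<close>
  once, so one of the three preceding statements applies to it.
\<close>
theorem weak_limit_CR_trilinear:
  assumes lim: "weak_limit X x" and X: "\<And>n. norm (X n) \<le> C"
  shows "weak_limit (\<lambda>n. CR_trilinear (X n) (X n) (X n)) (CR_trilinear x x x)"
proof -
  define C' where "C' = C + norm x"
  have C: "C \<ge> 0"
    using X[of 0] norm_ge_zero[of "X 0"] by linarith
  have R: "norm (X n - x) \<le> C'" and X': "norm (X n) \<le> C'" and x: "norm x \<le> C'" for n
    using norm_triangle_ineq4[of "X n" x] X[of n] C by (auto simp: C'_def add_increasing2)
  note null = weak_limit_diff[OF lim]
  have "(\<lambda>n. inner (CR_trilinear (X n) (X n) (X n)) K) \<longlonglongrightarrow> inner (CR_trilinear x x x) K" for K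
  proof -
    have "(\<lambda>n. Re (cinner_L2 (CR_trilinear (X n) (X n - x) (X n)) K) +
        (Re (cinner_L2 (CR_trilinear (X n - x) x (X n)) K) + Re (cinner_L2 (CR_trilinear x x (X n - x)) K))) \<longlonglongrightarrow>
        Re 0 + (Re 0 + Re 0)"
      by (intro tendsto_add tendsto_Re CR_trilinear_null_middle[OF null R X'] CR_trilinear_null_left[OF null R X']
          CR_trilinear_null_right[OF null R x])
    then have "(\<lambda>n. inner (CR_trilinear (X n) (X n) (X n) - CR_trilinear x x x) K) \<longlonglongrightarrow> 0"
      unfolding CR_trilinear_cube_diff inner_add_left unfolding inner_L2_eq_Re by simp
    then show ?thesis
      by (simp add: inner_diff_left LIM_zero_iff)
  qed
  then show ?thesis
    by (simp add: weak_limit_def)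
qed

section \<open>Compactness of bounded families of solutions\<close>

lemma finite_measure_lebesgue_on_interval: "finite_measure (lebesgue_on {a..b::real})"
  by (rule finite_measure_lebesgue_on) simp

lemma
  fixes h :: "real \<Rightarrow> 'b::{banach, second_countable_topology}"
  assumes h: "h \<in> borel_measurable (lebesgue_on {0..T})"
    and bound: "AE s in lebesgue_on {0..T}. norm (h s) \<le> B"
  shows bounded_integrable_lebesgue_on: "t \<in> {0..T} \<Longrightarrow> integrable (lebesgue_on {0..t}) h"
    and norm_primitive_diff_le: "s \<in> {0..T} \<Longrightarrow> t \<in> {0..T} \<Longrightarrow>
      norm ((LINT u|lebesgue_on {0..s}. h u) - (LINT u|lebesgue_on {0..t}. h u)) \<le> B * \<bar>s - t\<bar>"
proof -
  interpret finite_measure "lebesgue_on {0..T}"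
    by (rule finite_measure_lebesgue_on_interval)
  have "integrable (lebesgue_on {0..T}) h"
    using bound h by (rule integrable_const_bound)
  then have int: "set_integrable lebesgue {0..T} h"
    by (simp add: set_integrable_def integrable_restrict_space)
  have sub: "set_integrable lebesgue A h" if "A \<subseteq> {0..T}" "A \<in> sets lebesgue" for A
    using set_integrable_subset[OF int that(2,1)] .
  have eq: "(LINT u|lebesgue_on {0..t}. h u) = (LINT u:{0..t}|lebesgue. h u)" for t
    by (simp add: set_lebesgue_integral_def integral_restrict_space)
  show "integrable (lebesgue_on {0..t}) h" if "t \<in> {0..T}"
    using sub[of "{0..t}"] that by (simp add: set_integrable_def integrable_restrict_space)
  have bound': "AE u in lebesgue. u \<in> {0..T} \<longrightarrow> norm (h u) \<le> B"
    using bound by (simp add: AE_restrict_space_iff)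
  have le: "norm ((LINT u:{0..s}|lebesgue. h u) - (LINT u:{0..t}|lebesgue. h u)) \<le> B * \<bar>s - t\<bar>"
    if st: "0 \<le> s" "s \<le> t" "t \<le> T" for s t
  proof -
    have Un: "{0..t} = {0..s} \<union> {s<..t}"
      using st by auto
    have "(LINT u:{0..t}|lebesgue. h u) = (LINT u:{0..s}|lebesgue. h u) + (LINT u:{s<..t}|lebesgue. h u)"
      unfolding Un by (rule set_integral_Un) (use st in \<open>auto intro!: sub\<close>)
    then have "norm ((LINT u:{0..s}|lebesgue. h u) - (LINT u:{0..t}|lebesgue. h u)) = norm (LINT u:{s<..t}|lebesgue. h u)"
      by simp
    also have "\<dots> \<le> (LINT u|lebesgue. norm (indicat_real {s<..t} u *\<^sub>R h u))"
      unfolding set_lebesgue_integral_def by (rule integral_norm_bound)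
    also have "\<dots> \<le> (LINT u|lebesgue. B * indicat_real {s<..t} u)"
    proof (rule integral_mono_AE)
      have "set_integrable lebesgue {s<..t} h"
        by (rule sub) (use st in auto)
      then show "integrable lebesgue (\<lambda>u. norm (indicat_real {s<..t} u *\<^sub>R h u))"
        unfolding set_integrable_def by (rule integrable_norm)
      have "integrable lebesgue (\<lambda>u. indicat_real {s<..t} u)"
        by (intro integrable_real_indicator) (use st in auto)
      then show "integrable lebesgue (\<lambda>u. B * indicat_real {s<..t} u)"
        by (rule integrable_mult_right)
      show "AE u in lebesgue. norm (indicat_real {s<..t} u *\<^sub>R h u) \<le> B * indicat_real {s<..t} u"
        using bound' by eventually_elim (use st in \<open>auto simp: indicator_def\<close>)
    qed
    also have "\<dots> = B * \<bar>s - t\<bar>"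
      using st by simp
    finally show ?thesis .
  qed
  show "norm ((LINT u|lebesgue_on {0..s}. h u) - (LINT u|lebesgue_on {0..t}. h u)) \<le> B * \<bar>s - t\<bar>"
    if "s \<in> {0..T}" "t \<in> {0..T}"
    unfolding eq using le[of s t] le[of t s] that
    by (cases "s \<le> t") (auto simp: norm_minus_commute abs_minus_commute)
qed

lemma norm_CR_trilinear_cube_le:
  assumes "norm F \<le> C"
  shows "norm (CR_trilinear F F F) \<le> 4 * C ^ 3"
proof -
  have "norm F ^ 3 \<le> C ^ 3"
    using assms by (intro power_mono) auto
  then show ?thesis
    using norm_CR_trilinear[of F F F] by (simp add: power3_eq_cube)
qed

text \<open>
  The hypothesis bounds \<open>f\<close> at almost every time only, which is enough to bound the integrand of the
  equation and hence the Lipschitz constant. As \<open>[0,T]\<close> has positive measure, there is a time \<open>t0\<close>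
  at which \<open>f\<close> is bounded by \<open>C\<close>; the Lipschitz estimate started from \<open>t0\<close> bounds \<open>f\<close> at every time.
\<close>
lemma CR_solution_estimates:
  assumes T: "T > 0" and sol: "CR_solution T f" and C: "Linf_norm T f \<le> ereal C"
  shows "\<And>s t. s \<in> {0..T} \<Longrightarrow> t \<in> {0..T} \<Longrightarrow> norm (f s - f t) \<le> 4 * C ^ 3 * \<bar>s - t\<bar>"
    and "\<And>t. t \<in> {0..T} \<Longrightarrow> norm (f t) \<le> C + 4 * C ^ 3 * T"
    and "0 \<le> C"
proof -
  have f_measurable: "f \<in> borel_measurable (lebesgue_on {0..T})"
    using sol by (simp add: CR_solution_def Linf_L2_def)
  have eq: "\<And>t. t \<in> {0..T} \<Longrightarrow> f t = f 0 + \<i> *\<^sub>C (LINT s|lebesgue_on {0..t}. CR_trilinear (f s) (f s) (f s))"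
    using sol unfolding CR_solution_def by blast
  have "AE t in lebesgue_on {0..T}. ereal (norm (f t)) \<le> Linf_norm T f"
    unfolding Linf_norm_def by (rule esssup_AE)
  then have ae: "AE t in lebesgue_on {0..T}. norm (f t) \<le> C"
    by eventually_elim (use C in \<open>metis ereal_less_eq(3) order_trans\<close>)
  have "emeasure (lebesgue_on {0..T}) (space (lebesgue_on {0..T})) \<noteq> 0"
    using T by (simp add: emeasure_restrict_space)
  then have "ae_filter (lebesgue_on {0..T}) \<noteq> bot"
    by (simp add: ae_filter_eq_bot_iff)
  moreover have "AE t in lebesgue_on {0..T}. t \<in> {0..T} \<and> norm (f t) \<le> C"
    using ae AE_space by eventually_elim simp
  ultimately obtain t0 where t0: "t0 \<in> {0..T}" "norm (f t0) \<le> C"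
    using eventually_happens' by blast
  show C0: "0 \<le> C"
    using t0(2) norm_ge_zero order_trans by blast
  have B: "AE s in lebesgue_on {0..T}. norm (CR_trilinear (f s) (f s) (f s)) \<le> 4 * C ^ 3"
    using ae by eventually_elim (rule norm_CR_trilinear_cube_le)
  show lip: "norm (f s - f t) \<le> 4 * C ^ 3 * \<bar>s - t\<bar>" if "s \<in> {0..T}" "t \<in> {0..T}" for s t
  proof -
    have "f s - f t = \<i> *\<^sub>C ((LINT u|lebesgue_on {0..s}. CR_trilinear (f u) (f u) (f u)) -
        (LINT u|lebesgue_on {0..t}. CR_trilinear (f u) (f u) (f u)))"
      unfolding eq[OF that(1)] eq[OF that(2)] scaleC_L2_diff_right by simp
    then show ?thesis
      using norm_primitive_diff_le[OF CR_trilinear_measurable[OF f_measurable] B that]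
      by (simp add: norm_scaleC_L2)
  qed
  show "norm (f t) \<le> C + 4 * C ^ 3 * T" if t: "t \<in> {0..T}" for t
  proof -
    have "norm (f t) \<le> norm (f t0) + norm (f t - f t0)"
      using norm_triangle_ineq[of "f t0" "f t - f t0"] by simp
    also have "norm (f t - f t0) \<le> 4 * C ^ 3 * \<bar>t - t0\<bar>"
      using t t0 by (intro lip)
    also have "4 * C ^ 3 * \<bar>t - t0\<bar> \<le> 4 * C ^ 3 * T"
      using t t0 C0 by (intro mult_left_mono) auto
    finally show ?thesis
      using t0(2) by simp
  qed
qed

text \<open>
  The equation is tested against a fixed vector. At every time the tested integrand converges by weak
  continuity of the operator, and it is bounded uniformly in \<open>n\<close> and in time, so that the time integrals
  converge as well.
\<close>
theorem CR_solution_weak_limit: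
  assumes T: "T > 0" and sol: "\<And>n. CR_solution T (F n)"
    and bound: "\<And>n t. t \<in> {0..T} \<Longrightarrow> norm (F n t) \<le> M"
    and lim: "\<And>t. t \<in> {0..T} \<Longrightarrow> weak_limit (\<lambda>n. F n t) (g t)"
    and g: "g \<in> Linf_L2 T"
  shows "CR_solution T g"
  unfolding CR_solution_def
proof (intro conjI ballI g)
  fix t assume t: "t \<in> {0..T}"
  let ?N = "\<lambda>X. CR_trilinear X X X"
  let ?L = "lebesgue_on {0..t}"
  have zero: "0 \<in> {0..T}"
    using T by simp
  have restrict: "f \<in> borel_measurable ?L" if "f \<in> Linf_L2 T" for f
  proof -
    have "f \<in> borel_measurable (lebesgue_on {0..T})"
      using that by (simp add: Linf_L2_def)
    then show ?thesis
      by (rule measurable_restrict_mono) (use t in auto)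
  qed
  have F_measurable: "F n \<in> borel_measurable ?L" for n
    using sol[of n] by (intro restrict) (simp add: CR_solution_def)
  have g_bound: "norm (g s) \<le> M" if "s \<in> {0..T}" for s
    using weak_limit_norm_le[OF lim[OF that]] bound[OF that] by blast
  have N_bound: "AE s in ?L. norm (?N (f s)) \<le> 4 * M ^ 3" if "\<And>s. s \<in> {0..T} \<Longrightarrow> norm (f s) \<le> M" for f
    using AE_space by eventually_elim (use t in \<open>auto intro!: norm_CR_trilinear_cube_le that\<close>)
  interpret finite_measure ?L
    by (rule finite_measure_lebesgue_on_interval)
  have N_int: "integrable ?L (\<lambda>s. ?N (f s))"
    if "\<And>s. s \<in> {0..T} \<Longrightarrow> norm (f s) \<le> M" "f \<in> borel_measurable ?L" for f
    using N_bound[OF that(1)] CR_trilinear_measurable[OF that(2)] by (rule integrable_const_bound)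
  have g_measurable: "g \<in> borel_measurable ?L"
    by (rule restrict[OF g])
  have conv: "(\<lambda>n. inner (LINT s|?L. ?N (F n s)) \<phi>) \<longlonglongrightarrow> inner (LINT s|?L. ?N (g s)) \<phi>" for \<phi>
  proof -
    have "(\<lambda>n. LINT s|?L. inner (?N (F n s)) \<phi>) \<longlonglongrightarrow> (LINT s|?L. inner (?N (g s)) \<phi>)"
    proof (rule integral_dominated_convergence[where w = "\<lambda>s. 4 * M ^ 3 * norm \<phi>"])
      show "(\<lambda>s. inner (?N (g s)) \<phi>) \<in> borel_measurable ?L" "(\<lambda>s. inner (?N (F n s)) \<phi>) \<in> borel_measurable ?L" for n
        by (intro borel_measurable_inner CR_trilinear_measurable g_measurable F_measurable borel_measurable_const)+
      show "AE s in ?L. (\<lambda>n. inner (?N (F n s)) \<phi>) \<longlonglongrightarrow> inner (?N (g s)) \<phi>"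
        using AE_space
      proof eventually_elim
        fix s assume "s \<in> space ?L"
        then have s: "s \<in> {0..T}" using t by simp
        show "(\<lambda>n. inner (?N (F n s)) \<phi>) \<longlonglongrightarrow> inner (?N (g s)) \<phi>"
          using weak_limit_CR_trilinear[OF lim[OF s] bound[OF s]] by (simp add: weak_limit_def)
      qed
      show "AE s in ?L. norm (inner (?N (F n s)) \<phi>) \<le> 4 * M ^ 3 * norm \<phi>" for n
      proof -
        have "AE s in ?L. norm (?N (F n s)) \<le> 4 * M ^ 3"
          by (rule N_bound) (rule bound)
        then show ?thesis
          by eventually_elim (auto intro: order_trans[OF Cauchy_Schwarz_ineq2 mult_right_mono])
      qed
    qed simp
    moreover have "integrable ?L (\<lambda>s. ?N (F n s))" for n
      by (rule N_int[of "F n", OF bound F_measurable])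
    moreover have "integrable ?L (\<lambda>s. ?N (g s))"
      by (rule N_int[of g, OF g_bound g_measurable])
    ultimately show ?thesis
      by simp
  qed
  have "\<forall>\<phi>. inner (g t) \<phi> = inner (g 0 + \<i> *\<^sub>C (LINT s|?L. ?N (g s))) \<phi>"
  proof (rule allI, rule LIMSEQ_unique)
    fix \<phi>
    show "(\<lambda>n. inner (F n t) \<phi>) \<longlonglongrightarrow> inner (g t) \<phi>"
      using lim[OF t] by (simp add: weak_limit_def)
    have "inner (F n t) \<phi> = inner (F n 0 + \<i> *\<^sub>C (LINT s|?L. ?N (F n s))) \<phi>" for n
      using sol[of n] t unfolding CR_solution_def by metis
    moreover have "(\<lambda>n. inner (F n 0 + \<i> *\<^sub>C (LINT s|?L. ?N (F n s))) \<phi>) \<longlonglongrightarrow>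
        inner (g 0 + \<i> *\<^sub>C (LINT s|?L. ?N (g s))) \<phi>"
      unfolding inner_add_left inner_scaleC_i_left
      using lim[OF zero] by (intro tendsto_add tendsto_minus conv) (simp add: weak_limit_def)
    ultimately show "(\<lambda>n. inner (F n t) \<phi>) \<longlonglongrightarrow> inner (g 0 + \<i> *\<^sub>C (LINT s|?L. ?N (g s))) \<phi>"
      by (simp only:)
  qed
  then show "g t = g 0 + \<i> *\<^sub>C (LINT s|?L. ?N (g s))"
    by (rule iffD1[OF vector_eq_rdot])
qed

text \<open>
  Dominated convergence in time, the dominating function being a multiple of the norm of the test
  function in \<open>L\<^sup>1([0,T],L\<^sup>2)\<close>.
\<close>
lemma weak_limit_imp_weak_star:
  assumes F: "\<And>n. F n \<in> Linf_L2 T" and g: "g \<in> Linf_L2 T"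
    and bound: "\<And>n t. t \<in> {0..T} \<Longrightarrow> norm (F n t) \<le> M"
    and lim: "\<And>t. t \<in> {0..T} \<Longrightarrow> weak_limit (\<lambda>n. F n t) (g t)"
  shows "limitin (weak_star_topology T) F g sequentially"
  unfolding limitin_weak_star_topology
proof (intro conjI ballI g always_eventually allI F)
  fix \<phi> assume "\<phi> \<in> L1_L2 T"
  then have \<phi>: "integrable (lebesgue_on {0..T}) \<phi>"
    by (simp add: L1_L2_def)
  show "(\<lambda>n. duality_pairing T (F n) \<phi>) \<longlonglongrightarrow> duality_pairing T g \<phi>"
    unfolding duality_pairing_def
  proof (rule integral_dominated_convergence[where w = "\<lambda>t. 2 * (M * norm (\<phi> t))"])
    show "(\<lambda>t. cinner_L2 (g t) (\<phi> t)) \<in> borel_measurable (lebesgue_on {0..T})"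
      "(\<lambda>t. cinner_L2 (F n t) (\<phi> t)) \<in> borel_measurable (lebesgue_on {0..T})" for n
      using F g \<phi> by (auto simp: Linf_L2_def intro!: cinner_L2_measurable)
    show "integrable (lebesgue_on {0..T}) (\<lambda>t. 2 * (M * norm (\<phi> t)))"
      using \<phi> by (intro integrable_mult_right integrable_norm)
    show "AE t in lebesgue_on {0..T}. (\<lambda>n. cinner_L2 (F n t) (\<phi> t)) \<longlonglongrightarrow> cinner_L2 (g t) (\<phi> t)"
      using AE_space by eventually_elim (auto intro!: weak_limit_cinner lim)
    show "AE t in lebesgue_on {0..T}. norm (cinner_L2 (F n t) (\<phi> t)) \<le> 2 * (M * norm (\<phi> t))" for n
      using AE_space
    proof eventually_elim
      fix t assume "t \<in> space (lebesgue_on {0..T})"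
      then have "norm (F n t) * norm (\<phi> t) \<le> M * norm (\<phi> t)"
        by (intro mult_right_mono bound) auto
      then show "norm (cinner_L2 (F n t) (\<phi> t)) \<le> 2 * (M * norm (\<phi> t))"
        using norm_cinner_L2_le[of "F n t" "\<phi> t"] by linarith
    qed
  qed
qed

lemma lipschitz_bounded_in_Linf_L2:
  assumes bound: "\<And>t. t \<in> {0..T} \<Longrightarrow> norm (g t) \<le> M"
    and lipschitz: "\<And>s t. s \<in> {0..T} \<Longrightarrow> t \<in> {0..T} \<Longrightarrow> norm (g s - g t) \<le> B * \<bar>s - t\<bar>" and B: "0 \<le> B"
  shows "g \<in> Linf_L2 T"
proof -
  have "continuous_on {0..T} g"
    by (rule lipschitz_on_continuous_on[of B], rule lipschitz_onI)
      (use lipschitz B in \<open>auto simp: dist_norm dist_real_def\<close>)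
  then have measurable: "g \<in> borel_measurable (lebesgue_on {0..T})"
    by (rule continuous_imp_measurable_on_sets_lebesgue) simp
  have "Linf_norm T g \<le> ereal M"
    unfolding Linf_norm_def
  proof (rule esssup_I)
    show "(\<lambda>t. ereal (norm (g t))) \<in> borel_measurable (lebesgue_on {0..T})"
      using measurable by measurable
    show "AE t in lebesgue_on {0..T}. ereal (norm (g t)) \<le> ereal M"
      using AE_space by eventually_elim (auto intro: bound)
  qed
  with measurable show ?thesis
    by (auto simp: Linf_L2_def intro: le_less_trans)
qed

theorem theorem2p10:
  fixes T :: real and f :: "nat \<Rightarrow> real \<Rightarrow> L2"
  assumes "T > 0"
    and "\<And>n. CR_solution T (f n)"
    and "\<exists>C :: real. \<forall>n. Linf_norm T (f n) \<le> ereal C"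
  shows "\<exists>g r. CR_solution T g \<and> strict_mono (r :: nat \<Rightarrow> nat) \<and>
           limitin (weak_star_topology T) (f \<circ> r) g sequentially"
proof -
  obtain C where "\<And>n. Linf_norm T (f n) \<le> ereal C"
    using assms(3) by blast
  note est = CR_solution_estimates[OF assms(1) assms(2) this]
  define B where "B = 4 * C ^ 3"
  define M where "M = C + 4 * C ^ 3 * T"
  have B: "0 \<le> B" and lipschitz: "\<And>n s t. s \<in> {0..T} \<Longrightarrow> t \<in> {0..T} \<Longrightarrow> norm (f n s - f n t) \<le> B * \<bar>s - t\<bar>"
    and bound: "\<And>n t. t \<in> {0..T} \<Longrightarrow> norm (f n t) \<le> M"
    using est by (auto simp: B_def M_def)
  obtain r g where r: "strict_mono r" and lim: "\<And>t. t \<in> {0..T} \<Longrightarrow> weak_limit (\<lambda>n. f (r n) t) (g t)"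
    using weak_Arzela_Ascoli[of "{0..T}" f M B] bound lipschitz by blast
  have "norm (g t) \<le> M" if "t \<in> {0..T}" for t
    using weak_limit_norm_le[OF lim[OF that]] bound[OF that] by blast
  moreover have "norm (g s - g t) \<le> B * \<bar>s - t\<bar>" if "s \<in> {0..T}" "t \<in> {0..T}" for s t
  proof (rule weak_limit_norm_le)
    show "weak_limit (\<lambda>n. f (r n) s - f (r n) t) (g s - g t)"
      using lim[OF that(1)] lim[OF that(2)] by (auto simp: weak_limit_def inner_diff_left intro!: tendsto_diff)
  qed (rule lipschitz[OF that])
  ultimately have g: "g \<in> Linf_L2 T"
    using B by (rule lipschitz_bounded_in_Linf_L2)
  have "CR_solution T g"
    by (rule CR_solution_weak_limit[OF assms(1) assms(2) bound lim g])
  moreover have "limitin (weak_star_topology T) (f \<circ> r) g sequentially"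
    unfolding o_def
    using assms(2) by (intro weak_limit_imp_weak_star[OF _ g bound lim]) (auto simp: CR_solution_def)
  ultimately show ?thesis
    using r by blast
qed

end
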